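(* Let $(\mathfrak g,\mathfrak k)$ be a Hermitian symmetric pair, let $\mathfrak q=\mathfrak l\oplus\mathfrak u$ be a $\theta$-stable parabolic subalgebra of $\mathfrak g$ with $\mathfrak l\subset\mathfrak k$ and $\mathfrak u\supset\mathfrak p^+$, and let $V$ be an admissible unitary $(\mathfrak g,K)$-module. Let $C$ and $C^-$ be the operators on $V\otimes S$ defined in the context, $C^{adj}$ and $(C^-)^{adj}$ their adjoints, and $\Delta=CC^{adj}+C^{adj}C$. Then: (a) $\operatorname{Ker}\Delta=\operatorname{Ker}C^-\cap\operatorname{Ker}(C^-)^{adj}$; (b) $V\otimes S=\operatorname{Ker}\Delta\oplus\operatorname{Im}C^-\oplus\operatorname{Im}(C^-)^{adj}$; (c) $\operatorname{Ker}C^-=\operatorname{Ker}\Delta\oplus\operatorname{Im}C^-$; (d) $\operatorname{Ker}(C^-)^{adj}=\operatorname{Ker}\Delta\oplus\operatorname{Im}(C^-)^{adj}$.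
   Context: $G$ is a connected semisimple Lie group with finite center, Lie algebra $\mathfrak g_0$, complexification $\mathfrak g$; $\theta$ a Cartan involution, $K=G^\theta$, $\mathfrak g=\mathfrak k\oplus\mathfrak p$ the complexified Cartan decomposition, $B$ the Killing form, bar denotes conjugation with respect to $\mathfrak g_0$. Hermitian symmetric: $\mathfrak p=\mathfrak p^+\oplus\mathfrak p^-$ with $\mathfrak p^\pm$ $K$-stable abelian subalgebras, conjugate to each other, and $\mathfrak k\oplus\mathfrak p^{+}$ parabolic with Levi factor $\mathfrak k$ and nilradical $\mathfrak p^+$. The $\theta$-stable parabolic $\mathfrak q=\mathfrak l\oplus\mathfrak u$ has Levi factor $\mathfrak l=\bar{\mathfrak l}$, nilradical $\mathfrak u$, and opposite parabolic $\mathfrak l\oplus\bar{\mathfrak u}$; $\mathfrak s=\mathfrak u\oplus\bar{\mathfrak u}$. $V$ is unitary if it carries a positive definite $K$-invariant Hermitian form for which $\mathfrak g_0$ acts by skew-Hermitian operators. $C(\mathfrak s)$ is the Clifford algebra with relations $vw+wv=2B(v,w)$, acting on $S=\bigwedge^\cdot\mathfrak u$ by $u\cdot Y=u\wedge Y$ ($u\in\mathfrak u$) and $u^*\cdot(Y_1\wedge\dots\wedge Y_p)=2\sum_i(-1)^{i+1}B(u^*,Y_i)Y_1\wedge\dots\widehat{Y_i}\dots\wedge Y_p$ ($u^*\in\bar{\mathfrak u}$). With $u_1,\dots,u_n$ a basis of $\mathfrak u$ and $u_i^*$ the $B$-dual basis of $\bar{\mathfrak u}$, $C$ and $C^-$ are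 the actions on $V\otimes S$ of the elements of $U(\mathfrak g)\otimes C(\mathfrak s)$ $$C=\sum_iu_i^*\otimes u_i-\tfrac14\sum_{i,j}1\otimes[u_i^*,u_j^*]u_iu_j,\qquad C^-=\sum_iu_i\otimes u_i^*-\tfrac14\sum_{i,j}1\otimes[u_i,u_j]u_i^*u_j^*$$ ($C$ is the $\bar{\mathfrak u}$-cohomology differential and $C^-$ is $-2$ times the $\mathfrak u$-homology differential). $\langle X,Y\rangle=-2B(X,\theta\bar Y)$ is a positive definite Hermitian form on $\mathfrak u$, extended to $S=\bigwedge^\cdot\mathfrak u$ by determinants; $V\otimes S$ carries the tensor product of this form with the unitary form on $V$. Adjoints are taken with respect to this form. *)

theory Defs
  imports
    "Jordan_Normal_Form.Determinant"
    "HOL-Analysis.Analysis"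
    "HOL-Algebra.Group"
    "HOL-Library.Function_Algebras"
begin

section \<open>Linear algebra over carriers\<close>

definition sum_of :: "'v::monoid_add set list \<Rightarrow> 'v set" where
  "sum_of Ws = sum_list ` listset Ws"

text \<open>\<open>direct_sum W [W1, \<dots>, Wk]\<close>: every element of \<^term>\<open>W\<close> is \<open>w1 + \<dots> + wk\<close> with \<open>wi \<in> Wi\<close>
  in exactly one way, and all such sums lie in \<^term>\<open>W\<close>.\<close>
definition direct_sum :: "'v::monoid_add set \<Rightarrow> 'v set list \<Rightarrow> bool" where
  "direct_sum W Ws \<longleftrightarrow> bij_betw sum_list (listset Ws) W"

definition kernel_on :: "'v set \<Rightarrow> ('v \<Rightarrow> 'w::zero) \<Rightarrow> 'v set" where
  "kernel_on W f = {x \<in> W. f x = 0}"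

definition finite_dimensional ::
  "(complex \<Rightarrow> 'v::ab_group_add \<Rightarrow> 'v) \<Rightarrow> 'v set \<Rightarrow> bool" where
  "finite_dimensional s W \<longleftrightarrow> (\<exists>F. finite F \<and> W \<subseteq> module.span s F)"

definition positive_hermitian_form ::
  "(complex \<Rightarrow> 'v::ab_group_add \<Rightarrow> 'v) \<Rightarrow> ('v \<Rightarrow> 'v \<Rightarrow> complex) \<Rightarrow> bool" where
  "positive_hermitian_form s h \<longleftrightarrow>
     (\<forall>x y z. h (x + y) z = h x z + h y z) \<and>
     (\<forall>c x y. h (s c x) y = c * h x y) \<and>
     (\<forall>x y. h y x = cnj (h x y)) \<and>
     (\<forall>x. x \<noteq> 0 \<longrightarrow> Re (h x x) > 0)"

text \<open>The adjoint with respect to the form \<^term>\<open>h\<close> on the (not necessarily complete) space \<^term>\<open>W\<close>.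
  It is unique on \<^term>\<open>W\<close> when \<^term>\<open>h\<close> is positive definite there; its existence is not built in.\<close>
definition adjoint_on :: "'v set \<Rightarrow> ('v \<Rightarrow> 'v \<Rightarrow> complex) \<Rightarrow> ('v \<Rightarrow> 'v) \<Rightarrow> 'v \<Rightarrow> 'v" where
  "adjoint_on W h f =
     (SOME f'. f' \<in> W \<rightarrow> W \<and> (\<forall>x\<in>W. \<forall>y\<in>W. h (f x) y = h x (f' y)))"


section \<open>Lie groups and their Lie algebras\<close>

primrec Ck_on :: "nat \<Rightarrow> ('x::euclidean_space \<Rightarrow> 'y::real_normed_vector) \<Rightarrow> 'x set \<Rightarrow> bool" where
  "Ck_on 0 f S \<longleftrightarrow> continuous_on S f"
| "Ck_on (Suc k) f S \<longleftrightarrow>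
     f differentiable_on S \<and> (\<forall>v. Ck_on k (\<lambda>x. frechet_derivative f (at x) v) S)"

text \<open>Only used for open \<^term>\<open>S\<close>.\<close>
definition smooth_on :: "('x::euclidean_space \<Rightarrow> 'y::real_normed_vector) \<Rightarrow> 'x set \<Rightarrow> bool" where
  "smooth_on f S \<longleftrightarrow> (\<forall>k. Ck_on k f S)"

definition smooth_atlas :: "'a topology \<Rightarrow> ('a set \<times> ('a \<Rightarrow> real^'n)) set \<Rightarrow> bool" where
  "smooth_atlas T A \<longleftrightarrow>
     (\<Union>(U, \<phi>)\<in>A. U) = topspace T \<and>
     (\<forall>(U, \<phi>)\<in>A. openin T U \<and> open (\<phi> ` U) \<and>
        homeomorphic_map (subtopology T U) (top_of_set (\<phi> ` U)) \<phi>) \<and>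
     (\<forall>(U, \<phi>)\<in>A. \<forall>(V, \<psi>)\<in>A. smooth_on (\<psi> \<circ> inv_into U \<phi>) (\<phi> ` (U \<inter> V)))"

text \<open>A group with a topology, an atlas modelled on \<open>\<real>\<^sup>n\<close>, a distinguished chart
  \<open>(edom, ecoord)\<close> around the identity, and the exponential map. The chart identifies the tangent space
  at the identity, i.e. the Lie algebra \<open>\<gg>\<^sub>0\<close>, with \<^typ>\<open>real^'n\<close>.\<close>
record ('a, 'n::finite) lie_grp = "'a monoid" +
  topo :: "'a topology"
  atlas :: "('a set \<times> ('a \<Rightarrow> real^'n)) set"
  edom :: "'a set"
  ecoord :: "'a \<Rightarrow> real^'n"
  expo :: "real^'n \<Rightarrow> 'a"

abbreviation eparam :: "('a, 'n::finite) lie_grp \<Rightarrow> real^'n \<Rightarrow> 'a" where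
  "eparam G \<equiv> inv_into (edom G) (ecoord G)"

abbreviation epoint :: "('a, 'n::finite) lie_grp \<Rightarrow> real^'n" where
  "epoint G \<equiv> ecoord G (one G)"

locale lie_group = group G for G :: "('a, 'n::finite) lie_grp" (structure) +
  assumes topspace_topo: "topspace (topo G) = carrier G"
    and Hausdorff: "Hausdorff_space (topo G)"
    and second_countable: "second_countable (topo G)"
    and atlas: "smooth_atlas (topo G) (atlas G)"
    and mult_continuous:
      "continuous_map (prod_topology (topo G) (topo G)) (topo G) (\<lambda>(x, y). x \<otimes> y)"
    and inv_continuous: "continuous_map (topo G) (topo G) (\<lambda>x. inv x)"
    and mult_smooth:
      "\<lbrakk>(U, \<phi>) \<in> atlas G; (V, \<psi>) \<in> atlas G; (W, \<omega>) \<in> atlas G\<rbrakk> \<Longrightarrow>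
       smooth_on (\<lambda>(x, y). \<omega> (inv_into U \<phi> x \<otimes> inv_into V \<psi> y))
         {(x, y). x \<in> \<phi> ` U \<and> y \<in> \<psi> ` V \<and> inv_into U \<phi> x \<otimes> inv_into V \<psi> y \<in> W}"
    and inv_smooth:
      "\<lbrakk>(U, \<phi>) \<in> atlas G; (W, \<omega>) \<in> atlas G\<rbrakk> \<Longrightarrow>
       smooth_on (\<lambda>x. \<omega> (inv (inv_into U \<phi> x))) {x \<in> \<phi> ` U. inv (inv_into U \<phi> x) \<in> W}"
    and identity_chart: "(edom G, ecoord G) \<in> atlas G" "\<one> \<in> edom G"
    and exp_closed: "expo G X \<in> carrier G"
    and exp_one_parameter: "expo G ((s + t) *\<^sub>R X) = expo G (s *\<^sub>R X) \<otimes> expo G (t *\<^sub>R X)"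
    and exp_continuous: "continuous_map euclideanreal (topo G) (\<lambda>t. expo G (t *\<^sub>R X))"
    and exp_velocity: "((\<lambda>t. ecoord G (expo G (t *\<^sub>R X))) has_vector_derivative X) (at 0)"

definition Ad0 :: "('a, 'n::finite) lie_grp \<Rightarrow> 'a \<Rightarrow> real^'n \<Rightarrow> real^'n" where
  "Ad0 G g = frechet_derivative
     (\<lambda>x. ecoord G (g \<otimes>\<^bsub>G\<^esub> eparam G x \<otimes>\<^bsub>G\<^esub> inv\<^bsub>G\<^esub> g)) (at (epoint G))"

text \<open>The Lie bracket of \<open>\<gg>\<^sub>0\<close>: \<open>ad\<close> is the differential of \<open>Ad\<close> at the identity.\<close>
definition lie_br0 :: "('a, 'n::finite) lie_grp \<Rightarrow> real^'n \<Rightarrow> real^'n \<Rightarrow> real^'n" where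
  "lie_br0 G X Y = frechet_derivative (\<lambda>x. Ad0 G (eparam G x) Y) (at (epoint G)) X"

definition killing :: "('k::field^'n \<Rightarrow> 'k^'n \<Rightarrow> 'k^'n) \<Rightarrow> 'k^'n \<Rightarrow> 'k^'n \<Rightarrow> 'k" where
  "killing br X Y = trace (matrix (\<lambda>Z. br X (br Y Z)))"

text \<open>A Lie algebra is semisimple if it has no nonzero abelian ideals.\<close>
definition semisimple0 :: "(real^'n \<Rightarrow> real^'n \<Rightarrow> real^'n) \<Rightarrow> bool" where
  "semisimple0 br \<longleftrightarrow>
     (\<forall>I. subspace I \<and> (\<forall>X. \<forall>Y\<in>I. br X Y \<in> I) \<and> (\<forall>X\<in>I. \<forall>Y\<in>I. br X Y = 0) \<longrightarrow> I = {0})"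

locale semisimple_lie_group = lie_group +
  assumes connected: "connected_space (topo G)"
    and semisimple: "semisimple0 (lie_br0 G)"
    and finite_center: "finite {z \<in> carrier G. \<forall>g\<in>carrier G. z \<otimes> g = g \<otimes> z}"

definition cartan_involution ::
  "(real^'n \<Rightarrow> real^'n \<Rightarrow> real^'n) \<Rightarrow> (real^'n \<Rightarrow> real^'n) \<Rightarrow> bool" where
  "cartan_involution br \<theta> \<longleftrightarrow>
     linear \<theta> \<and> (\<forall>X. \<theta> (\<theta> X) = X) \<and> (\<forall>X Y. \<theta> (br X Y) = br (\<theta> X) (\<theta> Y)) \<and>
     (\<forall>X. X \<noteq> 0 \<longrightarrow> - killing br X (\<theta> X) > 0)"

text \<open>\<^term>\<open>\<Theta>\<close> is the automorphism of \<^term>\<open>G\<close> with differential \<^term>\<open>\<theta>\<close>; since \<^term>\<open>G\<close> is connected it is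
  determined by \<open>\<Theta> \<circ> exp = exp \<circ> \<theta>\<close>.\<close>
locale cartan_pair = semisimple_lie_group G
  for G :: "('a, 'n::finite) lie_grp" (structure)
  and \<theta> :: "real^'n \<Rightarrow> real^'n" and \<Theta> :: "'a \<Rightarrow> 'a" +
  assumes cartan_involution: "cartan_involution (lie_br0 G) \<theta>"
    and Theta_hom: "\<Theta> \<in> hom G G"
    and Theta_differential: "\<Theta> (expo G X) = expo G (\<theta> X)"

definition fixed_group :: "('a, 'n::finite) lie_grp \<Rightarrow> ('a \<Rightarrow> 'a) \<Rightarrow> 'a set" where
  "fixed_group G \<Theta> = {g \<in> carrier G. \<Theta> g = g}"


section \<open>Complexification\<close>

text \<open>The complexification of \<^typ>\<open>real^'n\<close> is \<^typ>\<open>complex^'n\<close>.\<close>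

definition cvec :: "real^'n \<Rightarrow> complex^'n" where "cvec X = (\<chi> i. of_real (X $ i))"
definition re_vec :: "complex^'n \<Rightarrow> real^'n" where "re_vec Z = (\<chi> i. Re (Z $ i))"
definition im_vec :: "complex^'n \<Rightarrow> real^'n" where "im_vec Z = (\<chi> i. Im (Z $ i))"
definition conj_vec :: "complex^'n \<Rightarrow> complex^'n" where "conj_vec Z = (\<chi> i. cnj (Z $ i))"

definition complexify :: "(real^'n \<Rightarrow> real^'n) \<Rightarrow> complex^'n \<Rightarrow> complex^'n" where
  "complexify f Z = cvec (f (re_vec Z)) + \<i> *s cvec (f (im_vec Z))"

definition complexify2 ::
  "(real^'n \<Rightarrow> real^'n \<Rightarrow> real^'n) \<Rightarrow> complex^'n \<Rightarrow> complex^'n \<Rightarrow> complex^'n" where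
  "complexify2 f Z W =
     cvec (f (re_vec Z) (re_vec W) - f (im_vec Z) (im_vec W)) +
     \<i> *s cvec (f (re_vec Z) (im_vec W) + f (im_vec Z) (re_vec W))"

definition lie_br :: "('a, 'n::finite) lie_grp \<Rightarrow> complex^'n \<Rightarrow> complex^'n \<Rightarrow> complex^'n" where
  "lie_br G = complexify2 (lie_br0 G)"

definition kill :: "('a, 'n::finite) lie_grp \<Rightarrow> complex^'n \<Rightarrow> complex^'n \<Rightarrow> complex" where
  "kill G = killing (lie_br G)"

definition Ad :: "('a, 'n::finite) lie_grp \<Rightarrow> 'a \<Rightarrow> complex^'n \<Rightarrow> complex^'n" where
  "Ad G g = complexify (Ad0 G g)"

definition k_part :: "(real^'n \<Rightarrow> real^'n) \<Rightarrow> (complex^'n) set" where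
  "k_part \<theta> = {Z. complexify \<theta> Z = Z}"

definition p_part :: "(real^'n \<Rightarrow> real^'n) \<Rightarrow> (complex^'n) set" where
  "p_part \<theta> = {Z. complexify \<theta> Z = - Z}"


section \<open>Parabolic subalgebras\<close>

text \<open>Throughout, \<^term>\<open>br\<close> is the bracket of a complex Lie algebra on \<^typ>\<open>complex^'n\<close>.\<close>

definition lie_subalgebra :: "(complex^'n \<Rightarrow> complex^'n \<Rightarrow> complex^'n) \<Rightarrow> (complex^'n) set \<Rightarrow> bool" where
  "lie_subalgebra br q \<longleftrightarrow> vec.subspace q \<and> (\<forall>x\<in>q. \<forall>y\<in>q. br x y \<in> q)"

definition lie_ideal ::
  "(complex^'n \<Rightarrow> complex^'n \<Rightarrow> complex^'n) \<Rightarrow> (complex^'n) set \<Rightarrow> (complex^'n) set \<Rightarrow> bool" where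
  "lie_ideal br I q \<longleftrightarrow> vec.subspace I \<and> I \<subseteq> q \<and> (\<forall>x\<in>q. \<forall>y\<in>I. br x y \<in> I)"

definition bracket_span ::
  "(complex^'n \<Rightarrow> complex^'n \<Rightarrow> complex^'n) \<Rightarrow> (complex^'n) set \<Rightarrow> (complex^'n) set \<Rightarrow> (complex^'n) set" where
  "bracket_span br A B = vec.span {br x y |x y. x \<in> A \<and> y \<in> B}"

definition lie_solvable :: "(complex^'n \<Rightarrow> complex^'n \<Rightarrow> complex^'n) \<Rightarrow> (complex^'n) set \<Rightarrow> bool" where
  "lie_solvable br q \<longleftrightarrow> (\<exists>m. ((\<lambda>d. bracket_span br d d) ^^ m) q = {0})"

definition lie_nilpotent :: "(complex^'n \<Rightarrow> complex^'n \<Rightarrow> complex^'n) \<Rightarrow> (complex^'n) set \<Rightarrow> bool" where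
  "lie_nilpotent br q \<longleftrightarrow> (\<exists>m. ((\<lambda>d. bracket_span br q d) ^^ m) q = {0})"

definition borel_subalgebra :: "(complex^'n \<Rightarrow> complex^'n \<Rightarrow> complex^'n) \<Rightarrow> (complex^'n) set \<Rightarrow> bool" where
  "borel_subalgebra br b \<longleftrightarrow>
     lie_subalgebra br b \<and> lie_solvable br b \<and>
     (\<forall>b'. lie_subalgebra br b' \<and> lie_solvable br b' \<and> b \<subseteq> b' \<longrightarrow> b' = b)"

definition parabolic :: "(complex^'n \<Rightarrow> complex^'n \<Rightarrow> complex^'n) \<Rightarrow> (complex^'n) set \<Rightarrow> bool" where
  "parabolic br q \<longleftrightarrow> lie_subalgebra br q \<and> (\<exists>b. borel_subalgebra br b \<and> b \<subseteq> q)"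

text \<open>The largest nilpotent ideal. For a parabolic subalgebra of a semisimple Lie algebra this is the
  usual nilradical: the center of a Levi factor meets it trivially.\<close>
definition nilradical ::
  "(complex^'n \<Rightarrow> complex^'n \<Rightarrow> complex^'n) \<Rightarrow> (complex^'n) set \<Rightarrow> (complex^'n) set \<Rightarrow> bool" where
  "nilradical br q u \<longleftrightarrow>
     lie_ideal br u q \<and> lie_nilpotent br u \<and>
     (\<forall>I. lie_ideal br I q \<and> lie_nilpotent br I \<longrightarrow> I \<subseteq> u)"

text \<open>\<^term>\<open>q\<close> is parabolic with Levi factor \<^term>\<open>l\<close> and nilradical \<^term>\<open>u\<close>. A subalgebra complementary to
  \<^term>\<open>u\<close> is isomorphic to \<open>q/u\<close>, hence reductive.\<close>
definition parabolic_decomposition ::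
  "(complex^'n \<Rightarrow> complex^'n \<Rightarrow> complex^'n) \<Rightarrow>
     (complex^'n) set \<Rightarrow> (complex^'n) set \<Rightarrow> (complex^'n) set \<Rightarrow> bool" where
  "parabolic_decomposition br q l u \<longleftrightarrow>
     parabolic br q \<and> nilradical br q u \<and> lie_subalgebra br l \<and> direct_sum q [l, u]"

definition hermitian_symmetric ::
  "('a, 'n::finite) lie_grp \<Rightarrow> (real^'n \<Rightarrow> real^'n) \<Rightarrow> ('a \<Rightarrow> 'a) \<Rightarrow>
     (complex^'n) set \<Rightarrow> (complex^'n) set \<Rightarrow> bool" where
  "hermitian_symmetric G \<theta> \<Theta> pp pm \<longleftrightarrow>
     direct_sum (p_part \<theta>) [pp, pm] \<and>
     lie_subalgebra (lie_br G) pp \<and> lie_subalgebra (lie_br G) pm \<and>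
     (\<forall>x\<in>pp. \<forall>y\<in>pp. lie_br G x y = 0) \<and> (\<forall>x\<in>pm. \<forall>y\<in>pm. lie_br G x y = 0) \<and>
     (\<forall>g\<in>fixed_group G \<Theta>. Ad G g ` pp \<subseteq> pp \<and> Ad G g ` pm \<subseteq> pm) \<and>
     conj_vec ` pp = pm \<and>
     parabolic_decomposition (lie_br G) (sum_of [k_part \<theta>, pp]) (k_part \<theta>) pp"

text \<open>The last two conjuncts say that the conjugate \<open>l \<oplus> conj u\<close> of \<^term>\<open>q\<close> is an opposite parabolic.\<close>
definition theta_stable_parabolic ::
  "('a, 'n::finite) lie_grp \<Rightarrow> (real^'n \<Rightarrow> real^'n) \<Rightarrow>
     (complex^'n) set \<Rightarrow> (complex^'n) set \<Rightarrow> (complex^'n) set \<Rightarrow> bool" where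
  "theta_stable_parabolic G \<theta> q l u \<longleftrightarrow>
     parabolic_decomposition (lie_br G) q l u \<and>
     complexify \<theta> ` q = q \<and>
     conj_vec ` l = l \<and>
     parabolic_decomposition (lie_br G) (sum_of [l, conj_vec ` u]) l (conj_vec ` u) \<and>
     direct_sum UNIV [conj_vec ` u, l, u]"


section \<open>Unitary and admissible modules\<close>

text \<open>A \<open>(\<gg>, K)\<close>-module with underlying vector space the whole type \<^typ>\<open>'v\<close>. On a \<open>K\<close>-finite vector,
  continuity and differentiability can be tested against linear functionals, because every functional
  on a finite-dimensional subspace extends to \<^typ>\<open>'v\<close>.\<close>
locale gK_module = cartan_pair G \<theta> \<Theta>
  for G :: "('a, 'n::finite) lie_grp" (structure) and \<theta> \<Theta> +
  fixes s :: "complex \<Rightarrow> 'v::ab_group_add \<Rightarrow> 'v"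
    and \<rho> :: "complex^'n \<Rightarrow> 'v \<Rightarrow> 'v"
    and \<pi> :: "'a \<Rightarrow> 'v \<Rightarrow> 'v"
  assumes vector_space: "vector_space s"
    and rho_linear_left: "Vector_Spaces.linear (*s) s (\<lambda>Z. \<rho> Z v)"
    and rho_linear_right: "Vector_Spaces.linear s s (\<rho> Z)"
    and rho_bracket: "\<rho> (lie_br G Z W) v = \<rho> Z (\<rho> W v) - \<rho> W (\<rho> Z v)"
    and pi_linear: "g \<in> fixed_group G \<Theta> \<Longrightarrow> Vector_Spaces.linear s s (\<pi> g)"
    and pi_one: "\<pi> \<one> v = v"
    and pi_mult: "\<lbrakk>g \<in> fixed_group G \<Theta>; h \<in> fixed_group G \<Theta>\<rbrakk> \<Longrightarrow> \<pi> (g \<otimes> h) v = \<pi> g (\<pi> h v)"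
    and K_finite: "finite_dimensional s {\<pi> g v |g. g \<in> fixed_group G \<Theta>}"
    and pi_continuous: "Vector_Spaces.linear s (*) f \<Longrightarrow>
      continuous_map (subtopology (topo G) (fixed_group G \<Theta>)) euclidean (\<lambda>g. f (\<pi> g v))"
    and pi_differential: "\<lbrakk>Vector_Spaces.linear s (*) f; \<theta> X = X\<rbrakk> \<Longrightarrow>
      ((\<lambda>t. f (\<pi> (expo G (t *\<^sub>R X)) v)) has_vector_derivative f (\<rho> (cvec X) v)) (at 0)"
    and compatible: "g \<in> fixed_group G \<Theta> \<Longrightarrow> \<pi> g (\<rho> Z v) = \<rho> (Ad G g Z) (\<pi> g v)"

definition stable_subspace ::
  "'a set \<Rightarrow> (complex \<Rightarrow> 'v::ab_group_add \<Rightarrow> 'v) \<Rightarrow> ('a \<Rightarrow> 'v \<Rightarrow> 'v) \<Rightarrow> 'v set \<Rightarrow> bool" where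
  "stable_subspace K s \<pi> W \<longleftrightarrow> module.subspace s W \<and> (\<forall>g\<in>K. \<pi> g ` W \<subseteq> W)"

definition irreducible_subspace ::
  "'a set \<Rightarrow> (complex \<Rightarrow> 'v::ab_group_add \<Rightarrow> 'v) \<Rightarrow> ('a \<Rightarrow> 'v \<Rightarrow> 'v) \<Rightarrow> 'v set \<Rightarrow> bool" where
  "irreducible_subspace K s \<pi> W \<longleftrightarrow>
     stable_subspace K s \<pi> W \<and> W \<noteq> {0} \<and>
     (\<forall>W'. stable_subspace K s \<pi> W' \<and> W' \<subseteq> W \<longrightarrow> W' = {0} \<or> W' = W)"

definition equivalent_subspaces ::
  "'a set \<Rightarrow> (complex \<Rightarrow> 'v::ab_group_add \<Rightarrow> 'v) \<Rightarrow> ('a \<Rightarrow> 'v \<Rightarrow> 'v) \<Rightarrow> 'v set \<Rightarrow> 'v set \<Rightarrow> bool" where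
  "equivalent_subspaces K s \<pi> W W' \<longleftrightarrow>
     (\<exists>f. bij_betw f W W' \<and>
        (\<forall>x\<in>W. \<forall>y\<in>W. f (x + y) = f x + f y) \<and> (\<forall>c. \<forall>x\<in>W. f (s c x) = s c (f x)) \<and>
        (\<forall>g\<in>K. \<forall>x\<in>W. f (\<pi> g x) = \<pi> g (f x)))"

definition isotypic_component ::
  "'a set \<Rightarrow> (complex \<Rightarrow> 'v::ab_group_add \<Rightarrow> 'v) \<Rightarrow> ('a \<Rightarrow> 'v \<Rightarrow> 'v) \<Rightarrow> 'v set \<Rightarrow> 'v set" where
  "isotypic_component K s \<pi> W =
     module.span s (\<Union>{W'. stable_subspace K s \<pi> W' \<and> equivalent_subspaces K s \<pi> W W'})"

text \<open>Every \<open>K\<close>-type has finite multiplicity. It suffices to consider the \<open>K\<close>-types occurring in the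
  module, since the others have multiplicity zero.\<close>
definition admissible ::
  "'a set \<Rightarrow> (complex \<Rightarrow> 'v::ab_group_add \<Rightarrow> 'v) \<Rightarrow> ('a \<Rightarrow> 'v \<Rightarrow> 'v) \<Rightarrow> bool" where
  "admissible K s \<pi> \<longleftrightarrow>
     (\<forall>W. irreducible_subspace K s \<pi> W \<and> finite_dimensional s W \<longrightarrow>
        finite_dimensional s (isotypic_component K s \<pi> W))"

definition unitary_form ::
  "'a set \<Rightarrow> (complex \<Rightarrow> 'v::ab_group_add \<Rightarrow> 'v) \<Rightarrow> (complex^'n \<Rightarrow> 'v \<Rightarrow> 'v) \<Rightarrow> ('a \<Rightarrow> 'v \<Rightarrow> 'v) \<Rightarrow>
     ('v \<Rightarrow> 'v \<Rightarrow> complex) \<Rightarrow> bool" where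
  "unitary_form K s \<rho> \<pi> h \<longleftrightarrow>
     positive_hermitian_form s h \<and>
     (\<forall>g\<in>K. \<forall>v w. h (\<pi> g v) (\<pi> g w) = h v w) \<and>
     (\<forall>X v w. h (\<rho> (cvec X) v) w = - h v (\<rho> (cvec X) w))"


section \<open>The space \<open>V \<otimes> \<And> u\<close> and the Clifford action\<close>

text \<open>The Killing form \<^term>\<open>B\<close> identifies \<open>\<gg>\<close> with its dual, so \<open>\<And>\<^sup>p u\<close> embeds into the alternating
  \<open>p\<close>-linear forms on \<open>\<gg>\<close> by
  \<open>Y\<^sub>1 \<and> \<dots> \<and> Y\<^sub>p \<mapsto> ((Z\<^sub>1, \<dots>, Z\<^sub>p) \<mapsto> det (B(Z\<^sub>i, Y\<^sub>j)))\<close>. Accordingly \<open>V \<otimes> \<And> u\<close> is realized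
  as a space of \<open>V\<close>-valued functions of lists of elements of \<open>\<gg>\<close>, with \<open>v \<otimes> Y\<^sub>1 \<and> \<dots> \<and> Y\<^sub>p\<close> being
  \<open>decomposable s B v [Y\<^sub>1, \<dots>, Y\<^sub>p]\<close>. An operator \<open>X \<otimes> 1\<close> acts by composition with \<^term>\<open>\<rho> X\<close>.\<close>

definition gram_det :: "('g \<Rightarrow> 'h \<Rightarrow> complex) \<Rightarrow> 'g list \<Rightarrow> 'h list \<Rightarrow> complex" where
  "gram_det B Zs Ys = (if length Zs = length Ys
     then Determinant.det (Matrix.mat (length Ys) (length Ys) (\<lambda>(i, j). B (Zs ! i) (Ys ! j)))
     else 0)"

definition decomposable ::
  "(complex \<Rightarrow> 'v::ab_group_add \<Rightarrow> 'v) \<Rightarrow> ('g \<Rightarrow> 'g \<Rightarrow> complex) \<Rightarrow> 'v \<Rightarrow> 'g list \<Rightarrow> 'g list \<Rightarrow> 'v" where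
  "decomposable s B v Ys = (\<lambda>Zs. s (gram_det B Zs Ys) v)"

definition scale_fun ::
  "(complex \<Rightarrow> 'v \<Rightarrow> 'v) \<Rightarrow> complex \<Rightarrow> ('x \<Rightarrow> 'v) \<Rightarrow> 'x \<Rightarrow> 'v" where
  "scale_fun s c f = (\<lambda>x. s c (f x))"

definition V_tensor_S ::
  "(complex \<Rightarrow> 'v::ab_group_add \<Rightarrow> 'v) \<Rightarrow> ('g \<Rightarrow> 'g \<Rightarrow> complex) \<Rightarrow> 'g set \<Rightarrow> ('g list \<Rightarrow> 'v) set" where
  "V_tensor_S s B u = module.span (scale_fun s) {decomposable s B v Ys |v Ys. set Ys \<subseteq> u}"

definition remove_at :: "nat \<Rightarrow> 'g list \<Rightarrow> 'g list" where
  "remove_at i xs = take i xs @ drop (Suc i) xs"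

text \<open>The Clifford action of \<^term>\<open>Y\<close> in \<open>u\<close>, i.e. the exterior multiplication.\<close>
definition cl_u ::
  "(complex \<Rightarrow> 'v::ab_group_add \<Rightarrow> 'v) \<Rightarrow> ('g \<Rightarrow> 'g \<Rightarrow> complex) \<Rightarrow> 'g \<Rightarrow> ('g list \<Rightarrow> 'v) \<Rightarrow> 'g list \<Rightarrow> 'v" where
  "cl_u s B Y f = (\<lambda>Zs. \<Sum>i<length Zs. s ((-1) ^ i * B (Zs ! i) Y) (f (remove_at i Zs)))"

text \<open>The Clifford action of \<^term>\<open>W\<close> in \<open>conj u\<close>, i.e. twice the contraction.\<close>
definition cl_ubar ::
  "(complex \<Rightarrow> 'v::ab_group_add \<Rightarrow> 'v) \<Rightarrow> 'g \<Rightarrow> ('g list \<Rightarrow> 'v) \<Rightarrow> 'g list \<Rightarrow> 'v" where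
  "cl_ubar s W f = (\<lambda>Zs. s 2 (f (W # Zs)))"

lemma length_remove_at: "i < length xs \<Longrightarrow> length (remove_at i xs) = length xs - 1"
  by (simp add: remove_at_def)

lemma nth_remove_at:
  assumes "i < length xs" "k < length xs - 1"
  shows "remove_at i xs ! k = xs ! (if k < i then k else Suc k)"
  using assms by (auto simp: remove_at_def nth_append min_def)

lemma gram_det_Cons_left:
  "gram_det B (W # Zs) Ys = (\<Sum>j<length Ys. (-1) ^ j * B W (Ys ! j) * gram_det B Zs (remove_at j Ys))"
proof (cases "Suc (length Zs) = length Ys")
  case False
  then show ?thesis
    by (auto simp: gram_det_def length_remove_at intro!: sum.neutral)
next
  case True
  define p where "p = length Zs"
  let ?A = "Matrix.mat (Suc p) (Suc p) (\<lambda>(i, j). B ((W # Zs) ! i) (Ys ! j))"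
  have "gram_det B (W # Zs) Ys = Determinant.det ?A"
    using True by (simp add: gram_det_def p_def)
  also have "\<dots> = (\<Sum>j<Suc p. ?A $$ (0, j) * cofactor ?A 0 j)"
    by (rule laplace_expansion_row) auto
  also have "\<dots> = (\<Sum>j<Suc p. (-1) ^ j * B W (Ys ! j) * gram_det B Zs (remove_at j Ys))"
  proof (rule sum.cong, goal_cases)
    case (2 j)
    then have j: "j < length Ys" using True by (simp add: p_def)
    have "mat_delete ?A 0 j =
        Matrix.mat p p (\<lambda>(i, k). B (Zs ! i) (remove_at j Ys ! k))"
      by (rule eq_matI) (use True j in \<open>auto simp: mat_delete_def nth_remove_at p_def\<close>)
    moreover have "?A $$ (0, j) = B W (Ys ! j)" using 2 by simp
    moreover have "length (remove_at j Ys) = p" using True j by (simp add: length_remove_at p_def)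
    ultimately show ?case by (simp add: cofactor_def gram_det_def p_def)
  qed simp
  finally show ?thesis using True by (simp add: p_def)
qed

lemma gram_det_Cons_right:
  "gram_det B Zs (Y # Ys) = (\<Sum>i<length Zs. (-1) ^ i * B (Zs ! i) Y * gram_det B (remove_at i Zs) Ys)"
proof (cases "length Zs = Suc (length Ys)")
  case False
  then show ?thesis
    by (auto simp: gram_det_def length_remove_at intro!: sum.neutral)
next
  case True
  define p where "p = length Ys"
  let ?A = "Matrix.mat (Suc p) (Suc p) (\<lambda>(i, j). B (Zs ! i) ((Y # Ys) ! j))"
  have "gram_det B Zs (Y # Ys) = Determinant.det ?A"
    using True by (simp add: gram_det_def p_def)
  also have "\<dots> = (\<Sum>i<Suc p. ?A $$ (i, 0) * cofactor ?A i 0)"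
    by (rule laplace_expansion_column) auto
  also have "\<dots> = (\<Sum>i<Suc p. (-1) ^ i * B (Zs ! i) Y * gram_det B (remove_at i Zs) Ys)"
  proof (rule sum.cong, goal_cases)
    case (2 i)
    then have i: "i < length Zs" using True by (simp add: p_def)
    have "mat_delete ?A i 0 =
        Matrix.mat p p (\<lambda>(k, j). B (remove_at i Zs ! k) (Ys ! j))"
      by (rule eq_matI) (use True i in \<open>auto simp: mat_delete_def nth_remove_at p_def\<close>)
    moreover have "?A $$ (i, 0) = B (Zs ! i) Y" using 2 by simp
    moreover have "length (remove_at i Zs) = p" using True i by (simp add: length_remove_at p_def)
    ultimately show ?case by (simp add: cofactor_def gram_det_def p_def)
  qed simp
  finally show ?thesis using True by (simp add: p_def)
qed

text \<open>The two operators act on decomposable tensors by the defining formulas of the spin module.\<close>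

lemma cl_u_decomposable:
  assumes "vector_space s"
  shows "cl_u s B Y (decomposable s B v Ys) = decomposable s B v (Y # Ys)"
proof -
  interpret vector_space s by fact
  show ?thesis
    by (auto simp: cl_u_def decomposable_def gram_det_Cons_right scale_sum_left intro!: ext)
qed

lemma sum_fun_apply: "(\<Sum>j\<in>J. F j) x = (\<Sum>j\<in>J. F j x)" for F :: "'i \<Rightarrow> 'x \<Rightarrow> 'v::comm_monoid_add"
  by (induction J rule: infinite_finite_induct) auto

lemma cl_ubar_decomposable:
  assumes "vector_space s"
  shows "cl_ubar s W (decomposable s B v Ys) =
    (\<Sum>j<length Ys. scale_fun s (2 * (-1) ^ j * B W (Ys ! j)) (decomposable s B v (remove_at j Ys)))"
proof -
  interpret vector_space s by fact
  show ?thesis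
    by (auto simp: cl_ubar_def decomposable_def gram_det_Cons_left scale_sum_left scale_sum_right
        scale_fun_def sum_fun_apply mult.assoc intro!: ext sum.cong)
qed

text \<open>\<^term>\<open>ub\<close> is a basis of \<^term>\<open>u\<close> indexed by \<open>{..<n}\<close>, and \<^term>\<open>us\<close> the \<^term>\<open>B\<close>-dual basis of
  \<open>conj u\<close>.\<close>
definition dual_bases ::
  "(complex^'n \<Rightarrow> complex^'n \<Rightarrow> complex) \<Rightarrow> (complex^'n) set \<Rightarrow>
     nat \<Rightarrow> (nat \<Rightarrow> complex^'n) \<Rightarrow> (nat \<Rightarrow> complex^'n) \<Rightarrow> bool" where
  "dual_bases B u n ub us \<longleftrightarrow>
     inj_on ub {..<n} \<and> vec.independent (ub ` {..<n}) \<and> vec.span (ub ` {..<n}) = u \<and>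
     inj_on us {..<n} \<and> vec.independent (us ` {..<n}) \<and> vec.span (us ` {..<n}) = conj_vec ` u \<and>
     (\<forall>i<n. \<forall>j<n. B (us i) (ub j) = (if i = j then 1 else 0))"

definition C_op ::
  "('a, 'n::finite) lie_grp \<Rightarrow> (complex \<Rightarrow> 'v::ab_group_add \<Rightarrow> 'v) \<Rightarrow> (complex^'n \<Rightarrow> 'v \<Rightarrow> 'v) \<Rightarrow>
     nat \<Rightarrow> (nat \<Rightarrow> complex^'n) \<Rightarrow> (nat \<Rightarrow> complex^'n) \<Rightarrow>
     ((complex^'n) list \<Rightarrow> 'v) \<Rightarrow> (complex^'n) list \<Rightarrow> 'v" where
  "C_op G s \<rho> n ub us f =
     (\<Sum>i<n. cl_u s (kill G) (ub i) (\<rho> (us i) \<circ> f)) -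
     scale_fun s (1/4) (\<Sum>i<n. \<Sum>j<n.
       cl_ubar s (lie_br G (us i) (us j)) (cl_u s (kill G) (ub i) (cl_u s (kill G) (ub j) f)))"

definition C_minus ::
  "('a, 'n::finite) lie_grp \<Rightarrow> (complex \<Rightarrow> 'v::ab_group_add \<Rightarrow> 'v) \<Rightarrow> (complex^'n \<Rightarrow> 'v \<Rightarrow> 'v) \<Rightarrow>
     nat \<Rightarrow> (nat \<Rightarrow> complex^'n) \<Rightarrow> (nat \<Rightarrow> complex^'n) \<Rightarrow>
     ((complex^'n) list \<Rightarrow> 'v) \<Rightarrow> (complex^'n) list \<Rightarrow> 'v" where
  "C_minus G s \<rho> n ub us f =
     (\<Sum>i<n. cl_ubar s (us i) (\<rho> (ub i) \<circ> f)) -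
     scale_fun s (1/4) (\<Sum>i<n. \<Sum>j<n.
       cl_u s (kill G) (lie_br G (ub i) (ub j)) (cl_ubar s (us i) (cl_ubar s (us j) f)))"

definition herm_u ::
  "('a, 'n::finite) lie_grp \<Rightarrow> (real^'n \<Rightarrow> real^'n) \<Rightarrow> complex^'n \<Rightarrow> complex^'n \<Rightarrow> complex" where
  "herm_u G \<theta> X Y = - 2 * kill G X (complexify \<theta> (conj_vec Y))"

text \<open>\<^term>\<open>H\<close> is the tensor product of the form \<^term>\<open>h\<close> on \<open>V\<close> with the extension by determinants to
  \<open>\<And> u\<close> of \<^term>\<open>herm_u G \<theta>\<close>; these conditions determine \<^term>\<open>H\<close> on \<open>V \<otimes> S\<close>.\<close>
definition tensor_form ::
  "('a, 'n::finite) lie_grp \<Rightarrow> (real^'n \<Rightarrow> real^'n) \<Rightarrow> (complex \<Rightarrow> 'v::ab_group_add \<Rightarrow> 'v) \<Rightarrow>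
     ('v \<Rightarrow> 'v \<Rightarrow> complex) \<Rightarrow> (complex^'n) set \<Rightarrow>
     (((complex^'n) list \<Rightarrow> 'v) \<Rightarrow> ((complex^'n) list \<Rightarrow> 'v) \<Rightarrow> complex) \<Rightarrow> bool" where
  "tensor_form G \<theta> s h u H \<longleftrightarrow>
     (\<forall>x\<in>V_tensor_S s (kill G) u. \<forall>y\<in>V_tensor_S s (kill G) u. \<forall>z\<in>V_tensor_S s (kill G) u. \<forall>c.
        H (x + y) z = H x z + H y z \<and> H (scale_fun s c x) z = c * H x z \<and>
        H z (x + y) = H z x + H z y \<and> H z (scale_fun s c x) = cnj c * H z x) \<and>
     (\<forall>v v' Ys Ys'. set Ys \<subseteq> u \<and> set Ys' \<subseteq> u \<longrightarrow>
        H (decomposable s (kill G) v Ys) (decomposable s (kill G) v' Ys') =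
          h v v' * gram_det (herm_u G \<theta>) Ys Ys')"

definition laplacian ::
  "'w set \<Rightarrow> ('w \<Rightarrow> 'w \<Rightarrow> complex) \<Rightarrow> ('w \<Rightarrow> 'w) \<Rightarrow> 'w::plus \<Rightarrow> 'w" where
  "laplacian W H C x = C (adjoint_on W H C x) + adjoint_on W H C (C x)"

end

theory Submission
  imports Defs
begin

text \<open>Write \<open>u = (u \<inter> k) \<oplus> p\<^sup>+\<close> and split \<open>C = A + D\<close>, where \<open>D\<close> is the part of the linear term indexed by
  \<open>p\<^sup>+\<close>. Because the Hermitian form on \<open>u\<close> involves the Cartan involution, the adjoint of \<open>C\<close> is \<open>C\<^sup>-\<close> formed
  with the twisted action \<open>\<rho> \<circ> \<theta>\<close>, and the adjoint of \<open>C\<^sup>-\<close> is \<open>C\<close> formed with \<open>\<rho> \<circ> \<theta>\<close>, that is \<open>A - D\<close>.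
  The mixed anticommutator of \<open>A\<close> with the adjoint of \<open>D\<close> vanishes since that adjoint comes from a \<open>k\<close>-invariant
  tensor; hence \<open>C\<close> and \<open>C\<^sup>-\<close> have the same Laplacian. This Laplacian is locally finite: modulo terms that only
  involve the action of \<open>k\<close> it equals a multiple of \<open>\<Sum>\<^sub>j \<rho>(u\<^sub>j) \<rho>(u\<^sub>j\<^sup>*)\<close> (sum over a basis of \<open>p\<^sup>+\<close>), which
  commutes with \<open>K\<close> and so preserves the finite-dimensional isotypic components. The Hodge decomposition then
  reduces to finite-dimensional linear algebra and \<open>(C\<^sup>-)\<^sup>2 = 0\<close>.\<close>

section \<open>The Lie algebra of a Lie group\<close>

text \<open>V may be infinite-dimensional and is not assumed complete, so adjoints are exhibited by
  explicit formulas, and a splitting into kernel and image is available only on finite-dimensional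
  subspaces that the Laplacian preserves. The vanishing of C^2 and of the mixed terms is not checked
  by expansion in the Clifford algebra but by contraction: an operator on V \<otimes> S whose values
  have no component in exterior degree 0, and which commutes up to a fixed scalar with contraction
  by a basis of conj u, is zero. By Cartan's formula, C and contraction by X anticommute to twice
  the action of X on V \<otimes> S, so both claims become statements about invariance. The operator
  A is C formed with \<rho> composed with the projection onto k along p; this composite is linear
  but in general not a representation, so Cartan's formula is proved for arbitrary linear families.
  Reordering creation and contraction produces traces of ad X on u or conj u; they vanish because u
  is nilpotent. The bracket is given only as a derivative of Ad in a chart, so its algebraic laws
  come from calculus on the group.\<close>

lemma smooth_onD_differentiable: "smooth_on f S \<Longrightarrow> f differentiable_on S"
  unfolding smooth_on_def by (metis Ck_on.simps(2))

lemma smooth_onD_frechet: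
  "smooth_on f S \<Longrightarrow> (\<lambda>x. frechet_derivative f (at x) v) differentiable_on S"
  unfolding smooth_on_def by (metis Ck_on.simps(2))

lemma frechet_derivative_at_eventually_cong:
  assumes "(f has_derivative f') (at x)" "eventually (\<lambda>y. f y = g y) (nhds x)"
  shows "frechet_derivative g (at x) = f'"
proof -
  have "(g has_derivative f') (at x)"
    by (rule has_derivative_transform_eventually[OF assms(1)])
      (use assms(2) in \<open>auto simp: eventually_at_filter elim: eventually_mono dest: eventually_nhds_x_imp_x\<close>)
  then show ?thesis by (simp add: frechet_derivative_at[symmetric])
qed

section \<open>Group operations read in charts\<close>

context lie_group
begin

lemma chart_props:
  assumes "(U, \<phi>) \<in> atlas G"
  shows "openin (topo G) U" "U \<subseteq> carrier G" "open (\<phi> ` U)" "inj_on \<phi> U"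
    "continuous_map (top_of_set (\<phi> ` U)) (topo G) (inv_into U \<phi>)"
    "homeomorphic_map (subtopology (topo G) U) (top_of_set (\<phi> ` U)) \<phi>"
proof -
  have *: "openin (topo G) U" "open (\<phi> ` U)"
     "homeomorphic_map (subtopology (topo G) U) (top_of_set (\<phi> ` U)) \<phi>"
    using atlas assms unfolding smooth_atlas_def by auto
  show "openin (topo G) U" "open (\<phi> ` U)"
    "homeomorphic_map (subtopology (topo G) U) (top_of_set (\<phi> ` U)) \<phi>" using * by auto
  show sub: "U \<subseteq> carrier G" using openin_subset[OF *(1)] topspace_topo by auto
  then have tU: "topspace (subtopology (topo G) U) = U" using topspace_topo by auto
  show inj: "inj_on \<phi> U" using homeomorphic_imp_injective_map[OF *(3)] tU by simp
  from *(3) obtain g where g: "homeomorphic_maps (subtopology (topo G) U) (top_of_set (\<phi> ` U)) \<phi> g"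
    using homeomorphic_map_maps by blast
  then have "continuous_map (top_of_set (\<phi> ` U)) (subtopology (topo G) U) g"
    by (simp add: homeomorphic_maps_def)
  then have cg: "continuous_map (top_of_set (\<phi> ` U)) (topo G) g"
    using continuous_map_in_subtopology by blast
  have "g y = inv_into U \<phi> y" if y: "y \<in> \<phi> ` U" for y
  proof -
    obtain x where x: "x \<in> U" "y = \<phi> x" using y by auto
    then have "g y = x" using g tU by (auto simp: homeomorphic_maps_def)
    then show ?thesis using x inj by (simp add: inv_into_f_f)
  qed
  then show "continuous_map (top_of_set (\<phi> ` U)) (topo G) (inv_into U \<phi>)"
    using cg by (metis (no_types, lifting) continuous_map_eq topspace_euclidean_subtopology)
qed

lemma chart_exists:
  assumes "g \<in> carrier G"
  obtains U \<phi> where "(U, \<phi>) \<in> atlas G" "g \<in> U"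
proof -
  have "g \<in> (\<Union>(U, \<phi>)\<in>atlas G. U)" using atlas assms topspace_topo unfolding smooth_atlas_def by blast
  then show ?thesis using that by auto
qed

definition mult_dom where
  "mult_dom U \<phi> V \<psi> W =
    {(x, y). x \<in> \<phi> ` U \<and> y \<in> \<psi> ` V \<and> inv_into U \<phi> x \<otimes> inv_into V \<psi> y \<in> W}"

lemma continuous_map_mult:
  "continuous_map X (topo G) f \<Longrightarrow> continuous_map X (topo G) g \<Longrightarrow>
   continuous_map X (topo G) (\<lambda>x. f x \<otimes> g x)"
  using continuous_map_compose[OF _ mult_continuous, of X "\<lambda>x. (f x, g x)"]
  by (simp add: continuous_map_paired o_def)

lemma open_preimage:
  assumes "open S" "continuous_map (top_of_set S) (topo G) f" "openin (topo G) W"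
  shows "open {x\<in>S. f x \<in> W}"
  using openin_continuous_map_preimage[OF assms(2,3)] assms(1)
  by (simp add: openin_open_eq)

lemma open_mult_dom:
  assumes U: "(U, \<phi>) \<in> atlas G" and V: "(V, \<psi>) \<in> atlas G" and W: "(W, \<omega>) \<in> atlas G"
  shows "open (mult_dom U \<phi> V \<psi> W)"
proof -
  have "open (\<phi> ` U \<times> \<psi> ` V)" using chart_props(3)[OF U] chart_props(3)[OF V] by (rule open_Times)
  moreover have "continuous_map (top_of_set (\<phi> ` U \<times> \<psi> ` V)) (topo G)
      (\<lambda>z. inv_into U \<phi> (fst z) \<otimes> inv_into V \<psi> (snd z))"
  proof (rule continuous_map_mult)
    have "continuous_map (top_of_set (\<phi> ` U \<times> \<psi> ` V)) (top_of_set (\<phi> ` U)) fst"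
      by (auto intro!: continuous_intros)
    from continuous_map_compose[OF this chart_props(5)[OF U]]
    show "continuous_map (top_of_set (\<phi> ` U \<times> \<psi> ` V)) (topo G) (\<lambda>z. inv_into U \<phi> (fst z))"
      by (simp add: o_def)
    have "continuous_map (top_of_set (\<phi> ` U \<times> \<psi> ` V)) (top_of_set (\<psi> ` V)) snd"
      by (auto intro!: continuous_intros)
    from continuous_map_compose[OF this chart_props(5)[OF V]]
    show "continuous_map (top_of_set (\<phi> ` U \<times> \<psi> ` V)) (topo G) (\<lambda>z. inv_into V \<psi> (snd z))"
      by (simp add: o_def)
  qed
  ultimately have "open {z \<in> \<phi> ` U \<times> \<psi> ` V. inv_into U \<phi> (fst z) \<otimes> inv_into V \<psi> (snd z) \<in> W}"
    using open_preimage chart_props(1)[OF W] by blast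
  moreover have "{z \<in> \<phi> ` U \<times> \<psi> ` V. inv_into U \<phi> (fst z) \<otimes> inv_into V \<psi> (snd z) \<in> W} = mult_dom U \<phi> V \<psi> W"
    by (auto simp: mult_dom_def)
  ultimately show ?thesis by simp
qed

lemma mult_differentiable:
  assumes U: "(U, \<phi>) \<in> atlas G" and V: "(V, \<psi>) \<in> atlas G" and W: "(W, \<omega>) \<in> atlas G"
    and z: "z \<in> mult_dom U \<phi> V \<psi> W"
  shows "(\<lambda>(x, y). \<omega> (inv_into U \<phi> x \<otimes> inv_into V \<psi> y)) differentiable (at z)"
  using smooth_onD_differentiable[OF mult_smooth[OF U V W]] z open_mult_dom[OF U V W]
  unfolding mult_dom_def[symmetric] differentiable_on_eq_differentiable_at[OF open_mult_dom[OF U V W]]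
  by auto

text \<open>A chart around g turns translation by g into the chart expression of the multiplication
  with its first coordinate frozen at \<open>\<phi> g\<close>.\<close>

lemma left_mult_differentiable:
  assumes V: "(V, \<psi>) \<in> atlas G" and W: "(W, \<omega>) \<in> atlas G"
    and g: "g \<in> carrier G" and y: "y \<in> \<psi> ` V" and gy: "g \<otimes> inv_into V \<psi> y \<in> W"
  shows "(\<lambda>y. \<omega> (g \<otimes> inv_into V \<psi> y)) differentiable (at y)"
proof -
  obtain U \<phi> where U: "(U, \<phi>) \<in> atlas G" "g \<in> U" using chart_exists[OF g] by blast
  have inv: "inv_into U \<phi> (\<phi> g) = g" using chart_props(4)[OF U(1)] U(2) by simp
  have "(\<phi> g, y) \<in> mult_dom U \<phi> V \<psi> W" using U y gy inv by (auto simp: mult_dom_def)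
  from mult_differentiable[OF U(1) V W this]
  have "(\<lambda>(x, y). \<omega> (inv_into U \<phi> x \<otimes> inv_into V \<psi> y)) differentiable (at (\<phi> g, y))" .
  from differentiable_chain_at[where f="\<lambda>y. (\<phi> g, y)", OF _ this]
  show ?thesis by (simp add: o_def inv)
qed

lemma right_mult_differentiable:
  assumes V: "(V, \<psi>) \<in> atlas G" and W: "(W, \<omega>) \<in> atlas G"
    and g: "g \<in> carrier G" and y: "y \<in> \<psi> ` V" and gy: "inv_into V \<psi> y \<otimes> g \<in> W"
  shows "(\<lambda>y. \<omega> (inv_into V \<psi> y \<otimes> g)) differentiable (at y)"
proof -
  obtain U \<phi> where U: "(U, \<phi>) \<in> atlas G" "g \<in> U" using chart_exists[OF g] by blast
  have inv: "inv_into U \<phi> (\<phi> g) = g" using chart_props(4)[OF U(1)] U(2) by simp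
  have "(y, \<phi> g) \<in> mult_dom V \<psi> U \<phi> W" using U y gy inv by (auto simp: mult_dom_def)
  from mult_differentiable[OF V U(1) W this]
  have "(\<lambda>(x, y). \<omega> (inv_into V \<psi> x \<otimes> inv_into U \<phi> y)) differentiable (at (y, \<phi> g))" .
  from differentiable_chain_at[where f="\<lambda>y. (y, \<phi> g)", OF _ this]
  show ?thesis by (simp add: o_def inv)
qed

section \<open>The identity chart and the adjoint representation\<close>

abbreviation "Ue \<equiv> edom G"
abbreviation "\<phi>e \<equiv> ecoord G"
abbreviation "\<psi>e \<equiv> eparam G"
abbreviation "pe \<equiv> epoint G"

definition conj_chart where "conj_chart g y = \<phi>e (g \<otimes> \<psi>e y \<otimes> inv g)"

lemma psi_phi: "g \<in> Ue \<Longrightarrow> \<psi>e (\<phi>e g) = g"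
  using chart_props(4)[OF identity_chart(1)] by simp

lemma phi_psi: "x \<in> \<phi>e ` Ue \<Longrightarrow> \<phi>e (\<psi>e x) = x"
  by (simp add: f_inv_into_f)

lemma psi_in: "x \<in> \<phi>e ` Ue \<Longrightarrow> \<psi>e x \<in> Ue" "x \<in> \<phi>e ` Ue \<Longrightarrow> \<psi>e x \<in> carrier G"
  using chart_props(2)[OF identity_chart(1)] by (auto simp: inv_into_into subset_iff)

lemma psi_pe [simp]: "\<psi>e pe = \<one>" by (simp add: psi_phi identity_chart)
lemma pe_in [simp]: "pe \<in> \<phi>e ` Ue" using identity_chart by auto

lemma open_chart: "open (\<phi>e ` Ue)" using chart_props(3)[OF identity_chart(1)] .

lemma conj_chart_pe [simp]: "g \<in> carrier G \<Longrightarrow> conj_chart g pe = pe"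
  by (simp add: conj_chart_def)

lemma continuous_map_const_mult:
  "g \<in> carrier G \<Longrightarrow> continuous_map X (topo G) f \<Longrightarrow> continuous_map X (topo G) (\<lambda>x. g \<otimes> f x)"
  "g \<in> carrier G \<Longrightarrow> continuous_map X (topo G) f \<Longrightarrow> continuous_map X (topo G) (\<lambda>x. f x \<otimes> g)"
  by (rule continuous_map_mult; simp add: topspace_topo)+

lemma eventually_chart:
  assumes f: "continuous_map (top_of_set (\<phi>e ` Ue)) (topo G) f" and W: "openin (topo G) W"
    and x: "x \<in> \<phi>e ` Ue" "f x \<in> W"
  shows "eventually (\<lambda>y. y \<in> \<phi>e ` Ue \<and> f y \<in> W) (nhds x)"
proof -
  have "open {y \<in> \<phi>e ` Ue. f y \<in> W}"
    by (rule open_preimage[OF open_chart f W])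
  then show ?thesis
    using x unfolding eventually_nhds by (intro exI[of _ "{y \<in> \<phi>e ` Ue. f y \<in> W}"]) auto
qed

lemma continuous_conj:
  assumes g: "g \<in> carrier G"
  shows "continuous_map (top_of_set (\<phi>e ` Ue)) (topo G) (\<lambda>y. g \<otimes> \<psi>e y \<otimes> inv g)"
  by (intro continuous_map_const_mult chart_props(5) identity_chart inv_closed g)

lemma eventually_conj:
  assumes g: "g \<in> carrier G"
  shows "eventually (\<lambda>y. y \<in> \<phi>e ` Ue \<and> g \<otimes> \<psi>e y \<otimes> inv g \<in> Ue) (nhds pe)"
  by (rule eventually_chart[OF continuous_conj[OF g]])
    (use chart_props[OF identity_chart(1)] identity_chart g in auto)

text \<open>For x near the identity the product of g with x lies near g, possibly outside the
  identity chart. Conjugation is therefore factored through a chart around g: left translation leads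
  into it, right translation by the inverse leads back.\<close>

lemma conj_chart_differentiable:
  assumes g: "g \<in> carrier G"
  shows "conj_chart g differentiable (at pe)"
proof -
  obtain V \<kappa> where V: "(V, \<kappa>) \<in> atlas G" "g \<in> V" using chart_exists[OF g] by blast
  have inv: "inv_into V \<kappa> (\<kappa> h) = h" if "h \<in> V" for h using chart_props(4)[OF V(1)] that by simp
  have 1: "(\<lambda>y. \<kappa> (g \<otimes> \<psi>e y)) differentiable (at pe)"
    by (rule left_mult_differentiable[OF identity_chart(1) V(1) g]) (use g V in auto)
  have 2: "(\<lambda>z. \<phi>e (inv_into V \<kappa> z \<otimes> inv g)) differentiable (at (\<kappa> (g \<otimes> \<psi>e pe)))"
    by (rule right_mult_differentiable[OF V(1) identity_chart(1)]) (use g V inv identity_chart in auto)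
  have 3: "((\<lambda>z. \<phi>e (inv_into V \<kappa> z \<otimes> inv g)) \<circ> (\<lambda>y. \<kappa> (g \<otimes> \<psi>e y))) differentiable (at pe)"
    by (rule differentiable_chain_at[OF 1 2])
  then obtain D where D: "((\<lambda>z. \<phi>e (inv_into V \<kappa> z \<otimes> inv g)) \<circ> (\<lambda>y. \<kappa> (g \<otimes> \<psi>e y)) has_derivative D) (at pe)"
    unfolding differentiable_def by blast
  have "eventually (\<lambda>y. y \<in> \<phi>e ` Ue \<and> g \<otimes> \<psi>e y \<in> V) (nhds pe)"
    by (rule eventually_chart[OF continuous_map_const_mult(1)[OF g chart_props(5)[OF identity_chart(1)]]])
      (use V g chart_props(1)[OF V(1)] in auto)
  then have "eventually (\<lambda>y. ((\<lambda>z. \<phi>e (inv_into V \<kappa> z \<otimes> inv g)) \<circ> (\<lambda>y. \<kappa> (g \<otimes> \<psi>e y))) y = conj_chart g y) (nhds pe)"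
    by eventually_elim (auto simp: conj_chart_def inv)
  then have "(conj_chart g has_derivative D) (at pe)"
    by (intro has_derivative_transform_eventually[OF D])
      (auto simp: eventually_at_filter elim: eventually_mono dest: eventually_nhds_x_imp_x)
  then show ?thesis unfolding differentiable_def by blast
qed

lemma Ad0_conj_chart: "Ad0 G g = frechet_derivative (conj_chart g) (at pe)"
  unfolding Ad0_def conj_chart_def[abs_def] by simp

lemma has_derivative_Ad0:
  "g \<in> carrier G \<Longrightarrow> (conj_chart g has_derivative Ad0 G g) (at pe)"
  unfolding Ad0_conj_chart using conj_chart_differentiable frechet_derivative_works by blast

lemma linear_Ad0: "g \<in> carrier G \<Longrightarrow> bounded_linear (Ad0 G g)"
  using has_derivative_Ad0 has_derivative_bounded_linear by blast

lemma Ad0_one: "Ad0 G \<one> = id"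
proof -
  have "eventually (\<lambda>y. id y = conj_chart \<one> y) (nhds pe)"
    using eventually_conj[OF one_closed]
    by eventually_elim (auto simp: conj_chart_def phi_psi psi_in)
  from frechet_derivative_at_eventually_cong[OF has_derivative_id this]
  show ?thesis by (simp add: Ad0_conj_chart id_def)
qed

lemma conj_chart_mult:
  assumes g: "g \<in> carrier G" and h: "h \<in> carrier G"
    and y: "y \<in> \<phi>e ` Ue" "h \<otimes> \<psi>e y \<otimes> inv h \<in> Ue"
  shows "conj_chart (g \<otimes> h) y = conj_chart g (conj_chart h y)"
  using assms psi_in[of y] by (simp add: conj_chart_def psi_phi inv_mult_group m_assoc)

lemma Ad0_mult:
  assumes g: "g \<in> carrier G" and h: "h \<in> carrier G"
  shows "Ad0 G (g \<otimes> h) X = Ad0 G g (Ad0 G h X)"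
proof -
  have "(conj_chart g \<circ> conj_chart h has_derivative Ad0 G g \<circ> Ad0 G h) (at pe)"
    using has_derivative_Ad0[OF g] has_derivative_Ad0[OF h] h
    by (intro diff_chain_at) auto
  moreover have "eventually (\<lambda>y. (conj_chart g \<circ> conj_chart h) y = conj_chart (g \<otimes> h) y) (nhds pe)"
    using eventually_conj[OF h] by eventually_elim (simp add: conj_chart_mult g h)
  ultimately have "frechet_derivative (conj_chart (g \<otimes> h)) (at pe) = Ad0 G g \<circ> Ad0 G h"
    by (rule frechet_derivative_at_eventually_cong)
  then show ?thesis by (simp add: Ad0_conj_chart[of "g \<otimes> h"])
qed

lemma Ad0_inv:
  assumes g: "g \<in> carrier G"
  shows "Ad0 G (inv g) (Ad0 G g X) = X" "Ad0 G g (Ad0 G (inv g) X) = X"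
  using Ad0_mult[OF g inv_closed[OF g], of X] Ad0_mult[OF inv_closed[OF g] g, of X] g
  by (simp_all add: Ad0_one)

section \<open>Dependence of Ad on the group element\<close>

definition mloc where "mloc z = \<phi>e (\<psi>e (fst z) \<otimes> \<psi>e (snd z))"
definition iloc where "iloc x = \<phi>e (inv (\<psi>e x))"
definition Sm where "Sm = mult_dom Ue \<phi>e Ue \<phi>e Ue"

lemma open_Sm: "open Sm" unfolding Sm_def using open_mult_dom identity_chart by blast

lemma smooth_mloc: "smooth_on mloc Sm"
  using mult_smooth[OF identity_chart(1) identity_chart(1) identity_chart(1)]
  unfolding Sm_def mult_dom_def mloc_def[abs_def] by (simp add: case_prod_unfold)

lemma mloc_has_derivative: 
  "z \<in> Sm \<Longrightarrow> (mloc has_derivative frechet_derivative mloc (at z)) (at z)"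
  using smooth_onD_differentiable[OF smooth_mloc] 
  unfolding differentiable_on_eq_differentiable_at[OF open_Sm] using frechet_derivative_works by blast

lemma dmloc_differentiable: 
  "z \<in> Sm \<Longrightarrow> (\<lambda>z. frechet_derivative mloc (at z) v) differentiable (at z)"
  using smooth_onD_frechet[OF smooth_mloc] 
  unfolding differentiable_on_eq_differentiable_at[OF open_Sm] by blast

lemma continuous_iloc:
  "continuous_map (top_of_set (\<phi>e ` Ue)) (topo G) (\<lambda>x. inv (\<psi>e x))"
  using continuous_map_compose[OF chart_props(5)[OF identity_chart(1)] inv_continuous] by (simp add: o_def)

lemma eventually_iloc: "eventually (\<lambda>x. x \<in> \<phi>e ` Ue \<and> inv (\<psi>e x) \<in> Ue) (nhds pe)"
  by (rule eventually_chart[OF continuous_iloc])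
    (use chart_props(1)[OF identity_chart(1)] identity_chart in auto)

lemma iloc_differentiable: "iloc differentiable (at pe)"
proof -
  have op: "open {x \<in> \<phi>e ` Ue. inv (\<psi>e x) \<in> Ue}"
    by (rule open_preimage[OF open_chart continuous_iloc chart_props(1)[OF identity_chart(1)]])
  have "iloc differentiable_on {x \<in> \<phi>e ` Ue. inv (\<psi>e x) \<in> Ue}"
    using smooth_onD_differentiable[OF inv_smooth[OF identity_chart(1) identity_chart(1)]]
    by (simp add: iloc_def[abs_def])
  then show ?thesis
    unfolding differentiable_on_eq_differentiable_at[OF op] using identity_chart by auto
qed

text \<open>\<open>Ad0\<close> is a derivative taken with the group element frozen, which hides its
  dependence on that element. Writing conjugation as two multiplications and applying the chain rule
  expresses it by derivatives of the single smooth map \<open>mloc\<close> at points that vary with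
  x.\<close>

lemma Ad0_formula:
  assumes x: "x \<in> \<phi>e ` Ue" and ix: "inv (\<psi>e x) \<in> Ue"
  shows "Ad0 G (\<psi>e x) Y =
    frechet_derivative mloc (at (x, iloc x)) (frechet_derivative mloc (at (x, pe)) (0, Y), 0)"
proof -
  let ?D1 = "frechet_derivative mloc (at (x, iloc x))" and ?D2 = "frechet_derivative mloc (at (x, pe))"
  have gx: "\<psi>e x \<in> carrier G" "\<psi>e x \<in> Ue" using psi_in[OF x] by auto
  have z1: "(x, pe) \<in> Sm" using x gx identity_chart by (auto simp: Sm_def mult_dom_def)
  have z2: "(x, iloc x) \<in> Sm"
    using x gx ix identity_chart by (auto simp: Sm_def mult_dom_def iloc_def psi_phi)
  have xe: "mloc (x, pe) = x" using gx x by (simp add: mloc_def phi_psi)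
  have d1: "((\<lambda>y. (x, y)) has_derivative (\<lambda>h. (0, h))) (at pe)"
    by (auto intro!: derivative_eq_intros)
  have d2: "((mloc \<circ> (\<lambda>y. (x, y))) has_derivative (?D2 \<circ> (\<lambda>h. (0, h)))) (at pe)"
    by (rule diff_chain_at[OF d1 mloc_has_derivative[OF z1]])
  have d3: "((\<lambda>w. (w, iloc x)) has_derivative (\<lambda>h. (h, 0))) (at ((mloc \<circ> (\<lambda>y. (x, y))) pe))"
    by (auto intro!: derivative_eq_intros)
  have "((\<lambda>w. (w, iloc x)) \<circ> (mloc \<circ> (\<lambda>y. (x, y))) has_derivative
     (\<lambda>h. (h, 0)) \<circ> (?D2 \<circ> (\<lambda>h. (0, h)))) (at pe)"
    by (rule diff_chain_at[OF d2 d3])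
  moreover have "(mloc has_derivative ?D1) (at (((\<lambda>w. (w, iloc x)) \<circ> (mloc \<circ> (\<lambda>y. (x, y)))) pe))"
    using mloc_has_derivative[OF z2] by (simp add: xe)
  ultimately have d5: "(mloc \<circ> ((\<lambda>w. (w, iloc x)) \<circ> (mloc \<circ> (\<lambda>y. (x, y)))) has_derivative
     ?D1 \<circ> ((\<lambda>h. (h, 0)) \<circ> (?D2 \<circ> (\<lambda>h. (0, h))))) (at pe)"
    by (rule diff_chain_at)
  have "eventually (\<lambda>y. y \<in> \<phi>e ` Ue \<and> \<psi>e x \<otimes> \<psi>e y \<in> Ue) (nhds pe)"
    by (rule eventually_chart[OF continuous_map_const_mult(1)[OF gx(1) chart_props(5)[OF identity_chart(1)]]])
      (use gx chart_props(1)[OF identity_chart(1)] in auto)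
  then have "eventually (\<lambda>y. (mloc \<circ> ((\<lambda>w. (w, iloc x)) \<circ> (mloc \<circ> (\<lambda>y. (x, y))))) y = conj_chart (\<psi>e x) y) (nhds pe)"
    by eventually_elim (use ix in \<open>simp add: mloc_def iloc_def conj_chart_def psi_phi\<close>)
  from frechet_derivative_at_eventually_cong[OF d5 this]
  show ?thesis by (simp add: Ad0_conj_chart)
qed

lemma Ad0_differentiable: "(\<lambda>x. Ad0 G (\<psi>e x) Y) differentiable (at pe)"
proof -
  let ?D = "\<lambda>z. frechet_derivative mloc (at z)"
  define w where "w x = ?D (x, pe) (0, Y)" for x
  have ipe: "iloc pe = pe" by (simp add: iloc_def)
  have zm: "(pe, pe) \<in> Sm" using identity_chart by (auto simp: Sm_def mult_dom_def)
  have w: "w differentiable (at pe)"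
    using differentiable_chain_at[where f="\<lambda>x. (x, pe)" and x=pe, OF _ dmloc_differentiable[of "(pe, pe)" "(0, Y)"]] zm
    by (simp add: o_def w_def[abs_def])
  have i: "(\<lambda>x. (x, iloc x)) differentiable (at pe)"
    using iloc_differentiable by (intro derivative_intros) (auto simp: differentiable_Pair)
  have b: "(\<lambda>x. ?D (x, iloc x) (b, 0)) differentiable (at pe)" for b
    using differentiable_chain_at[OF i, of "\<lambda>z. ?D z (b, 0)"] dmloc_differentiable[of "(pe, pe)" "(b, 0)"] zm
    by (simp add: o_def ipe)
  \<comment> \<open>\<open>dmloc_differentiable\<close> lets the base point vary for a fixed vector
    only, while here the vector \<open>w x\<close> moves too; its expansion in \<open>Basis\<close>
    separates the two dependences.\<close>
  have s: "(\<lambda>x. \<Sum>b\<in>Basis. (w x \<bullet> b) *\<^sub>R ?D (x, iloc x) (b, 0)) differentiable (at pe)"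
    by (intro differentiable_sum finite_Basis ballI differentiable_scaleR b differentiable_inner w differentiable_const)
  then obtain D where D: "((\<lambda>x. \<Sum>b\<in>Basis. (w x \<bullet> b) *\<^sub>R ?D (x, iloc x) (b, 0)) has_derivative D) (at pe)"
    unfolding differentiable_def by blast
  have "eventually (\<lambda>x. (\<Sum>b\<in>Basis. (w x \<bullet> b) *\<^sub>R ?D (x, iloc x) (b, 0)) = Ad0 G (\<psi>e x) Y) (nhds pe)"
    using eventually_iloc
  proof eventually_elim
    case (elim x)
    have gx: "\<psi>e x \<in> carrier G" using psi_in elim by auto
    have z2: "(x, iloc x) \<in> Sm"
      using elim gx identity_chart by (auto simp: Sm_def mult_dom_def iloc_def psi_phi)
    interpret D: bounded_linear "?D (x, iloc x)"
      using mloc_has_derivative[OF z2] has_derivative_bounded_linear by blast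
    have "Ad0 G (\<psi>e x) Y = ?D (x, iloc x) (w x, 0)" using Ad0_formula elim by (simp add: w_def)
    also have "(w x, 0) = (\<Sum>b\<in>Basis. (w x \<bullet> b) *\<^sub>R (b, 0 :: real^'n))"
      by (rule prod_eqI) (simp_all add: fst_sum snd_sum euclidean_representation)
    also have "?D (x, iloc x) \<dots> = (\<Sum>b\<in>Basis. (w x \<bullet> b) *\<^sub>R ?D (x, iloc x) (b, 0))"
      by (simp only: D.sum D.scaleR)
    finally show ?case by simp
  qed
  then have "((\<lambda>x. Ad0 G (\<psi>e x) Y) has_derivative D) (at pe)"
    by (intro has_derivative_transform_eventually[OF D])
      (auto simp: eventually_at_filter elim: eventually_mono dest: eventually_nhds_x_imp_x)
  then show ?thesis unfolding differentiable_def by blast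
qed

section \<open>The bracket of the real Lie algebra\<close>

lemma Ad0_has_derivative:
  "((\<lambda>x. Ad0 G (\<psi>e x) Y) has_derivative (\<lambda>X. lie_br0 G X Y)) (at pe)"
  using Ad0_differentiable[of Y] unfolding frechet_derivative_works lie_br0_def by simp

lemma eventually_in_chart: "eventually (\<lambda>x. x \<in> \<phi>e ` Ue) (nhds pe)"
  using open_chart pe_in eventually_nhds by blast

text \<open>Linearity in X is that of a derivative; linearity in Y is inherited from
  \<open>Ad0\<close> at all points of the identity chart.\<close>

lemma lie_br0_bilinear: "bilinear (lie_br0 G)"
proof -
  have "linear (\<lambda>X. lie_br0 G X Y)" for Y
    using Ad0_has_derivative has_derivative_linear by blast
  moreover have "linear (lie_br0 G X)" for X
  proof (rule linearI)
    fix Y Z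
    have "eventually (\<lambda>x. Ad0 G (\<psi>e x) Y + Ad0 G (\<psi>e x) Z = Ad0 G (\<psi>e x) (Y + Z)) (nhds pe)"
      using eventually_in_chart
      by eventually_elim (metis linear_Ad0 psi_in(2) linear_simps(1))
    from frechet_derivative_at_eventually_cong[OF has_derivative_add[OF Ad0_has_derivative Ad0_has_derivative] this]
    show "lie_br0 G X (Y + Z) = lie_br0 G X Y + lie_br0 G X Z"
      by (simp add: lie_br0_def[of G X "Y + Z"])
  next
    fix c :: real and Y
    have "eventually (\<lambda>x. c *\<^sub>R Ad0 G (\<psi>e x) Y = Ad0 G (\<psi>e x) (c *\<^sub>R Y)) (nhds pe)"
      using eventually_in_chart
      by eventually_elim (metis linear_Ad0 psi_in(2) linear_simps(5))
    from frechet_derivative_at_eventually_cong[OF has_derivative_scaleR_right[OF Ad0_has_derivative] this]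
    show "lie_br0 G X (c *\<^sub>R Y) = c *\<^sub>R lie_br0 G X Y"
      by (simp add: lie_br0_def[of G X "c *\<^sub>R Y"])
  qed
  ultimately show ?thesis unfolding bilinear_def by blast
qed

text \<open>Differentiate Ad(g x g^-1) Ad(g) Y = Ad(g) Ad(x) Y in x at the identity, once by the
  chain rule through conjugation by g and once through the linear map Ad(g).\<close>

lemma Ad0_lie_br0:
  assumes g: "g \<in> carrier G"
  shows "Ad0 G g (lie_br0 G X Y) = lie_br0 G (Ad0 G g X) (Ad0 G g Y)"
proof -
  interpret A: bounded_linear "Ad0 G g" by (rule linear_Ad0[OF g])
  have 1: "((\<lambda>x. Ad0 G g (Ad0 G (\<psi>e x) Y)) has_derivative (\<lambda>X. Ad0 G g (lie_br0 G X Y))) (at pe)"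
    by (rule A.has_derivative[OF Ad0_has_derivative])
  have "((\<lambda>x. Ad0 G (\<psi>e x) (Ad0 G g Y)) \<circ> conj_chart g has_derivative
      (\<lambda>X. lie_br0 G X (Ad0 G g Y)) \<circ> Ad0 G g) (at pe)"
    using Ad0_has_derivative has_derivative_Ad0[OF g] g by (intro diff_chain_at) auto
  moreover have "eventually (\<lambda>x. ((\<lambda>x. Ad0 G (\<psi>e x) (Ad0 G g Y)) \<circ> conj_chart g) x
      = Ad0 G g (Ad0 G (\<psi>e x) Y)) (nhds pe)"
    using eventually_conj[OF g]
  proof eventually_elim
    case (elim x)
    have gx: "\<psi>e x \<in> carrier G" using psi_in elim by auto
    have "g \<otimes> \<psi>e x \<otimes> inv g \<otimes> g = g \<otimes> \<psi>e x" using g gx by (simp add: m_assoc)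
    then have "Ad0 G (g \<otimes> \<psi>e x \<otimes> inv g) (Ad0 G g Y) = Ad0 G g (Ad0 G (\<psi>e x) Y)"
      using g gx by (metis Ad0_mult inv_closed m_closed)
    then show ?case using elim by (simp add: conj_chart_def psi_phi)
  qed
  ultimately have "frechet_derivative (\<lambda>x. Ad0 G g (Ad0 G (\<psi>e x) Y)) (at pe) =
      (\<lambda>X. lie_br0 G X (Ad0 G g Y)) \<circ> Ad0 G g"
    by (rule frechet_derivative_at_eventually_cong)
  moreover have "frechet_derivative (\<lambda>x. Ad0 G g (Ad0 G (\<psi>e x) Y)) (at pe) = (\<lambda>X. Ad0 G g (lie_br0 G X Y))"
    using frechet_derivative_at[OF 1] by simp
  ultimately show ?thesis by (metis comp_apply)
qed

text \<open>This is the derivative at the identity of the invariance \<open>Ad0_lie_br0\<close>; the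
  product rule gives the two terms on the right.\<close>

lemma lie_br0_jacobi:
  "lie_br0 G X (lie_br0 G Y Z) = lie_br0 G (lie_br0 G X Y) Z + lie_br0 G Y (lie_br0 G X Z)"
proof -
  have bb: "bounded_bilinear (lie_br0 G)" using lie_br0_bilinear bilinear_conv_bounded_bilinear by blast
  have "((\<lambda>x. lie_br0 G (Ad0 G (\<psi>e x) Y) (Ad0 G (\<psi>e x) Z)) has_derivative
      (\<lambda>X. lie_br0 G (Ad0 G (\<psi>e pe) Y) (lie_br0 G X Z) + lie_br0 G (lie_br0 G X Y) (Ad0 G (\<psi>e pe) Z))) (at pe)"
    by (rule bounded_bilinear.FDERIV[OF bb Ad0_has_derivative Ad0_has_derivative])
  moreover have "eventually (\<lambda>x. lie_br0 G (Ad0 G (\<psi>e x) Y) (Ad0 G (\<psi>e x) Z) =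
      Ad0 G (\<psi>e x) (lie_br0 G Y Z)) (nhds pe)"
    using eventually_in_chart by eventually_elim (simp add: Ad0_lie_br0 psi_in)
  ultimately have "frechet_derivative (\<lambda>x. Ad0 G (\<psi>e x) (lie_br0 G Y Z)) (at pe) =
     (\<lambda>X. lie_br0 G (Ad0 G (\<psi>e pe) Y) (lie_br0 G X Z) + lie_br0 G (lie_br0 G X Y) (Ad0 G (\<psi>e pe) Z))"
    by (rule frechet_derivative_at_eventually_cong)
  then show ?thesis by (simp add: lie_br0_def[of G X "lie_br0 G Y Z"] Ad0_one)
qed

section \<open>One-parameter subgroups and antisymmetry\<close>

lemma expo_zero [simp]: "expo G 0 = \<one>"
proof -
  have "expo G 0 = expo G 0 \<otimes> expo G 0" using exp_one_parameter[of 0 0 0] by simp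
  then show ?thesis using exp_closed[of 0] by (metis l_cancel_one')
qed

lemma eventually_expo: "eventually (\<lambda>t. expo G (t *\<^sub>R X) \<in> Ue) (nhds (0::real))"
proof -
  have "open {t \<in> UNIV. expo G (t *\<^sub>R X) \<in> Ue}"
    by (rule open_preimage) (use exp_continuous chart_props(1)[OF identity_chart(1)] in auto)
  then show ?thesis
    unfolding eventually_nhds using identity_chart by (intro exI[of _ "{t. expo G (t *\<^sub>R X) \<in> Ue}"]) auto
qed

lemma expo_commute: "expo G (t *\<^sub>R X) \<otimes> expo G (r *\<^sub>R X) = expo G (r *\<^sub>R X) \<otimes> expo G (t *\<^sub>R X)"
  by (metis add.commute exp_one_parameter)

text \<open>Conjugation by \<open>exp tX\<close> fixes the curve \<open>s \<mapsto> exp sX\<close>.\<close>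
lemma Ad0_expo: "Ad0 G (expo G (t *\<^sub>R X)) X = X"
proof -
  define g where "g = expo G (t *\<^sub>R X)"
  have g: "g \<in> carrier G" by (simp add: g_def exp_closed)
  define \<gamma> where "\<gamma> r = \<phi>e (expo G (r *\<^sub>R X))" for r :: real
  have g0: "\<gamma> 0 = pe" by (simp add: \<gamma>_def)
  have d: "(\<gamma> has_vector_derivative X) (at 0)" unfolding \<gamma>_def[abs_def] by (rule exp_velocity)
  have "(conj_chart g \<circ> \<gamma> has_derivative Ad0 G g \<circ> (\<lambda>h. h *\<^sub>R X)) (at 0)"
    using d[unfolded has_vector_derivative_def] has_derivative_Ad0[OF g]
    by (intro diff_chain_at) (auto simp: g0)
  moreover have "eventually (\<lambda>r. (conj_chart g \<circ> \<gamma>) r = \<gamma> r) (nhds 0)"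
    using eventually_expo[of X]
  proof eventually_elim
    case (elim r)
    have e: "expo G (r *\<^sub>R X) \<in> carrier G" by (simp add: exp_closed)
    have "g \<otimes> expo G (r *\<^sub>R X) \<otimes> inv g = expo G (r *\<^sub>R X) \<otimes> g \<otimes> inv g"
      unfolding g_def by (simp add: expo_commute)
    also have "\<dots> = expo G (r *\<^sub>R X)" using e g by (simp add: m_assoc)
    finally have "g \<otimes> expo G (r *\<^sub>R X) \<otimes> inv g = expo G (r *\<^sub>R X)" .
    then show ?case by (simp add: conj_chart_def \<gamma>_def psi_phi elim)
  qed
  ultimately have "frechet_derivative \<gamma> (at 0) = Ad0 G g \<circ> (\<lambda>h. h *\<^sub>R X)"
    by (rule frechet_derivative_at_eventually_cong)
  moreover have "frechet_derivative \<gamma> (at 0) = (\<lambda>h. h *\<^sub>R X)"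
    using d[unfolded has_vector_derivative_def] frechet_derivative_at by metis
  ultimately show ?thesis by (metis comp_apply g_def scaleR_one)
qed

text \<open>The two arguments of the bracket play different roles in its definition, so antisymmetry
  needs its own source: along the curve exp tX the vector Ad(exp tX) X is constant by
  \<open>Ad0_expo\<close>, and its derivative at 0 is [X, X].\<close>

lemma lie_br0_self: "lie_br0 G X X = 0"
proof -
  have "((\<lambda>x. Ad0 G (\<psi>e x) X) \<circ> (\<lambda>t. \<phi>e (expo G (t *\<^sub>R X))) has_derivative
      (\<lambda>Z. lie_br0 G Z X) \<circ> (\<lambda>h. h *\<^sub>R X)) (at 0)"
    using exp_velocity[of X, unfolded has_vector_derivative_def] Ad0_has_derivative
    by (intro diff_chain_at) auto
  moreover have "eventually (\<lambda>t. ((\<lambda>x. Ad0 G (\<psi>e x) X) \<circ> (\<lambda>t. \<phi>e (expo G (t *\<^sub>R X)))) t = X) (nhds 0)"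
    using eventually_expo[of X] by eventually_elim (simp add: psi_phi Ad0_expo)
  ultimately have "frechet_derivative (\<lambda>t::real. X) (at 0) = (\<lambda>Z. lie_br0 G Z X) \<circ> (\<lambda>h. h *\<^sub>R X)"
    by (rule frechet_derivative_at_eventually_cong)
  then have "lie_br0 G X X = frechet_derivative (\<lambda>t::real. X) (at 0) 1" by simp
  then show ?thesis by simp
qed

lemma lie_br0_antisym: "lie_br0 G X Y = - lie_br0 G Y X"
proof -
  have "lie_br0 G (X + Y) (X + Y) = lie_br0 G X Y + lie_br0 G Y X"
    using lie_br0_self[of X] lie_br0_self[of Y] bilinear_ladd[OF lie_br0_bilinear] bilinear_radd[OF lie_br0_bilinear]
    by simp
  then show ?thesis using lie_br0_self[of "X + Y"] by (simp add: eq_neg_iff_add_eq_0)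
qed

end

section \<open>Traces and complexification\<close>

abbreviation lin_op :: "(complex^'n \<Rightarrow> complex^'n) \<Rightarrow> bool" where
  "lin_op \<equiv> Vector_Spaces.linear (*s) (*s)"

lemma lin_opI:
  assumes "\<And>x y. f (x + y) = f x + f y" "\<And>c x. f (c *s x) = c *s f x"
  shows "lin_op f"
  using assms by unfold_locales (auto simp: vec.scale_right_distrib vec.scale_left_distrib)

section \<open>Real and imaginary parts, conjugation and complexified maps\<close>

lemma re_vec_simps [simp]:
  "re_vec (Z + W) = re_vec Z + re_vec W" "re_vec (Z - W) = re_vec Z - re_vec W"
  "re_vec (- Z) = - re_vec Z" "re_vec 0 = 0"
  "re_vec (c *s Z) = Re c *\<^sub>R re_vec Z - Im c *\<^sub>R im_vec Z"
  "re_vec (cvec X) = X" "re_vec (conj_vec Z) = re_vec Z"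
  by (simp_all add: re_vec_def im_vec_def cvec_def conj_vec_def vec_eq_iff)

lemma im_vec_simps [simp]:
  "im_vec (Z + W) = im_vec Z + im_vec W" "im_vec (Z - W) = im_vec Z - im_vec W"
  "im_vec (- Z) = - im_vec Z" "im_vec 0 = 0"
  "im_vec (c *s Z) = Re c *\<^sub>R im_vec Z + Im c *\<^sub>R re_vec Z"
  "im_vec (cvec X) = 0" "im_vec (conj_vec Z) = - im_vec Z"
  by (simp_all add: re_vec_def im_vec_def cvec_def conj_vec_def vec_eq_iff)

lemma cvec_eq_iff: "Z = W \<longleftrightarrow> re_vec Z = re_vec W \<and> im_vec Z = im_vec W"
  by (auto simp: re_vec_def im_vec_def vec_eq_iff complex_eq_iff)

lemma cvec_decomp: "Z = cvec (re_vec Z) + \<i> *s cvec (im_vec Z)"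
  by (simp add: cvec_eq_iff)

lemma re_im_complexify [simp]:
  "re_vec (complexify f Z) = f (re_vec Z)" "im_vec (complexify f Z) = f (im_vec Z)"
  by (simp_all add: complexify_def)

lemma re_im_complexify2 [simp]:
  "re_vec (complexify2 f Z W) = f (re_vec Z) (re_vec W) - f (im_vec Z) (im_vec W)"
  "im_vec (complexify2 f Z W) = f (re_vec Z) (im_vec W) + f (im_vec Z) (re_vec W)"
  by (simp_all add: complexify2_def)

lemma conj_vec_simps [simp]:
  "conj_vec (Z + W) = conj_vec Z + conj_vec W" "conj_vec (Z - W) = conj_vec Z - conj_vec W"
  "conj_vec (- Z) = - conj_vec Z" "conj_vec 0 = 0"
  "conj_vec (c *s Z) = cnj c *s conj_vec Z" "conj_vec (conj_vec Z) = Z"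
  "conj_vec (cvec X) = cvec X"
  by (simp_all add: cvec_eq_iff)

lemma lin_op_complexify:
  assumes "linear f" shows "lin_op (complexify f)"
proof -
  interpret linear f by fact
  show ?thesis by (rule lin_opI) (simp_all add: cvec_eq_iff add diff scale)
qed

lemma complexify_conj:
  "linear f \<Longrightarrow> complexify f (conj_vec Z) = conj_vec (complexify f Z)"
  by (simp add: cvec_eq_iff linear_neg)

lemma complexify2_lin_op:
  assumes "bilinear f" shows "lin_op (complexify2 f Z)" "lin_op (\<lambda>Z. complexify2 f Z W)"
  by (rule lin_opI; simp add: cvec_eq_iff bilinear_ladd[OF assms] bilinear_radd[OF assms] bilinear_lsub[OF assms]
      bilinear_rsub[OF assms] bilinear_lmul[OF assms] bilinear_rmul[OF assms] algebra_simps)+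

lemma complexify2_conj:
  assumes "bilinear f"
  shows "conj_vec (complexify2 f Z W) = complexify2 f (conj_vec Z) (conj_vec W)"
  by (simp add: cvec_eq_iff bilinear_lneg[OF assms] bilinear_rneg[OF assms])

lemma complexify2_cvec: "bilinear f \<Longrightarrow> complexify2 f (cvec X) (cvec Y) = cvec (f X Y)"
  by (simp add: cvec_eq_iff bilinear_lzero bilinear_rzero)

lemma complexify_complexify2:
  assumes "linear g" "\<And>X Y. g (f X Y) = f (g X) (g Y)"
  shows "complexify g (complexify2 f Z W) = complexify2 f (complexify g Z) (complexify g W)"
  by (simp add: cvec_eq_iff linear_add[OF assms(1)] linear_diff[OF assms(1)] assms(2))

section \<open>Traces of complex linear operators\<close>

definition tr :: "(complex^'n \<Rightarrow> complex^'n) \<Rightarrow> complex" where "tr f = trace (matrix f)"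

lemma tr_commute:
  assumes "lin_op f" "lin_op g" shows "tr (\<lambda>x. f (g x)) = tr (\<lambda>x. g (f x))"
proof -
  have "matrix (f \<circ> g) = matrix f ** matrix g" "matrix (g \<circ> f) = matrix g ** matrix f"
    using matrix_compose_gen assms by blast+
  then show ?thesis by (simp add: tr_def o_def trace_mul_sym[of "matrix f"])
qed

lemma tr_simps:
  "tr (\<lambda>x. f x - g x) = tr f - tr g" "tr (\<lambda>x. f x + g x) = tr f + tr g" "tr (\<lambda>x. c *s f x) = c * tr f"
  "tr (\<lambda>x. 0) = 0"
  by (simp_all add: tr_def trace_def matrix_def sum_subtractf sum.distrib sum_distrib_left)

lemma tr_rank_one:
  assumes "\<And>x y. b (x + y) = b x + b y" "\<And>c x. b (c *s x) = c * b x"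
  shows "tr (\<lambda>x. b x *s v) = b v"
proof -
  have s: "b (\<Sum>j\<in>J. g j) = (\<Sum>j\<in>J. b (g j))" for J :: "'a set" and g
  proof (induction J rule: infinite_finite_induct)
    case empty
    then show ?case using assms(2)[of 0 0] by simp
  next
    case (infinite J)
    then show ?case using assms(2)[of 0 0] by simp
  qed (simp add: assms(1))
  have "b v = b (\<Sum>j\<in>UNIV. v $ j *s axis j 1)" by (simp add: basis_expansion)
  also have "\<dots> = (\<Sum>j\<in>UNIV. v $ j * b (axis j 1))" by (simp add: s assms)
  finally show ?thesis by (simp add: tr_def trace_def matrix_def mult.commute)
qed

lemma tr_sum: "tr (\<lambda>x. \<Sum>j\<in>J. f j x) = (\<Sum>j\<in>J. tr (f j))"
  by (induction J rule: infinite_finite_induct) (simp_all add: tr_simps)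

lemma projection_exists:
  assumes "vec.subspace (W :: (complex^'n) set)"
  obtains P where "lin_op P" "\<And>x. P x \<in> W" "\<And>x. x \<in> W \<Longrightarrow> P x = x"
proof -
  obtain B where B: "B \<subseteq> W" "vec.independent B" "W \<subseteq> vec.span B"
    by (rule vec.maximal_independent_subset)
  define E where "E = vec.extend_basis B"
  have E: "vec.independent E" "vec.span E = UNIV" "B \<subseteq> E"
    unfolding E_def using vec.independent_extend_basis[OF B(2)] vec.span_extend_basis[OF B(2)]
      vec.extend_basis_superset[OF B(2)] by auto
  have "\<exists>P. (\<forall>x\<in>E. P x = (if x \<in> B then x else 0)) \<and> lin_op P"
  proof -
    let ?f = "\<lambda>x. if x \<in> B then x else 0"
    show ?thesis
      using vec.linear_construct[OF E(1), of ?f] vec.construct_basis[OF E(1), of _ ?f]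
      by (intro exI[of _ "vec.construct E ?f"]) simp
  qed
  then obtain P where P: "\<And>x. x \<in> E \<Longrightarrow> P x = (if x \<in> B then x else 0)" "lin_op P" by blast
  interpret P: Vector_Spaces.linear "(*s)" "(*s)" P by (rule P(2))
  have sub: "P x \<in> W" for x
  proof -
    have "x \<in> vec.span E" using E by simp
    then show ?thesis
    proof (induction rule: vec.span_induct_alt)
      case (step c x y)
      then show ?case
        using assms B(1) P(1)[of x]
        by (auto simp: P.add P.scale vec.subspace_def)
    qed (use assms in \<open>simp add: vec.subspace_0\<close>)
  qed
  have "P x = x" if "x \<in> W" for x
  proof -
    have "x \<in> vec.span B" using that B by auto
    then show ?thesis
      by (induction rule: vec.span_induct_alt) (use P(1) E(3) in \<open>auto simp: P.add P.scale\<close>)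
  qed
  then show ?thesis using that P(2) sub by blast
qed

text \<open>If \<open>P k\<close> projects onto \<open>W k\<close>, then \<open>tr (f P k) = tr (P (k + 1) f P k) = tr (f P (k + 1))\<close>.\<close>
lemma tr_zero_of_flag:
  fixes W :: "nat \<Rightarrow> (complex^'n) set"
  assumes W: "\<And>k. vec.subspace (W k)" "\<And>k. W (Suc k) \<subseteq> W k" "W m = {0}"
    and f: "lin_op f" "\<And>k x. x \<in> W k \<Longrightarrow> f x \<in> W (Suc k)"
    and P: "lin_op P" "\<And>x. P x \<in> W 0" "\<And>x. x \<in> W 0 \<Longrightarrow> P x = x"
  shows "tr (\<lambda>x. f (P x)) = 0"
proof -
  interpret f: Vector_Spaces.linear "(*s)" "(*s)" f by (rule f(1))
  have step: "tr (\<lambda>x. f (P x)) = tr (\<lambda>x. f (P' x))"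
    if "lin_op P" "\<And>x. P x \<in> W k" "\<And>x. x \<in> W k \<Longrightarrow> P x = x"
      "lin_op P'" "\<And>x. P' x \<in> W (Suc k)" "\<And>x. x \<in> W (Suc k) \<Longrightarrow> P' x = x" for P P' k
  proof -
    have l: "lin_op (\<lambda>x. f (P x))"
      using Vector_Spaces.linear_compose[OF that(1) f(1)] by (simp add: o_def)
    have "tr (\<lambda>x. f (P x)) = tr (\<lambda>x. P' (f (P x)))"
      using that f(2) by simp
    also have "\<dots> = tr (\<lambda>x. f (P (P' x)))" by (rule tr_commute[OF that(4) l])
    also have "\<dots> = tr (\<lambda>x. f (P' x))"
      using that(3) that(5) W(2)[of k] by (metis subset_eq)
    finally show ?thesis .
  qed
  have "\<exists>P'. lin_op P' \<and> (\<forall>x. P' x \<in> W k) \<and> (\<forall>x\<in>W k. P' x = x) \<and>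
      tr (\<lambda>x. f (P x)) = tr (\<lambda>x. f (P' x))" for k
  proof (induction k)
    case 0
    then show ?case using P by blast
  next
    case (Suc k)
    then obtain P' where P': "lin_op P'" "\<And>x. P' x \<in> W k" "\<And>x. x \<in> W k \<Longrightarrow> P' x = x"
      "tr (\<lambda>x. f (P x)) = tr (\<lambda>x. f (P' x))" by blast
    obtain P'' where P'': "lin_op P''" "\<And>x. P'' x \<in> W (Suc k)" "\<And>x. x \<in> W (Suc k) \<Longrightarrow> P'' x = x"
      using projection_exists[OF W(1)] by metis
    show ?case using step[OF P'(1-3) P''] P'(4) P'' by metis
  qed
  from this[of m] obtain P' where P': "\<And>x. P' x \<in> W m" "tr (\<lambda>x. f (P x)) = tr (\<lambda>x. f (P' x))" by blast
  then have "P' x = 0" for x using W(3) by auto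
  then show ?thesis using P'(2) by (simp add: tr_simps)
qed

text \<open>\<open>W\<close> is the lower central series of u. Apart from reaching zero, which is
  nilpotency, these are the properties that \<open>tr_zero_of_flag\<close> demands of a flag when
  the operator is ad X.\<close>

lemma bracket_span_iterate:
  assumes br: "\<And>x y. x \<in> u \<Longrightarrow> y \<in> u \<Longrightarrow> br x y \<in> u" and u: "vec.subspace u"
  defines "W \<equiv> \<lambda>k. ((\<lambda>d. bracket_span br u d) ^^ k) u"
  shows "vec.subspace (W k)" "W (Suc k) \<subseteq> W k" "X \<in> u \<Longrightarrow> Y \<in> W k \<Longrightarrow> br X Y \<in> W (Suc k)"
proof -
  have mono: "bracket_span br u d \<subseteq> bracket_span br u d'" if "d \<subseteq> d'" for d d'
    unfolding bracket_span_def by (rule vec.span_mono) (use that in blast)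
  show "vec.subspace (W k)" by (cases k) (auto simp: W_def u bracket_span_def)
  show "W (Suc k) \<subseteq> W k"
  proof (induction k)
    case 0
    have "vec.span {br x y |x y. x \<in> u \<and> y \<in> u} \<subseteq> u"
      by (rule vec.span_minimal) (use br u in auto)
    then show ?case by (simp add: W_def bracket_span_def)
  next
    case (Suc k)
    then show ?case using mono by (simp add: W_def)
  qed
  show "X \<in> u \<Longrightarrow> Y \<in> W k \<Longrightarrow> br X Y \<in> W (Suc k)"
    unfolding W_def by (auto simp: bracket_span_def intro!: vec.span_base)
qed

section \<open>The complexified bracket and the Killing form\<close>

context lie_group
begin

abbreviation "br \<equiv> lie_br G"
abbreviation "BK \<equiv> kill G"

lemma lin_op_br: "lin_op (br Z)" "lin_op (\<lambda>Z. br Z W)"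
  unfolding lie_br_def by (simp_all add: complexify2_lin_op lie_br0_bilinear)

lemma br_simps:
  "br (X + Y) Z = br X Z + br Y Z" "br Z (X + Y) = br Z X + br Z Y"
  "br (X - Y) Z = br X Z - br Y Z" "br Z (X - Y) = br Z X - br Z Y"
  "br (- X) Z = - br X Z" "br Z (- X) = - br Z X"
  "br (c *s X) Z = c *s br X Z" "br Z (c *s X) = c *s br Z X" "br 0 Z = 0" "br Z 0 = 0"
proof -
  interpret l: Vector_Spaces.linear "(*s)" "(*s)" "\<lambda>X. br X Z" by (rule lin_op_br)
  interpret r: Vector_Spaces.linear "(*s)" "(*s)" "br Z" by (rule lin_op_br)
  show "br (X + Y) Z = br X Z + br Y Z" "br Z (X + Y) = br Z X + br Z Y"
  "br (X - Y) Z = br X Z - br Y Z" "br Z (X - Y) = br Z X - br Z Y"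
  "br (- X) Z = - br X Z" "br Z (- X) = - br Z X"
  "br (c *s X) Z = c *s br X Z" "br Z (c *s X) = c *s br Z X" "br 0 Z = 0" "br Z 0 = 0"
    by (simp_all add: l.add r.add l.diff r.diff l.neg r.neg l.scale r.scale)
qed

lemma br_antisym: "br X Y = - br Y X"
proof -
  have a: "lie_br0 G X Y + lie_br0 G Y X = 0" for X Y using lie_br0_antisym[of X Y] by simp
  have "br X Y + br Y X = 0"
    unfolding lie_br_def using a[of "re_vec X" "re_vec Y"] a[of "im_vec X" "im_vec Y"]
      a[of "re_vec X" "im_vec Y"] a[of "im_vec X" "re_vec Y"]
    by (simp add: cvec_eq_iff) (simp add: algebra_simps add_eq_0_iff)
  then show ?thesis by (simp add: eq_neg_iff_add_eq_0)
qed

lemma br_jacobi: "br X (br Y Z) = br (br X Y) Z + br Y (br X Z)"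
proof -
  note b = lie_br0_bilinear
  show ?thesis
    unfolding lie_br_def
    by (simp add: cvec_eq_iff bilinear_ladd[OF b] bilinear_radd[OF b] bilinear_lsub[OF b] bilinear_rsub[OF b]
       lie_br0_jacobi[of "re_vec X"] lie_br0_jacobi[of "im_vec X"])
qed

lemma br_conj: "conj_vec (br X Y) = br (conj_vec X) (conj_vec Y)"
  unfolding lie_br_def by (rule complexify2_conj[OF lie_br0_bilinear])

lemma kill_tr: "BK X Y = tr (\<lambda>Z. br X (br Y Z))"
  by (simp add: kill_def killing_def tr_def)

lemma lin_op_compose2: "lin_op f \<Longrightarrow> lin_op g \<Longrightarrow> lin_op (\<lambda>x. f (g x))"
  using Vector_Spaces.linear_compose[of "(*s)" "(*s)" g "(*s)" f] by (simp add: o_def)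

lemma kill_sym: "BK X Y = BK Y X"
  unfolding kill_tr by (rule tr_commute) (rule lin_op_br)+

lemma kill_simps:
  "BK (X + Y) Z = BK X Z + BK Y Z" "BK Z (X + Y) = BK Z X + BK Z Y"
  "BK (X - Y) Z = BK X Z - BK Y Z" "BK Z (X - Y) = BK Z X - BK Z Y"
  "BK (- X) Z = - BK X Z" "BK Z (- X) = - BK Z X"
  "BK (c *s X) Z = c * BK X Z" "BK Z (c *s X) = c * BK Z X" "BK 0 Z = 0" "BK Z 0 = 0"
proof -
  show a: "BK (X + Y) Z = BK X Z + BK Y Z" "BK (c *s X) Z = c * BK X Z" for X Y Z c
    by (simp_all add: kill_tr br_simps tr_simps)
  then show a': "BK Z (X + Y) = BK Z X + BK Z Y" "BK Z (c *s X) = c * BK Z X" for X Y Z c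
    using kill_sym by metis+
  show n: "BK (- X) Z = - BK X Z" "BK Z (- X) = - BK Z X" for X
    using a(2)[of "- 1" X Z] a'(2)[of Z "-1" X] by simp_all
  show "BK (X - Y) Z = BK X Z - BK Y Z" "BK Z (X - Y) = BK Z X - BK Z Y"
    using a(1)[of X "- Y" Z] a'(1)[of Z X "- Y"] n by simp_all
  show "BK 0 Z = 0" "BK Z 0 = 0" using a(2)[of 0 0 Z] a'(2)[of Z 0 0] by simp_all
qed

text \<open>By the Jacobi identity ad [X, Y] is a commutator; after expansion both sides contain
  tr(ad X ad Y ad Z), and the remaining traces agree by cyclicity.\<close>

lemma kill_invariant: "BK (br X Y) Z = BK X (br Y Z)"
proof -
  have j: "br (br X Y) W = br X (br Y W) - br Y (br X W)" for X Y W
    using br_jacobi[of X Y W] by simp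
  have "tr (\<lambda>W. br Y (br X (br Z W))) = tr (\<lambda>W. br X (br Z (br Y W)))"
    by (rule tr_commute[OF lin_op_br(1) lin_op_compose2[OF lin_op_br(1) lin_op_br(1)]])
  then show ?thesis
    by (simp add: kill_tr j br_simps tr_simps)
qed

text \<open>For an automorphism f one has ad (f X) = f (ad X) f^-1, and conjugation does not change
  a trace. This serves both for Ad g and for the Cartan involution.\<close>

lemma kill_automorphism:
  assumes f: "lin_op f" "lin_op f'" "\<And>X. f (f' X) = X" "\<And>X. f' (f X) = X"
    and fbr: "\<And>X Y. f (br X Y) = br (f X) (f Y)"
  shows "BK (f X) (f Y) = BK X Y"
proof -
  have "BK (f X) (f Y) = tr (\<lambda>Z. f (br X (br Y (f' Z))))"
    unfolding kill_tr by (simp add: f fbr)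
  also have "\<dots> = tr (\<lambda>Z. br X (br Y (f' (f Z))))"
    by (rule tr_commute[OF f(1) lin_op_compose2[OF lin_op_br(1) lin_op_compose2[OF lin_op_br(1) f(2)]]])
  finally show ?thesis by (simp add: f kill_tr)
qed

lemma kill_conj: "BK (conj_vec X) (conj_vec Y) = cnj (BK X Y)"
proof -
  have "conj_vec (axis j 1) = (axis j 1 :: complex^'n)" for j
    by (simp add: conj_vec_def vec_eq_iff axis_def)
  then have "br (conj_vec X) (br (conj_vec Y) (axis j 1)) = conj_vec (br X (br Y (axis j 1)))" for j
    by (simp add: br_conj)
  then show ?thesis
    by (simp add: kill_def killing_def trace_def matrix_def) (simp add: conj_vec_def)
qed

lemma kill_cvec: "BK (cvec X) (cvec Y) = of_real (killing (lie_br0 G) X Y)"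
proof -
  have "(axis j 1 :: complex^'n) = cvec (axis j 1)" for j
    by (simp add: cvec_def vec_eq_iff axis_def)
  then have "br (cvec X) (br (cvec Y) (axis j 1)) = cvec (lie_br0 G X (lie_br0 G Y (axis j 1)))" for j
    by (simp add: lie_br_def complexify2_cvec lie_br0_bilinear)
  then show ?thesis
    by (simp add: kill_def killing_def trace_def matrix_def) (simp add: cvec_def)
qed

lemma Ad_simps:
  assumes g: "g \<in> carrier G"
  shows "lin_op (Ad G g)" "Ad G g (br X Y) = br (Ad G g X) (Ad G g Y)"
    "Ad G (inv g) (Ad G g X) = X" "Ad G g (Ad G (inv g) X) = X"
    "BK (Ad G g X) (Ad G g Y) = BK X Y"
proof -
  have l: "linear (Ad0 G g)" if "g \<in> carrier G" for g using linear_Ad0[OF that] bounded_linear.linear by blast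
  have L: "lin_op (Ad G g)" if "g \<in> carrier G" for g unfolding Ad_def by (rule lin_op_complexify[OF l[OF that]])
  show "lin_op (Ad G g)" using L[OF g] .
  show b: "Ad G g (br X Y) = br (Ad G g X) (Ad G g Y)" for X Y
    unfolding Ad_def lie_br_def by (rule complexify_complexify2[where f="lie_br0 G" and g="Ad0 G g", OF l[OF g] Ad0_lie_br0[OF g]])
  show i: "Ad G (inv g) (Ad G g X) = X" "Ad G g (Ad G (inv g) X) = X" for X
    using Ad0_inv[OF g] by (simp_all add: cvec_eq_iff Ad_def)
  show "BK (Ad G g X) (Ad G g Y) = BK X Y"
    by (rule kill_automorphism[OF L[OF g] L[OF inv_closed[OF g]] i(2) i(1) b])
qed

end

section \<open>The Cartan involution and its positive form\<close>

context cartan_pair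
begin

abbreviation "\<theta>c \<equiv> complexify \<theta>"

lemma theta_linear: "linear \<theta>" and theta_theta: "\<theta> (\<theta> X) = X"
  and theta_br: "\<theta> (lie_br0 G X Y) = lie_br0 G (\<theta> X) (\<theta> Y)"
  and killing_theta_pos: "X \<noteq> 0 \<Longrightarrow> - killing (lie_br0 G) X (\<theta> X) > 0"
  using cartan_involution unfolding cartan_involution_def by auto

lemma thetac_lin: "lin_op \<theta>c" by (rule lin_op_complexify[OF theta_linear])

lemma thetac_simps:
  "\<theta>c (X + Y) = \<theta>c X + \<theta>c Y" "\<theta>c (X - Y) = \<theta>c X - \<theta>c Y" "\<theta>c (- X) = - \<theta>c X"
  "\<theta>c (c *s X) = c *s \<theta>c X" "\<theta>c 0 = 0" "\<theta>c (\<theta>c X) = X"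
proof -
  interpret Vector_Spaces.linear "(*s)" "(*s)" \<theta>c by (rule thetac_lin)
  show "\<theta>c (X + Y) = \<theta>c X + \<theta>c Y" "\<theta>c (X - Y) = \<theta>c X - \<theta>c Y" "\<theta>c (- X) = - \<theta>c X"
  "\<theta>c (c *s X) = c *s \<theta>c X" "\<theta>c 0 = 0"
    by (simp_all add: add diff neg scale)
  show "\<theta>c (\<theta>c X) = X" by (simp add: cvec_eq_iff theta_theta)
qed

lemma thetac_br: "\<theta>c (br X Y) = br (\<theta>c X) (\<theta>c Y)"
  unfolding lie_br_def by (rule complexify_complexify2[where f="lie_br0 G" and g=\<theta>, OF theta_linear theta_br])

lemma thetac_conj: "\<theta>c (conj_vec X) = conj_vec (\<theta>c X)"
  by (rule complexify_conj[OF theta_linear])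

lemma kill_theta: "BK (\<theta>c X) (\<theta>c Y) = BK X Y"
  by (rule kill_automorphism[OF thetac_lin thetac_lin]) (simp_all add: thetac_simps thetac_br)

abbreviation "hu \<equiv> herm_u G \<theta>"

text \<open>With x = a + i b the real part of the form at x is twice the sum of - B(a, \<theta> a)
  and - B(b, \<theta> b), the quantities that a Cartan involution makes positive; the mixed terms
  are i times a real number. Positivity on all of g allows orthonormal systems to be formed in any
  subspace.\<close>

lemma herm_u_positive: "positive_hermitian_form (*s) hu"
  unfolding positive_hermitian_form_def
proof (intro conjI allI impI)
  fix x y z :: "complex^'n" and c
  show "hu (x + y) z = hu x z + hu y z" "hu (c *s x) y = c * hu x y"
    by (simp_all add: herm_u_def kill_simps algebra_simps)
  have "BK y (\<theta>c (conj_vec x)) = BK (\<theta>c y) (conj_vec x)"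
    using kill_theta[of y "\<theta>c (conj_vec x)"] by (simp add: thetac_simps)
  also have "\<dots> = cnj (BK (conj_vec (\<theta>c y)) x)"
    using kill_conj[of "conj_vec (\<theta>c y)" x] by simp
  also have "\<dots> = cnj (BK x (\<theta>c (conj_vec y)))" by (simp add: kill_sym thetac_conj)
  finally show "hu y x = cnj (hu x y)" by (simp add: herm_u_def)
next
  fix x :: "complex^'n" assume x: "x \<noteq> 0"
  let ?a = "re_vec x" and ?b = "im_vec x"
  let ?k = "killing (lie_br0 G)"
  have cv: "\<theta>c (cvec a) = cvec (\<theta> a)" for a
    using theta_linear by (simp add: cvec_eq_iff linear_0)
  have X: "x = cvec ?a + \<i> *s cvec ?b" by (rule cvec_decomp)
  have Xb: "\<theta>c (conj_vec x) = cvec (\<theta> ?a) - \<i> *s cvec (\<theta> ?b)"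
    by (subst X) (simp add: thetac_simps cv)
  have "BK x (\<theta>c (conj_vec x)) = of_real (?k ?a (\<theta> ?a)) + of_real (?k ?b (\<theta> ?b))
      + \<i> * of_real (?k ?b (\<theta> ?a) - ?k ?a (\<theta> ?b))"
    by (subst Xb, subst X) (simp add: kill_simps kill_cvec algebra_simps)
  then have R: "Re (hu x x) = 2 * (- ?k ?a (\<theta> ?a)) + 2 * (- ?k ?b (\<theta> ?b))" by (simp add: herm_u_def)
  have k0: "?k 0 Y = 0" for Y
    by (simp add: killing_def bilinear_lzero[OF lie_br0_bilinear] trace_def matrix_def)
  have nn: "- ?k a (\<theta> a) \<ge> 0" for a
    using killing_theta_pos[of a] k0 by (cases "a = 0") auto
  have "?a \<noteq> 0 \<or> ?b \<noteq> 0" using x cvec_eq_iff[of x 0] by auto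
  then show "Re (hu x x) > 0"
    using killing_theta_pos[of ?a] killing_theta_pos[of ?b] nn[of ?a] nn[of ?b] unfolding R by fastforce
qed

end

section \<open>Hermitian forms\<close>

text \<open>The axioms speak about W only: the form \<open>H\<close> on V \<otimes> S is prescribed
  there and arbitrary on other functions of lists.\<close>

locale hermitian_space = vector_space s for s :: "complex \<Rightarrow> 'w::ab_group_add \<Rightarrow> 'w" +
  fixes W :: "'w set" and h :: "'w \<Rightarrow> 'w \<Rightarrow> complex"
  assumes subspace_W: "subspace W"
    and h_add: "\<lbrakk>x \<in> W; y \<in> W; z \<in> W\<rbrakk> \<Longrightarrow> h (x + y) z = h x z + h y z"
    and h_scale: "\<lbrakk>x \<in> W; z \<in> W\<rbrakk> \<Longrightarrow> h (s c x) z = c * h x z"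
    and h_sym: "\<lbrakk>x \<in> W; y \<in> W\<rbrakk> \<Longrightarrow> h y x = cnj (h x y)"
    and h_pos: "\<lbrakk>x \<in> W; x \<noteq> 0\<rbrakk> \<Longrightarrow> Re (h x x) > 0"
begin

lemmas W_closed = subspace_0[OF subspace_W] subspace_add[OF subspace_W] subspace_scale[OF subspace_W]
  subspace_diff[OF subspace_W] subspace_neg[OF subspace_W] subspace_sum[OF subspace_W]

lemma h_zero [simp]: "z \<in> W \<Longrightarrow> h 0 z = 0" "z \<in> W \<Longrightarrow> h z 0 = 0"
proof -
  show *: "z \<in> W \<Longrightarrow> h 0 z = 0" using h_scale[of 0 z 0] W_closed(1) by simp
  show "z \<in> W \<Longrightarrow> h z 0 = 0" using * h_sym[of 0 z] W_closed(1) by simp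
qed

lemma h_minus: "\<lbrakk>x \<in> W; z \<in> W\<rbrakk> \<Longrightarrow> h (- x) z = - h x z"
  using h_scale[of x z "-1"] by simp

lemma h_diff: "\<lbrakk>x \<in> W; y \<in> W; z \<in> W\<rbrakk> \<Longrightarrow> h (x - y) z = h x z - h y z"
  using h_add[of x "- y" z] h_minus[of y z] W_closed(5)[of y] by simp

lemma h_sum: "\<lbrakk>\<And>i. i \<in> I \<Longrightarrow> f i \<in> W; z \<in> W\<rbrakk> \<Longrightarrow> h (\<Sum>i\<in>I. f i) z = (\<Sum>i\<in>I. h (f i) z)"
  by (induction I rule: infinite_finite_induct) (simp_all add: h_add W_closed)

lemma h_right:
  "\<lbrakk>x \<in> W; y \<in> W; z \<in> W\<rbrakk> \<Longrightarrow> h z (x + y) = h z x + h z y"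
  "\<lbrakk>x \<in> W; y \<in> W; z \<in> W\<rbrakk> \<Longrightarrow> h z (x - y) = h z x - h z y"
  "\<lbrakk>x \<in> W; z \<in> W\<rbrakk> \<Longrightarrow> h z (s c x) = cnj c * h z x"
  using h_sym[of "x + y" z] h_sym[of "x - y" z] h_sym[of "s c x" z] h_sym[of x z] h_sym[of y z]
  by (simp_all add: h_add h_diff h_scale W_closed)

lemma h_self_zero: "x \<in> W \<Longrightarrow> h x x = 0 \<Longrightarrow> x = 0"
  using h_pos[of x] by auto

lemma h_self_real: "x \<in> W \<Longrightarrow> h x x = of_real (Re (h x x))"
  using h_sym[of x x] by (simp add: complex_eq_iff)

lemma h_self_nonneg: "x \<in> W \<Longrightarrow> Re (h x x) \<ge> 0"
  using h_pos[of x] by (cases "x = 0") (auto simp: W_closed)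

lemma orthogonal_span:
  assumes "S \<subseteq> W" "x \<in> W" "\<And>y. y \<in> S \<Longrightarrow> h x y = 0" "y \<in> span S"
  shows "h x y = 0"
proof -
  have "subspace {y \<in> W. h x y = 0}"
    unfolding subspace_def using assms(2) by (auto simp: h_right W_closed)
  moreover have "S \<subseteq> {y \<in> W. h x y = 0}" using assms by auto
  ultimately show ?thesis using span_minimal assms(4) by blast
qed

definition orthonormal :: "nat \<Rightarrow> (nat \<Rightarrow> 'w) \<Rightarrow> bool" where
  "orthonormal m b \<longleftrightarrow> (\<forall>i<m. b i \<in> W) \<and> (\<forall>i<m. \<forall>j<m. h (b i) (b j) = (if i = j then 1 else 0))"

lemma orthonormal_coeff:
  assumes "orthonormal m b" "j < m"
  shows "h (\<Sum>i<m. s (c i) (b i)) (b j) = c j"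
proof -
  have "b i \<in> W" if "i < m" for i using assms that by (simp add: orthonormal_def)
  note bW = this
  have "h (\<Sum>i<m. s (c i) (b i)) (b j) = (\<Sum>i<m. h (s (c i) (b i)) (b j))"
    by (rule h_sum) (use bW assms(2) W_closed in auto)
  also have "\<dots> = (\<Sum>i<m. c i * h (b i) (b j))"
    by (rule sum.cong) (use bW assms(2) h_scale in auto)
  finally have "h (\<Sum>i<m. s (c i) (b i)) (b j) = (\<Sum>i<m. c i * h (b i) (b j))" .
  also have "\<dots> = (\<Sum>i<m. if i = j then c i else 0)"
    using assms by (intro sum.cong) (auto simp: orthonormal_def)
  finally show ?thesis using assms by (simp add: sum.delta)
qed

lemma orthonormal_projection:
  assumes b: "orthonormal m b" and x: "x \<in> W" and z: "z \<in> span (b ` {..<m})"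
  shows "h (x - (\<Sum>i<m. s (h x (b i)) (b i))) z = 0"
proof (rule orthogonal_span[OF _ _ _ z])
  have bW: "b i \<in> W" if "i < m" for i using b that by (simp add: orthonormal_def)
  then show "b ` {..<m} \<subseteq> W" by auto
  have sW: "(\<Sum>i<m. s (h x (b i)) (b i)) \<in> W" using bW by (intro W_closed) auto
  then show "x - (\<Sum>i<m. s (h x (b i)) (b i)) \<in> W" using x by (simp add: W_closed)
  show "h (x - (\<Sum>i<m. s (h x (b i)) (b i))) y = 0" if y: "y \<in> b ` {..<m}" for y
  proof -
    obtain j where j: "j < m" "y = b j" using y by auto
    then show ?thesis using orthonormal_coeff[OF b j(1), of "\<lambda>i. h x (b i)"] x sW bW
      by (simp add: h_diff)
  qed
qed

text \<open>Gram-Schmidt on an arbitrary finite set: a vector whose residue \<open>a'\<close>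
  vanishes adds nothing to the span and is skipped.\<close>

lemma orthonormal_basis:
  assumes "finite S" "S \<subseteq> W"
  shows "\<exists>m b. orthonormal m b \<and> span (b ` {..<m}) = span S"
  using assms
proof (induction S rule: finite_induct)
  case empty
  show ?case by (rule exI[of _ 0]) (simp add: orthonormal_def)
next
  case (insert a S)
  then obtain m b where b: "orthonormal m b" "span (b ` {..<m}) = span S" by auto
  have aW: "a \<in> W" using insert by auto
  have bW: "b i \<in> W" if "i < m" for i using b that by (simp add: orthonormal_def)
  define p where "p = (\<Sum>i<m. s (h a (b i)) (b i))"
  have p: "p \<in> span S" unfolding p_def b(2)[symmetric] by (intro span_sum span_scale span_base) auto
  have sW: "span S \<subseteq> W" using insert subspace_W by (simp add: span_minimal)
  define a' where "a' = a - p"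
  have a'W: "a' \<in> W" using aW p sW by (auto simp: a'_def W_closed)
  have orth: "h a' z = 0" if "z \<in> span S" for z
    using orthonormal_projection[OF b(1) aW, of z] that b(2) by (simp add: a'_def p_def)
  have sp: "span (insert a S) = span (insert a' S)"
  proof (rule span_eq[THEN iffD2], rule conjI)
    have "p \<in> span (insert a' S)" "a' \<in> span (insert a' S)"
      using p span_mono[of S "insert a' S"] by (auto intro: span_base)
    then have "a \<in> span (insert a' S)" using span_add[of a' "insert a' S" p] by (simp add: a'_def)
    then show "insert a S \<subseteq> span (insert a' S)" by (auto intro: span_base)
    have "p \<in> span (insert a S)" using p span_mono[of S "insert a S"] by auto
    then show "insert a' S \<subseteq> span (insert a S)" by (auto simp: a'_def intro: span_base span_diff)
  qed
  show ?case
  proof (cases "a' = 0")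
    case True
    then have "span (insert a S) = span S" using sp by (simp add: span_insert_0)
    then show ?thesis using b by auto
  next
    case False
    define r where "r = sqrt (Re (h a' a'))"
    have r: "r > 0" using h_pos[OF a'W False] by (simp add: r_def)
    define e where "e = s (of_real (1 / r)) a'"
    define c where "c = (\<lambda>i. if i < m then b i else e)"
    have eW: "e \<in> W" using a'W by (simp add: e_def W_closed)
    have "h e e = of_real (1 / r) * (of_real (1 / r) * h a' a')"
      using a'W by (simp add: e_def h_scale h_right W_closed)
    also have "h a' a' = of_real (r * r)" using h_self_real[OF a'W] h_self_nonneg[OF a'W] by (simp add: r_def)
    finally have ee: "h e e = 1" using r by (simp flip: of_real_mult)
    have eb: "h e (b i) = 0" if "i < m" for i
    proof -
      have "b i \<in> span S" unfolding b(2)[symmetric] using that by (auto intro: span_base)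
      then show ?thesis using orth a'W sW by (auto simp: e_def h_scale)
    qed
    have be: "h (b i) e = 0" if "i < m" for i using h_sym[OF eW bW[OF that]] eb[OF that] by simp
    have "orthonormal (Suc m) c"
      using b(1) eW ee eb be unfolding orthonormal_def c_def by (auto simp: less_Suc_eq)
    moreover have "span (c ` {..<Suc m}) = span (insert a S)"
    proof -
      have "c ` {..<Suc m} = insert e (b ` {..<m})" by (auto simp: c_def lessThan_Suc)
      moreover have "span (insert e (b ` {..<m})) = span (insert a' S)"
      proof (rule span_eq[THEN iffD2], rule conjI)
        have "e \<in> span (insert a' S)" by (auto simp: e_def intro: span_scale span_base)
        moreover have "b ` {..<m} \<subseteq> span (insert a' S)"
          using b(2) span_superset[of "b ` {..<m}"] span_mono[of S "insert a' S"] by auto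
        ultimately show "insert e (b ` {..<m}) \<subseteq> span (insert a' S)" by auto
        have "a' = s (of_real r) e" using r by (simp add: e_def flip: of_real_mult)
        then have "a' \<in> span (insert e (b ` {..<m}))" by (metis insertI1 span_base span_scale)
        moreover have "S \<subseteq> span (insert e (b ` {..<m}))"
          using b(2) span_superset[of S] span_mono[of "b ` {..<m}" "insert e (b ` {..<m})"] by auto
        ultimately show "insert a' S \<subseteq> span (insert e (b ` {..<m}))" by auto
      qed
      ultimately show ?thesis using sp by simp
    qed
    ultimately show ?thesis by blast
  qed
qed

text \<open>W need not be complete, so orthogonal projection is provided onto finite-dimensional
  subspaces, where an orthonormal basis yields it.\<close>

lemma projection_onto_span:
  assumes "finite S" "S \<subseteq> W" "x \<in> W"
  obtains y where "y \<in> span S" "\<And>z. z \<in> span S \<Longrightarrow> h (x - y) z = 0"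
proof -
  obtain m b where b: "orthonormal m b" "span (b ` {..<m}) = span S" using orthonormal_basis[OF assms(1,2)] by blast
  have "(\<Sum>i<m. s (h x (b i)) (b i)) \<in> span S"
    unfolding b(2)[symmetric] by (intro span_sum span_scale span_base) auto
  then show ?thesis using that orthonormal_projection[OF b(1) assms(3)] b(2) by metis
qed

end

lemma hermitian_spaceI:
  assumes "vector_space s" and h: "positive_hermitian_form s h" and "module.subspace s W"
  shows "hermitian_space s W h"
proof -
  have *: "h (x + y) z = h x z + h y z" "h (s c x) y = c * h x y" "h y x = cnj (h x y)"
    "x \<noteq> 0 \<Longrightarrow> Re (h x x) > 0" for x y z c
    using h unfolding positive_hermitian_form_def by blast+
  show ?thesis
    by (intro hermitian_space.intro hermitian_space_axioms.intro assms(1,3) *)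
qed

section \<open>The spin module\<close>

lemmas fun_app = plus_fun_apply zero_fun_apply minus_apply uminus_apply

text \<open>The induction methods eta-expand variables of function type; evaluating \<open>(x + y) a\<close> would then
  destroy the sum \<open>x + y\<close>.\<close>
declare fun_app [simp del]

locale spin_space = vector_space s for s :: "complex \<Rightarrow> 'v::ab_group_add \<Rightarrow> 'v" +
  fixes B :: "complex^'n \<Rightarrow> complex^'n \<Rightarrow> complex" and n :: nat and ub us :: "nat \<Rightarrow> complex^'n"
  assumes B_add: "B (X + Y) Z = B X Z + B Y Z" "B Z (X + Y) = B Z X + B Z Y"
    and B_scale: "B (c *s X) Z = c * B X Z" "B Z (c *s X) = c * B Z X"
    and dual: "\<lbrakk>i < n; j < n\<rbrakk> \<Longrightarrow> B (us i) (ub j) = (if i = j then 1 else 0)"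
begin

abbreviation "e \<equiv> cl_u s B"
abbreviation f :: "complex^'n \<Rightarrow> ((complex^'n) list \<Rightarrow> 'v) \<Rightarrow> (complex^'n) list \<Rightarrow> 'v" where "f \<equiv> cl_ubar s"
abbreviation sf :: "complex \<Rightarrow> ((complex^'n) list \<Rightarrow> 'v) \<Rightarrow> (complex^'n) list \<Rightarrow> 'v" where "sf \<equiv> scale_fun s"
abbreviation "U \<equiv> vec.span (ub ` {..<n})"
abbreviation "Ub \<equiv> vec.span (us ` {..<n})"
abbreviation "VS \<equiv> V_tensor_S s B U"
abbreviation "linV \<equiv> Vector_Spaces.linear s s"
abbreviation vac :: "'v \<Rightarrow> (complex^'n) list \<Rightarrow> 'v" where "vac v \<equiv> decomposable s B v []"

sublocale F: vector_space sf
  by unfold_locales (simp_all add: scale_fun_def fun_eq_iff fun_app scale_right_distrib scale_left_distrib)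

lemma B_zero [simp]: "B 0 Z = 0" "B Z 0 = 0"
  using B_scale(1)[of 0 0 Z] B_scale(2)[of Z 0 0] by simp_all

lemma ub_in: "i < n \<Longrightarrow> ub i \<in> U" and us_in: "i < n \<Longrightarrow> us i \<in> Ub"
  by (auto intro: vec.span_base)

lemma expand_U: 
  assumes "X \<in> U" shows "(\<Sum>i<n. B (us i) X *s ub i) = X"
  using assms
proof (induction rule: vec.span_induct_alt)
  case (step c x y)
  then obtain j where j: "j < n" "x = ub j" by auto
  have "(\<Sum>i<n. B (us i) x *s ub i) = (\<Sum>i<n. if i = j then x else 0)"
    by (rule sum.cong) (auto simp: j dual)
  then have "(\<Sum>i<n. B (us i) x *s ub i) = x" using j by simp
  moreover have "(\<Sum>i<n. B (us i) (c *s x + y) *s ub i) = c *s (\<Sum>i<n. B (us i) x *s ub i) + (\<Sum>i<n. B (us i) y *s ub i)"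
    by (simp add: B_add B_scale vec.scale_left_distrib sum.distrib vec.scale_sum_right)
  ultimately show ?case using step by simp
qed simp

lemma expand_Ub: 
  assumes "X \<in> Ub" shows "(\<Sum>i<n. B X (ub i) *s us i) = X"
  using assms
proof (induction rule: vec.span_induct_alt)
  case (step c x y)
  then obtain j where j: "j < n" "x = us j" by auto
  have "(\<Sum>i<n. B x (ub i) *s us i) = (\<Sum>i<n. if i = j then x else 0)"
    by (rule sum.cong) (auto simp: j dual)
  then have "(\<Sum>i<n. B x (ub i) *s us i) = x" using j by simp
  moreover have "(\<Sum>i<n. B (c *s x + y) (ub i) *s us i) = c *s (\<Sum>i<n. B x (ub i) *s us i) + (\<Sum>i<n. B y (ub i) *s us i)"
    by (simp add: B_add B_scale vec.scale_left_distrib sum.distrib vec.scale_sum_right)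
  ultimately show ?case using step by simp
qed simp

lemma e_linear: "Vector_Spaces.linear sf sf (e Y)"
  by unfold_locales
    (simp_all add: cl_u_def scale_fun_def fun_eq_iff fun_app scale_right_distrib sum.distrib scale_sum_right mult.commute)

lemma f_linear: "Vector_Spaces.linear sf sf (f W)"
  by unfold_locales
    (simp_all add: cl_ubar_def scale_fun_def fun_eq_iff fun_app scale_right_distrib mult.commute)

lemma comp_linear: "linV R \<Longrightarrow> Vector_Spaces.linear sf sf ((\<circ>) R)"
proof -
  assume "linV R"
  then interpret R: Vector_Spaces.linear s s R .
  show "Vector_Spaces.linear sf sf ((\<circ>) R)"
    by unfold_locales (simp_all add: scale_fun_def fun_eq_iff fun_app R.add R.scale)
qed

lemma linear_sf:
  assumes "Vector_Spaces.linear sf sf T"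
  shows "T (x + y) = T x + T y" "T (x - y) = T x - T y" "T (- x) = - T x" "T 0 = 0"
    "T (sf c x) = sf c (T x)" "T (\<Sum>i\<in>I. g i) = (\<Sum>i\<in>I. T (g i))"
proof -
  interpret Vector_Spaces.linear sf sf T by fact
  show "T (x + y) = T x + T y" "T (x - y) = T x - T y" "T (- x) = - T x" "T 0 = 0"
    "T (sf c x) = sf c (T x)" "T (\<Sum>i\<in>I. g i) = (\<Sum>i\<in>I. T (g i))"
    by (simp_all add: add diff neg scale sum)
qed

lemmas e_simps = linear_sf[OF e_linear]
lemmas f_simps = linear_sf[OF f_linear]
lemmas comp_simps = linear_sf[OF comp_linear]

lemma e_lin: "e (X + Y) x = e X x + e Y x" "e (c *s X) x = sf c (e X x)"
  by (simp_all add: cl_u_def scale_fun_def fun_eq_iff fun_app B_add B_scale distrib_left scale_left_distrib sum.distrib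
      scale_sum_right mult.left_commute)

lemma comp_e: "linV R \<Longrightarrow> R \<circ> e Y x = e Y (R \<circ> x)"
proof -
  assume "linV R"
  then interpret R: Vector_Spaces.linear s s R .
  show "R \<circ> e Y x = e Y (R \<circ> x)"
    by (simp add: cl_u_def fun_eq_iff fun_app R.sum R.scale)
qed

lemma comp_f: "linV R \<Longrightarrow> R \<circ> f W x = f W (R \<circ> x)"
proof -
  assume "linV R"
  then interpret R: Vector_Spaces.linear s s R .
  show "R \<circ> f W x = f W (R \<circ> x)"
    by (simp add: cl_ubar_def fun_eq_iff fun_app R.scale)
qed

lemma remove_at_Cons: "remove_at 0 (Z # Zs) = Zs" "remove_at (Suc i) (Z # Zs) = Z # remove_at i Zs"
  by (simp_all add: remove_at_def)

text \<open>The Clifford relation W Y + Y W = 2 B(W, Y), valid for every function of lists. In the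
  sum defining \<open>e Y x\<close> at a list with head W, removing the head gives the scalar term;
  every other position is shifted by one, which changes its sign.\<close>

lemma f_e: "f W (e Y x) = sf (2 * B W Y) x - e Y (f W x)"
proof
  fix Zs
  have "f W (e Y x) Zs = s 2 (s (B W Y) (x Zs) + (\<Sum>i<length Zs. s ((-1) ^ Suc i * B (Zs ! i) Y) (x (W # remove_at i Zs))))"
    by (simp add: cl_ubar_def cl_u_def lessThan_Suc_eq_insert_0 remove_at_Cons sum.reindex)
  also have "\<dots> = (sf (2 * B W Y) x - e Y (f W x)) Zs"
    by (simp add: cl_ubar_def cl_u_def scale_fun_def scale_right_diff_distrib scale_sum_right sum_negf fun_app ac_simps)
  finally show "f W (e Y x) Zs = (sf (2 * B W Y) x - e Y (f W x)) Zs" .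
qed

lemma e_Nil [simp]: "e Y x [] = 0" by (simp add: cl_u_def)
lemma f_vac [simp]: "f W (vac v) = 0"
  by (simp add: cl_ubar_def decomposable_def gram_det_def fun_eq_iff fun_app)

lemma vac_Nil [simp]: "vac v [] = v" by (simp add: decomposable_def gram_det_def)

lemma vac_add: "vac (v + w) = vac v + vac w" "sf c (vac v) = vac (s c v)"
  by (simp_all add: decomposable_def scale_fun_def fun_eq_iff fun_app scale_right_distrib mult.commute)

text \<open>Contraction by the head of the list passes through the anticommutator, because the
  scalar terms of \<open>f_e\<close> cancel in pairs; this permits induction on the list for
  arbitrary functions.\<close>

lemma e_anticomm: "e Y (e Y' x) + e Y' (e Y x) = 0"
proof
  fix Zs
  show "(e Y (e Y' x) + e Y' (e Y x)) Zs = (0 :: (complex^'n) list \<Rightarrow> 'v) Zs"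
  proof (induction Zs arbitrary: x)
    case (Cons Z Zs)
    have "s 2 ((e Y (e Y' x) + e Y' (e Y x)) (Z # Zs)) = f Z (e Y (e Y' x) + e Y' (e Y x)) Zs"
      by (simp add: cl_ubar_def)
    also have "f Z (e Y (e Y' x) + e Y' (e Y x)) = e Y (e Y' (f Z x)) + e Y' (e Y (f Z x))"
      by (simp add: f_simps f_e e_simps)
    also have "\<dots> Zs = 0" using Cons.IH[of "f Z x"] by (simp add: fun_app)
    finally show ?case by (simp add: fun_app)
  qed (simp add: fun_app)
qed

lemma decomposable_Cons: "decomposable s B v (Y # Ys) = e Y (decomposable s B v Ys)"
  by (simp add: cl_u_decomposable vector_space_axioms)

lemma decomposable_scale: "sf c (decomposable s B v Ys) = decomposable s B (s c v) Ys"
  by (simp add: decomposable_def scale_fun_def fun_eq_iff fun_app mult.commute)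

lemma decomposable_comp: "linV R \<Longrightarrow> R \<circ> decomposable s B v Ys = decomposable s B (R v) Ys"
proof -
  assume "linV R"
  then interpret R: Vector_Spaces.linear s s R .
  show ?thesis by (simp add: decomposable_def fun_eq_iff fun_app R.scale)
qed

lemma VS_subspace: "F.subspace VS"
  by (simp add: V_tensor_S_def)

lemmas VS_closed = F.subspace_0[OF VS_subspace] F.subspace_add[OF VS_subspace] F.subspace_scale[OF VS_subspace]
  F.subspace_diff[OF VS_subspace] F.subspace_neg[OF VS_subspace] F.subspace_sum[OF VS_subspace]

lemma VS_vac: "vac v \<in> VS"
  unfolding V_tensor_S_def by (rule F.span_base) (auto intro!: exI[of _ v] exI[of _ "[]"])

lemma VS_e: 
  assumes "Y \<in> U" "x \<in> VS" shows "e Y x \<in> VS"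
  using assms(2) unfolding V_tensor_S_def
proof (induction rule: F.span_induct_alt)
  case (step c x y)
  then obtain v Ys where "x = decomposable s B v Ys" "set Ys \<subseteq> U" by auto
  then have "e Y x \<in> F.span {decomposable s B v Ys |v Ys. set Ys \<subseteq> U}"
    using assms(1) by (auto simp flip: decomposable_Cons intro!: F.span_base exI[of _ v] exI[of _ "Y # Ys"])
  then show ?case unfolding e_simps using step by (blast intro: F.span_add F.span_scale)
next
  case base
  then show ?case unfolding e_simps by (rule F.span_zero)
qed

text \<open>V \<otimes> S behaves as a Fock space: it is generated from the vacuum vectors v
  \<otimes> 1 by exterior multiplication and sums, scalars being absorbed into v.\<close>

lemma VS_induct [consumes 1, case_names vac e add]:
  assumes "x \<in> VS"
    and v: "\<And>v. P (vac v)"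
    and e: "\<And>Y x. Y \<in> U \<Longrightarrow> x \<in> VS \<Longrightarrow> P x \<Longrightarrow> P (e Y x)"
    and a: "\<And>x y. x \<in> VS \<Longrightarrow> y \<in> VS \<Longrightarrow> P x \<Longrightarrow> P y \<Longrightarrow> P (x + y)"
  shows "P x"
proof -
  have d: "decomposable s B v Ys \<in> VS \<and> P (decomposable s B v Ys)" if "set Ys \<subseteq> U" for v Ys
    using that by (induction Ys) (auto simp: VS_vac v decomposable_Cons intro!: VS_e e)
  have "x \<in> VS \<and> P x"
    using assms(1) unfolding V_tensor_S_def
  proof (induction rule: F.span_induct_alt)
    case base
    have "vac 0 = 0" by (simp add: decomposable_def fun_eq_iff fun_app)
    then show ?case using v[of 0] VS_vac[of 0] by (simp add: V_tensor_S_def)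
  next
    case (step c x y)
    then show ?case using d a VS_closed(2) by (auto simp: V_tensor_S_def decomposable_scale)
  qed
  then show ?thesis ..
qed

lemma VS_f: "x \<in> VS \<Longrightarrow> f W x \<in> VS"
  by (induction rule: VS_induct) (simp_all add: f_e f_simps VS_closed VS_e)

lemma VS_comp: "x \<in> VS \<Longrightarrow> linV R \<Longrightarrow> R \<circ> x \<in> VS"
  by (induction rule: VS_induct) (simp_all add: decomposable_comp VS_vac comp_e VS_e comp_simps VS_closed)

text \<open>An arbitrary function of lists need be neither alternating nor additive in its entries,
  so this identity and \<open>f_lin\<close> are confined to \<open>VS\<close> and obtained by
  induction from the vacuum.\<close>

lemma f_anticomm: "x \<in> VS \<Longrightarrow> f W (f W' x) + f W' (f W x) = 0"
proof (induction rule: VS_induct)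
  case (e Y x)
  have "f W (f W' (e Y x)) + f W' (f W (e Y x)) = e Y (f W (f W' x) + f W' (f W x))"
    by (simp add: f_e f_simps e_simps)
  then show ?case using e by (simp add: e_simps)
next
  case (add x y)
  have "f W (f W' (x + y)) + f W' (f W (x + y)) =
      (f W (f W' x) + f W' (f W x)) + (f W (f W' y) + f W' (f W y))"
    by (simp add: f_simps)
  then show ?case using add by simp
qed (simp add: f_simps)

lemma f_lin: "x \<in> VS \<Longrightarrow> f (X + Y) x = f X x + f Y x" "x \<in> VS \<Longrightarrow> f (c *s X) x = sf c (f X x)"
proof (induction rule: VS_induct)
  case (e Y x)
  { case 1 show ?case using e by (simp add: f_e B_add distrib_left F.scale_left_distrib e_simps) }
  { case 2 show ?case using e by (simp add: f_e B_scale e_simps F.scale_right_diff_distrib mult.left_commute) }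
qed (simp_all add: f_simps F.scale_right_distrib)

lemma f_lin_simps:
  assumes "x \<in> VS"
  shows "f (X - Y) x = f X x - f Y x" "f (- X) x = - f X x" "f 0 x = 0"
    "f (\<Sum>i\<in>I. W i) x = (\<Sum>i\<in>I. f (W i) x)"
proof -
  show z: "f 0 x = 0" using f_lin(2)[OF assms, of 0 0] by simp
  show n: "f (- X) x = - f X x" for X using f_lin(2)[OF assms, of "-1" X] by simp
  show "f (X - Y) x = f X x - f Y x" using f_lin(1)[OF assms, of X "- Y"] n by simp
  show "f (\<Sum>i\<in>I. W i) x = (\<Sum>i\<in>I. f (W i) x)"
    by (induction I rule: infinite_finite_induct) (simp_all add: z f_lin(1)[OF assms])
qed

text \<open>\<open>Fock A m\<close> is A \<otimes> \<Lambda> of the span of \<open>ub 0\<close>,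
  ..., \<open>ub (m - 1)\<close>, each stage adjoining one generator at most once. The subspace A is
  a parameter so that finite-dimensional subspaces of V give finite-dimensional subspaces of V
  \<otimes> S.\<close>

primrec Fock :: "'v set \<Rightarrow> nat \<Rightarrow> ((complex^'n) list \<Rightarrow> 'v) set" where
  "Fock A 0 = vac ` A"
| "Fock A (Suc m) = {y + e (ub m) z |y z. y \<in> Fock A m \<and> z \<in> Fock A m}"

lemma Fock_SucI: "y \<in> Fock A m \<Longrightarrow> z \<in> Fock A m \<Longrightarrow> y + e (ub m) z \<in> Fock A (Suc m)"
  by auto

lemma Fock_subspace:
  assumes "subspace A" shows "F.subspace (Fock A m)"
proof (induction m)
  case 0
  have z: "vac 0 = 0" by (simp add: decomposable_def fun_eq_iff fun_app)
  show ?case unfolding F.subspace_def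
    using assms by (auto simp: vac_add subspace_def simp flip: vac_add(1) z)
next
  case (Suc m)
  show ?case unfolding F.subspace_def
  proof (intro conjI ballI allI)
    show "0 \<in> Fock A (Suc m)"
      using Fock_SucI[OF F.subspace_0[OF Suc] F.subspace_0[OF Suc]] by (simp add: e_simps)
  next
    fix x y assume "x \<in> Fock A (Suc m)" "y \<in> Fock A (Suc m)"
    then obtain a b c d where "x = a + e (ub m) b" "y = c + e (ub m) d"
      "a \<in> Fock A m" "b \<in> Fock A m" "c \<in> Fock A m" "d \<in> Fock A m" by auto
    then show "x + y \<in> Fock A (Suc m)"
      using Fock_SucI[of "a + c" A m "b + d"] F.subspace_add[OF Suc] by (simp add: e_simps add_ac)
  next
    fix c x assume "x \<in> Fock A (Suc m)"
    then obtain a b where "x = a + e (ub m) b" "a \<in> Fock A m" "b \<in> Fock A m" by auto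
    then show "sf c x \<in> Fock A (Suc m)"
      using Fock_SucI[of "sf c a" A m "sf c b"] F.subspace_scale[OF Suc] by (simp add: e_simps F.scale_right_distrib)
  qed
qed

lemma Fock_Suc: "subspace A \<Longrightarrow> Fock A m \<subseteq> Fock A (Suc m)"
  using Fock_SucI[OF _ F.subspace_0[OF Fock_subspace], of _ A m] by (auto simp: e_simps)

lemma Fock_mono: "subspace A \<Longrightarrow> m \<le> m' \<Longrightarrow> Fock A m \<subseteq> Fock A m'"
  by (rule lift_Suc_mono_le[of "Fock A"]) (use Fock_Suc in auto)

lemma Fock_e:
  assumes A: "subspace A" shows "x \<in> Fock A m \<Longrightarrow> k < m \<Longrightarrow> e (ub k) x \<in> Fock A m"
proof (induction m arbitrary: x)
  case (Suc m)
  obtain y z where x: "x = y + e (ub m) z" "y \<in> Fock A m" "z \<in> Fock A m" using Suc.prems by auto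
  note sub = Fock_subspace[OF A, of m]
  show ?case
  proof (cases "k = m")
    case True
    have "sf 2 (e (ub m) (e (ub m) z)) = 0"
      using e_anticomm[of "ub m" "ub m" z] F.scale_left_distrib[of 1 1 "e (ub m) (e (ub m) z)"] by simp
    then have "e (ub k) x = 0 + e (ub m) y" using True x by (simp add: e_simps)
    then show ?thesis using Fock_SucI[OF F.subspace_0[OF sub] x(2)] by metis
  next
    case False
    then have k: "k < m" using Suc by simp
    have "e (ub k) (e (ub m) z) = e (ub m) (e (ub k) (- z))"
      using e_anticomm[of "ub k" "ub m" z] by (simp add: e_simps eq_neg_iff_add_eq_0)
    then have "e (ub k) x = e (ub k) y + e (ub m) (e (ub k) (- z))" using x by (simp add: e_simps)
    then show ?thesis using Suc.IH[OF x(2) k] Suc.IH[OF F.subspace_neg[OF sub x(3)] k] Fock_SucI by metis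
  qed
qed simp

lemma Fock_eU:
  assumes A: "subspace A" and x: "x \<in> Fock A n" and Y: "Y \<in> U"
  shows "e Y x \<in> Fock A n"
  using Y
proof (induction rule: vec.span_induct_alt)
  case base
  have "e 0 x = 0" using e_lin(2)[of 0 0 x] by simp
  then show ?case using F.subspace_0[OF Fock_subspace[OF A]] by simp
next
  case (step c Y Z)
  then have "e Y x \<in> Fock A n" using Fock_e[OF A x] by auto
  then show ?case using step Fock_subspace[OF A] by (simp add: e_lin F.subspace_add F.subspace_scale)
qed

text \<open>\<open>us k\<close> pairs to zero with every generator adjoined so far, and contraction
  kills the vacuum.\<close>

lemma Fock_f_high: "x \<in> Fock A m \<Longrightarrow> m \<le> k \<Longrightarrow> k < n \<Longrightarrow> f (us k) x = 0"
proof (induction m arbitrary: x)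
  case (Suc m)
  then obtain y z where x: "x = y + e (ub m) z" "y \<in> Fock A m" "z \<in> Fock A m" by auto
  then show ?case using Suc.IH[of y] Suc.IH[of z] Suc.prems by (simp add: f_simps f_e e_simps dual)
qed auto

lemma Fock_f: 
  assumes A: "subspace A" shows "x \<in> Fock A m \<Longrightarrow> m \<le> n \<Longrightarrow> f W x \<in> Fock A m"
proof (induction m arbitrary: x)
  case (Suc m)
  then obtain y z where x: "x = y + e (ub m) z" "y \<in> Fock A m" "z \<in> Fock A m" by auto
  note sub = Fock_subspace[OF A, of m]
  have "f W x = (f W y + sf (2 * B W (ub m)) z) + e (ub m) (f W (- z))"
    using x by (simp add: f_simps f_e e_simps)
  moreover have "f W y + sf (2 * B W (ub m)) z \<in> Fock A m" "f W (- z) \<in> Fock A m"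
    using Suc.IH[OF x(2)] Suc.IH[OF F.subspace_neg[OF sub x(3)]] x Suc.prems(2)
    by (simp_all add: F.subspace_add[OF sub] F.subspace_scale[OF sub])
  ultimately show ?case using Fock_SucI by metis
next
  case 0
  then show ?case using F.subspace_0[OF Fock_subspace[OF A], of 0] by auto
qed

lemma Fock_comp:
  assumes "linV R" "R ` A \<subseteq> A" shows "x \<in> Fock A m \<Longrightarrow> R \<circ> x \<in> Fock A m"
proof (induction m arbitrary: x)
  case (Suc m)
  then obtain y z where x: "x = y + e (ub m) z" "y \<in> Fock A m" "z \<in> Fock A m" by auto
  then have "R \<circ> x = (R \<circ> y) + e (ub m) (R \<circ> z)" using assms(1) by (simp add: comp_simps comp_e)
  then show ?case using Suc.IH[OF x(2)] Suc.IH[OF x(3)] Fock_SucI by metis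
qed (use assms in \<open>auto simp: decomposable_comp\<close>)

lemma Fock_sub_VS: "x \<in> Fock A m \<Longrightarrow> m \<le> n \<Longrightarrow> x \<in> VS"
proof (induction m arbitrary: x)
  case (Suc m)
  then show ?case by (auto intro!: VS_closed VS_e ub_in)
qed (auto simp: VS_vac)

lemma VS_Fock: "VS = Fock UNIV n"
proof
  show "Fock UNIV n \<subseteq> VS" using Fock_sub_VS by auto
  show "VS \<subseteq> Fock UNIV n"
  proof
    fix x assume "x \<in> VS"
    then show "x \<in> Fock UNIV n"
    proof (induction rule: VS_induct)
      case (vac v)
      then show ?case using Fock_mono[of UNIV 0 n] by auto
    qed (auto intro: Fock_eU F.subspace_add[OF Fock_subspace])
  qed
qed

text \<open>An element of V \<otimes> S involves only finitely many vectors of V. If each vector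
  lies in a finite-dimensional subspace with property \<open>Q\<close>, and any two such subspaces
  lie in a third, then one subspace serves for all of them.\<close>

lemma Fock_Un:
  assumes "x \<in> VS" "\<And>v. \<exists>A. subspace A \<and> finite_dimensional s A \<and> Q A \<and> v \<in> A"
    and "\<And>A A'. subspace A \<Longrightarrow> finite_dimensional s A \<Longrightarrow> Q A \<Longrightarrow> subspace A' \<Longrightarrow> finite_dimensional s A' \<Longrightarrow> Q A' \<Longrightarrow>
      \<exists>A''. subspace A'' \<and> finite_dimensional s A'' \<and> Q A'' \<and> A \<subseteq> A'' \<and> A' \<subseteq> A''"
  shows "\<exists>A. subspace A \<and> finite_dimensional s A \<and> Q A \<and> x \<in> Fock A n"
proof -
  have mono: "Fock A m \<subseteq> Fock A' m" if "A \<subseteq> A'" for A A' m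
    by (induction m) (use that in auto)
  show ?thesis using assms(1)
  proof (induction rule: VS_induct)
    case (vac v)
    then show ?case using assms(2)[of v] Fock_mono[of _ 0 n] by fastforce
  next
    case (e Y x)
    then show ?case using Fock_eU by blast
  next
    case (add x y)
    then obtain A A' where "subspace A" "finite_dimensional s A" "Q A" "x \<in> Fock A n"
       "subspace A'" "finite_dimensional s A'" "Q A'" "y \<in> Fock A' n" by blast
    moreover obtain A'' where A'': "subspace A''" "finite_dimensional s A''" "Q A''" "A \<subseteq> A''" "A' \<subseteq> A''"
      using assms(3) calculation by metis
    ultimately have "x \<in> Fock A'' n" "y \<in> Fock A'' n" using mono by blast+
    then show ?case using A'' F.subspace_add[OF Fock_subspace[OF A''(1)]] by blast
  qed
qed

lemma Fock_finite_dimensional: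
  assumes "finite_dimensional s A"
  shows "\<exists>S. finite S \<and> Fock A m \<subseteq> F.span S"
proof (induction m)
  case 0
  obtain S where S: "finite S" "A \<subseteq> span S" using assms by (auto simp: finite_dimensional_def)
  have "vac v \<in> F.span (vac ` S)" if "v \<in> span S" for v
    using that
  proof (induction rule: span_induct_alt)
    case base
    have "vac 0 = 0" by (simp add: decomposable_def fun_eq_iff fun_app)
    then show ?case by (simp add: F.span_zero)
  next
    case (step c x y)
    then show ?case by (auto simp: vac_add(1) simp flip: vac_add(2) intro!: F.span_add F.span_scale intro: F.span_base)
  qed
  then show ?case using S by (intro exI[of _ "vac ` S"]) auto
next
  case (Suc m)
  then obtain S where S: "finite S" "Fock A m \<subseteq> F.span S" by blast
  have e: "e (ub m) z \<in> F.span (e (ub m) ` S)" if "z \<in> F.span S" for z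
    using that
    by (induction rule: F.span_induct_alt)
      (auto simp: e_simps F.span_zero intro!: F.span_add F.span_scale intro: F.span_base)
  have "y + e (ub m) z \<in> F.span (S \<union> e (ub m) ` S)" if "y \<in> Fock A m" "z \<in> Fock A m" for y z
  proof (rule F.span_add)
    show "y \<in> F.span (S \<union> e (ub m) ` S)" using S(2) that(1) F.span_mono[of S "S \<union> e (ub m) ` S"] by auto
    show "e (ub m) z \<in> F.span (S \<union> e (ub m) ` S)" 
      using e[of z] S(2) that(2) F.span_mono[of "e (ub m) ` S" "S \<union> e (ub m) ` S"] by auto
  qed
  then show ?case using S(1) by (intro exI[of _ "S \<union> e (ub m) ` S"]) auto
qed

text \<open>Contraction with \<open>us m\<close> turns y + e (ub m) z, with y and z from stage m,
  into 2 z, since it annihilates both y and z. So the coefficients are recovered from values on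
  lists over the dual basis, one generator at a time.\<close>

lemma VS_eqI:
  assumes "x \<in> VS" "\<And>Zs. set Zs \<subseteq> us ` {..<n} \<Longrightarrow> x Zs = 0"
  shows "x = 0"
proof -
  have "x = 0" if "x \<in> Fock UNIV m" "m \<le> n" "\<forall>Zs. set Zs \<subseteq> us ` {..<n} \<longrightarrow> x Zs = 0" for m x
    using that
  proof (induction m arbitrary: x)
    case 0
    then obtain v where "x = vac v" by auto
    moreover have "x [] = 0" using 0 by simp
    ultimately show ?case using vac_add(2)[of 0 0] by simp
  next
    case (Suc m)
    then obtain y z where x: "x = y + e (ub m) z" "y \<in> Fock UNIV m" "z \<in> Fock UNIV m" by auto
    have fx: "f (us m) x = sf 2 z"
      using x Suc.prems(2) Fock_f_high[of y UNIV m m] Fock_f_high[of z UNIV m m]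
      by (simp add: f_simps f_e e_simps dual)
    have "z Zs = 0" if "set Zs \<subseteq> us ` {..<n}" for Zs
    proof -
      have "sf 2 z Zs = s 2 (x (us m # Zs))" by (simp add: fx[symmetric] cl_ubar_def)
      also have "\<dots> = 0" using Suc.prems(2,3) that by simp
      finally show ?thesis by (simp add: scale_fun_def)
    qed
    then have "z = 0" using Suc.IH[OF x(3)] Suc.prems(2) by auto
    then have "x = y" using x by (simp add: e_simps)
    then show ?case using Suc.IH[OF x(2)] Suc.prems by auto
  qed
  then show ?thesis using assms VS_Fock by blast
qed

text \<open>Induction on the length of the list: reading \<open>T x\<close> at a list with head
  \<open>us i\<close> means contracting, and the third hypothesis moves the contraction inside T.
  The scalar c is 1 for operators that commute with contractions and -1 for those that
  anticommute.\<close>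

lemma operator_zeroI:
  assumes T: "\<And>x. x \<in> VS \<Longrightarrow> T x \<in> VS" "\<And>x. x \<in> VS \<Longrightarrow> T x [] = 0"
    "\<And>x i. x \<in> VS \<Longrightarrow> i < n \<Longrightarrow> f (us i) (T x) = sf c (T (f (us i) x))"
    and x: "x \<in> VS"
  shows "T x = 0"
proof (rule VS_eqI[OF T(1)[OF x]])
  fix Zs assume "set Zs \<subseteq> us ` {..<n}"
  then show "T x Zs = 0" using x
  proof (induction Zs arbitrary: x)
    case (Cons Z Zs)
    then obtain i where i: "i < n" "Z = us i" by auto
    have "s 2 (T x (Z # Zs)) = f Z (T x) Zs" by (simp add: cl_ubar_def)
    also have "\<dots> = s c (T (f Z x) Zs)" using T(3)[of x i] Cons.prems i by (simp add: scale_fun_def)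
    also have "T (f Z x) Zs = 0" using Cons VS_f by auto
    finally show ?case by (simp add: fun_app)
  qed (use T(2) in simp)
qed

end

section \<open>Cartan calculus\<close>

locale spin_lie = spin_space s B n ub us
  for s :: "complex \<Rightarrow> 'v::ab_group_add \<Rightarrow> 'v"
    and B :: "complex^'n \<Rightarrow> complex^'n \<Rightarrow> complex" and n :: nat and ub us :: "nat \<Rightarrow> complex^'n" +
  fixes br :: "complex^'n \<Rightarrow> complex^'n \<Rightarrow> complex^'n"
  assumes br_add: "br (X + Y) Z = br X Z + br Y Z" "br Z (X + Y) = br Z X + br Z Y"
    and br_scale: "br (c *s X) Z = c *s br X Z" "br Z (c *s X) = c *s br Z X"
    and br_antisym: "br X Y = - br Y X"
    and br_jacobi: "br X (br Y Z) = br (br X Y) Z + br Y (br X Z)"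
    and B_sym: "B X Y = B Y X"
    and B_inv: "B (br X Y) Z = B X (br Y Z)"
    and Ub_br: "\<lbrakk>X \<in> Ub; Y \<in> Ub\<rbrakk> \<Longrightarrow> br X Y \<in> Ub"
    and trace_Ub: "X \<in> Ub \<Longrightarrow> (\<Sum>j<n. B (br X (us j)) (ub j)) = 0"
begin

text \<open>No bracket relation is imposed, so that \<rho> composed with the projection onto k,
  which is in general not a representation, is covered.\<close>

definition linrep :: "(complex^'n \<Rightarrow> 'v \<Rightarrow> 'v) \<Rightarrow> bool" where
  "linrep R \<longleftrightarrow> (\<forall>v. Vector_Spaces.linear (*s) s (\<lambda>Z. R Z v)) \<and> (\<forall>Z. linV (R Z))"

lemma linrepD: "linrep R \<Longrightarrow> linV (R Z)" by (simp add: linrep_def)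

lemma linrep_lin:
  assumes "linrep R"
  shows "(R (X + Y) \<circ> x) = (R X \<circ> x) + (R Y \<circ> x)" "(R (c *s X) \<circ> x) = sf c (R X \<circ> x)"
    "(R (\<Sum>i\<in>I. W i) \<circ> x) = (\<Sum>i\<in>I. R (W i) \<circ> x)" "(R (X - Y) \<circ> x) = (R X \<circ> x) - (R Y \<circ> x)"
    "(R (- X) \<circ> x) = - (R X \<circ> x)" "(R 0 \<circ> x) = 0"
proof -
  have l: "Vector_Spaces.linear (*s) s (\<lambda>Z. R Z v)" for v using assms by (simp add: linrep_def)
  interpret Vector_Spaces.linear "(*s)" s "\<lambda>Z. R Z v" for v by (rule l)
  show "(R (X + Y) \<circ> x) = (R X \<circ> x) + (R Y \<circ> x)" "(R (c *s X) \<circ> x) = sf c (R X \<circ> x)"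
    "(R (\<Sum>i\<in>I. W i) \<circ> x) = (\<Sum>i\<in>I. R (W i) \<circ> x)" "(R (X - Y) \<circ> x) = (R X \<circ> x) - (R Y \<circ> x)"
    "(R (- X) \<circ> x) = - (R X \<circ> x)" "(R 0 \<circ> x) = 0"
    by (simp_all add: fun_eq_iff fun_app add scale_fun_def scale sum sum_fun_apply diff neg)
qed

lemma br_zero [simp]: "br 0 Z = 0" "br Z 0 = 0"
  using br_scale(1)[of 0 0 Z] br_scale(2)[of Z 0 0] by simp_all

lemma br_sum: "br (\<Sum>i\<in>I. X i) Z = (\<Sum>i\<in>I. br (X i) Z)" "br Z (\<Sum>i\<in>I. X i) = (\<Sum>i\<in>I. br Z (X i))"
  by (induction I rule: infinite_finite_induct) (simp_all add: br_add)

lemma f_br_expand: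
  assumes "X \<in> Ub" "y \<in> VS"
  shows "(\<Sum>j<n. sf (B X (ub j)) (f (br Z (us j)) y)) = f (br Z X) y"
    "(\<Sum>j<n. sf (B X (ub j)) (f (br (us j) Z) y)) = f (br X Z) y"
proof -
  have "f (br Z (\<Sum>j<n. B X (ub j) *s us j)) y = (\<Sum>j<n. sf (B X (ub j)) (f (br Z (us j)) y))"
    "f (br (\<Sum>j<n. B X (ub j) *s us j) Z) y = (\<Sum>j<n. sf (B X (ub j)) (f (br (us j) Z) y))"
    using assms(2) by (simp_all add: br_sum br_scale f_lin f_lin_simps)
  then show "(\<Sum>j<n. sf (B X (ub j)) (f (br Z (us j)) y)) = f (br Z X) y"
    "(\<Sum>j<n. sf (B X (ub j)) (f (br (us j) Z) y)) = f (br X Z) y"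
    by (simp_all add: expand_Ub assms(1))
qed

definition lin where "lin R x = (\<Sum>i<n. e (ub i) (R (us i) \<circ> x))"
definition cub where "cub x = (\<Sum>i<n. \<Sum>j<n. f (br (us i) (us j)) (e (ub i) (e (ub j) x)))"
definition CC where "CC R x = lin R x - sf (1/4) (cub x)"
text \<open>The Lie derivative on the factor S: identify u with the dual of conj u by B; then
  \<open>EE X\<close> is the derivation of the exterior algebra induced by ad X on conj u, as
  \<open>EE_f\<close> records. The 1/2 compensates the 2 in the Clifford action. Having the creation
  operator on the right includes a trace of ad X, which \<open>trace_Ub\<close> makes zero for X in
  \<open>Ub\<close>.\<close>

definition EE where "EE X x = sf (1/2) (\<Sum>j<n. f (br X (us j)) (e (ub j) x))"

lemma lin_linear: "linrep R \<Longrightarrow> Vector_Spaces.linear sf sf (lin R)"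
  by unfold_locales (simp_all add: lin_def comp_simps linrepD e_simps sum.distrib F.scale_sum_right)

lemma cub_linear: "Vector_Spaces.linear sf sf cub"
  by unfold_locales (simp_all add: cub_def e_simps f_simps sum.distrib F.scale_sum_right)

lemma CC_linear: "linrep R \<Longrightarrow> Vector_Spaces.linear sf sf (CC R)"
  by unfold_locales (simp_all add: CC_def linear_sf[OF lin_linear] linear_sf[OF cub_linear] algebra_simps
    F.scale_right_distrib F.scale_right_diff_distrib)

lemma EE_linear: "Vector_Spaces.linear sf sf (EE X)"
  by unfold_locales (simp_all add: EE_def e_simps f_simps sum.distrib F.scale_sum_right F.scale_right_distrib mult.commute)

lemmas CC_simps = linear_sf[OF CC_linear]
lemmas EE_simps = linear_sf[OF EE_linear]

lemma VS_CC: "linrep R \<Longrightarrow> x \<in> VS \<Longrightarrow> CC R x \<in> VS"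
  unfolding CC_def lin_def cub_def
  by (intro VS_closed VS_e VS_f VS_comp linrepD ub_in) auto

lemma VS_EE: "x \<in> VS \<Longrightarrow> EE X x \<in> VS"
  unfolding EE_def by (intro VS_closed VS_e VS_f ub_in) auto

lemma lin_f:
  assumes R: "linrep R" and X: "X \<in> Ub"
  shows "f X (lin R x) = sf 2 (R X \<circ> x) - lin R (f X x)"
proof -
  have "f X (lin R x) = (\<Sum>i<n. sf (2 * B X (ub i)) (R (us i) \<circ> x)) - lin R (f X x)"
    by (simp add: lin_def f_simps f_e comp_f linrepD[OF R] sum_subtractf)
  also have "(\<Sum>i<n. sf (2 * B X (ub i)) (R (us i) \<circ> x)) = sf 2 (R (\<Sum>i<n. B X (ub i) *s us i) \<circ> x)"
    by (simp add: linrep_lin[OF R] F.scale_sum_right)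
  finally show ?thesis by (simp add: expand_Ub X)
qed

lemma f_fee:
  assumes "x \<in> VS" "Y \<in> U" "Y' \<in> U"
  shows "f X (f W (e Y (e Y' x))) =
    sf 2 (sf (B X Y') (f W (e Y x))) - sf 2 (sf (B X Y) (f W (e Y' x))) - f W (e Y (e Y' (f X x)))"
proof -
  have "f X (f W (e Y (e Y' x))) = - f W (f X (e Y (e Y' x)))"
    using f_anticomm[of "e Y (e Y' x)" X W] assms by (simp add: VS_e eq_neg_iff_add_eq_0)
  then show ?thesis by (simp add: f_e f_simps e_simps)
qed

text \<open>Contraction can strike either creation operator. By antisymmetry of the bracket both
  contributions are -4 \<open>EE X\<close>; the total -8 times the coefficient -1/4 gives the 2 in
  Cartan's formula.\<close>

lemma cub_f:
  assumes x: "x \<in> VS" and X: "X \<in> Ub"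
  shows "f X (cub x) = - sf 8 (EE X x) - cub (f X x)"
proof -
  have "f X (cub x) = sf 2 (\<Sum>i<n. \<Sum>j<n. sf (B X (ub j)) (f (br (us i) (us j)) (e (ub i) x)))
     - sf 2 (\<Sum>i<n. \<Sum>j<n. sf (B X (ub i)) (f (br (us i) (us j)) (e (ub j) x))) - cub (f X x)"
    by (simp add: cub_def f_simps f_fee[OF x] ub_in sum_subtractf F.scale_sum_right)
  also have "(\<Sum>i<n. \<Sum>j<n. sf (B X (ub j)) (f (br (us i) (us j)) (e (ub i) x))) = - sf 2 (EE X x)"
  proof -
    have "(\<Sum>i<n. \<Sum>j<n. sf (B X (ub j)) (f (br (us i) (us j)) (e (ub i) x))) =
      (\<Sum>i<n. - f (br X (us i)) (e (ub i) x))"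
      by (intro sum.cong refl)
        (simp add: f_br_expand[OF X] VS_e x ub_in br_antisym[of _ X] f_lin_simps)
    then show ?thesis by (simp add: EE_def sum_negf)
  qed
  also have "(\<Sum>i<n. \<Sum>j<n. sf (B X (ub i)) (f (br (us i) (us j)) (e (ub j) x))) = sf 2 (EE X x)"
  proof -
    have "(\<Sum>i<n. \<Sum>j<n. sf (B X (ub i)) (f (br (us i) (us j)) (e (ub j) x))) =
      (\<Sum>j<n. f (br X (us j)) (e (ub j) x))"
      by (subst sum.swap) (intro sum.cong refl, simp add: f_br_expand[OF X] VS_e x ub_in)
    then show ?thesis by (simp add: EE_def)
  qed
  also have "sf 2 (- sf 2 (EE X x)) - sf 2 (sf 2 (EE X x)) = - sf 8 (EE X x)"
    using F.scale_left_distrib[of 4 4 "EE X x"] by simp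
  finally show ?thesis .
qed

text \<open>Cartan's formula: contraction by X and the differential anticommute to the Lie
  derivative, here doubled because \<open>f X\<close> is twice the contraction. It uses only
  linearity of R and so applies to \<open>\<rho>K\<close> as well.\<close>

lemma CC_f:
  assumes R: "linrep R" and x: "x \<in> VS" and X: "X \<in> Ub"
  shows "f X (CC R x) = sf 2 (R X \<circ> x) + sf 2 (EE X x) - CC R (f X x)"
  by (simp add: CC_def f_simps lin_f[OF R X] cub_f[OF x X] F.scale_right_diff_distrib)

lemma EE_f:
  assumes x: "x \<in> VS" and Y: "Y \<in> Ub"
  shows "f Y (EE X x) = EE X (f Y x) - f (br X Y) x"
proof -
  have "f Y (f (br X (us j)) (e (ub j) x)) =
     f (br X (us j)) (e (ub j) (f Y x)) - sf 2 (sf (B Y (ub j)) (f (br X (us j)) x))" if "j < n" for j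
  proof -
    have "f Y (f (br X (us j)) (e (ub j) x)) = - f (br X (us j)) (f Y (e (ub j) x))"
      using f_anticomm[of "e (ub j) x"] x that by (simp add: VS_e ub_in eq_neg_iff_add_eq_0)
    then show ?thesis by (simp add: f_e f_simps)
  qed
  then have "f Y (EE X x) = EE X (f Y x) - (\<Sum>j<n. sf (B Y (ub j)) (f (br X (us j)) x))"
    by (simp add: EE_def f_simps sum_subtractf F.scale_right_diff_distrib F.scale_sum_right)
  then show ?thesis by (simp add: f_br_expand[OF Y x])
qed

lemma f_Nil: "f W x [] = s 2 (x [W])" by (simp add: cl_ubar_def)
lemma e_single: "e Y x [W] = s (B W Y) (x [])" by (simp add: cl_u_def remove_at_def)
lemma sf_Nil: "sf c x Zs = s c (x Zs)" by (simp add: scale_fun_def)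

text \<open>In degree 0 the operator multiplies by the trace of ad X on conj u.\<close>

lemma EE_Nil: "X \<in> Ub \<Longrightarrow> EE X x [] = 0"
  using trace_Ub[of X]
  by (simp add: EE_def sf_Nil sum_fun_apply f_Nil e_single flip: scale_sum_left scale_sum_right sum_distrib_left)

lemma CC_Nil: "CC R x [] = 0"
  by (simp add: CC_def lin_def cub_def sf_Nil sum_fun_apply f_Nil e_single fun_app)

text \<open>Contraction by Z reduces the claim to the Jacobi identity for X, Y, Z; in degree 0 every
  term vanishes as a trace.\<close>

lemma EE_commutator:
  assumes X: "X \<in> Ub" and Y: "Y \<in> Ub" and x: "x \<in> VS"
  shows "EE X (EE Y x) - EE Y (EE X x) = EE (br X Y) x"
proof -
  define T where "T x = EE X (EE Y x) - EE Y (EE X x) - EE (br X Y) x" for x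
  have "T x = 0"
  proof (rule operator_zeroI[where T=T and c=1, OF _ _ _ x])
    fix x assume x: "x \<in> VS"
    show "T x \<in> VS" unfolding T_def by (intro VS_closed VS_EE x)
    show "T x [] = 0" by (simp add: T_def fun_app EE_Nil X Y Ub_br)
    fix i assume i: "i < n"
    let ?Z = "us i"
    have Z: "?Z \<in> Ub" using i by (rule us_in)
    have "f (br (br X Y) ?Z) x = f (br X (br Y ?Z)) x - f (br Y (br X ?Z)) x"
      using br_jacobi[of X Y ?Z] f_lin_simps(1)[OF x, of "br X (br Y ?Z)" "br Y (br X ?Z)"]
      by simp
    then show "f ?Z (T x) = sf 1 (T (f ?Z x))"
      using X Y Z x by (simp add: T_def f_simps EE_f VS_EE VS_f Ub_br EE_simps)
  qed
  then show ?thesis by (simp add: T_def)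
qed

lemma comp_EE: "linV R \<Longrightarrow> (R \<circ> EE X x) = EE X (R \<circ> x)"
  by (simp add: EE_def comp_simps comp_e comp_f)

text \<open>The diagonal action of X on V \<otimes> S, which is the Lie derivative in Cartan's
  formula.\<close>

definition LL where "LL R X x = (R X \<circ> x) + EE X x"

lemma LL_linear: "linrep R \<Longrightarrow> Vector_Spaces.linear sf sf (LL R X)"
  by unfold_locales (simp_all add: LL_def comp_simps linrepD EE_simps F.scale_right_distrib)

lemmas LL_simps = linear_sf[OF LL_linear]

lemma VS_LL: "linrep R \<Longrightarrow> x \<in> VS \<Longrightarrow> LL R X x \<in> VS"
  unfolding LL_def by (intro VS_closed VS_comp VS_EE linrepD)

lemma LL_f:
  assumes R: "linrep R" and x: "x \<in> VS" and Y: "Y \<in> Ub"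
  shows "f Y (LL R X x) = LL R X (f Y x) - f (br X Y) x"
  by (simp add: LL_def f_simps EE_f[OF x Y] comp_f linrepD[OF R])

lemma CC_f':
  "linrep R \<Longrightarrow> x \<in> VS \<Longrightarrow> X \<in> Ub \<Longrightarrow> f X (CC R x) = sf 2 (LL R X x) - CC R (f X x)"
  by (simp add: CC_f LL_def F.scale_right_distrib)

definition is_rep where
  "is_rep R \<longleftrightarrow> linrep R \<and> (\<forall>Z W v. R (br Z W) v = R Z (R W v) - R W (R Z v))"

lemma LL_commutator:
  assumes R: "is_rep R" and X: "X \<in> Ub" and Y: "Y \<in> Ub" and x: "x \<in> VS"
  shows "LL R X (LL R Y x) - LL R Y (LL R X x) = LL R (br X Y) x"
proof -
  have l: "linrep R" using R by (simp add: is_rep_def)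
  have "(R (br X Y) \<circ> x) = (R X \<circ> (R Y \<circ> x)) - (R Y \<circ> (R X \<circ> x))"
    using R by (simp add: is_rep_def fun_eq_iff fun_app)
  then show ?thesis
    by (simp add: LL_def comp_simps linrepD[OF l] EE_simps comp_EE EE_commutator[OF X Y x, symmetric])
qed

text \<open>The commutator T anticommutes with contraction by Z: the obstructing terms are twice the
  commutator of \<open>LL R X\<close> with \<open>LL R Z\<close> and, from Cartan's formula for
  [X, Z], twice the Lie derivative along [X, Z]; they cancel.\<close>

lemma CC_LL:
  assumes R: "is_rep R" and X: "X \<in> Ub" and x: "x \<in> VS"
  shows "LL R X (CC R x) = CC R (LL R X x)"
proof -
  have l: "linrep R" using R by (simp add: is_rep_def)
  define T where "T x = LL R X (CC R x) - CC R (LL R X x)" for x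
  have "T x = 0"
  proof (rule operator_zeroI[where T=T and c="-1", OF _ _ _ x])
    fix x assume x: "x \<in> VS"
    show "T x \<in> VS" unfolding T_def by (intro VS_closed VS_LL VS_CC l x)
    interpret RX: Vector_Spaces.linear s s "R X" using linrepD[OF l] .
    show "T x [] = 0" by (simp add: T_def fun_app CC_Nil LL_def EE_Nil X RX.zero)
    fix i assume i: "i < n"
    let ?Z = "us i"
    have Z: "?Z \<in> Ub" using i by (rule us_in)
    have "f ?Z (T x) = sf 2 (LL R X (LL R ?Z x) - LL R ?Z (LL R X x)) - LL R X (CC R (f ?Z x))
        - (f (br X ?Z) (CC R x) + CC R (f (br X ?Z) x)) + CC R (LL R X (f ?Z x))"
      using x X Z l by (simp add: T_def f_simps LL_f CC_f' VS_LL VS_CC VS_f LL_simps CC_simps F.scale_right_diff_distrib)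
    also have "LL R X (LL R ?Z x) - LL R ?Z (LL R X x) = LL R (br X ?Z) x"
      by (rule LL_commutator[OF R X Z x])
    also have "f (br X ?Z) (CC R x) + CC R (f (br X ?Z) x) = sf 2 (LL R (br X ?Z) x)"
      using CC_f'[OF l x Ub_br[OF X Z]] by simp
    finally show "f ?Z (T x) = sf (- 1) (T (f ?Z x))" by (simp add: T_def)
  qed
  then show ?thesis by (simp add: T_def)
qed

text \<open>By Cartan's formula the contraction of C^2 x differs from C^2 of the contracted x by
  twice a commutator of \<open>LL\<close> with C, which is zero by \<open>CC_LL\<close>; and values
  of C have no component in degree 0.\<close>

lemma CC_square:
  assumes R: "is_rep R" and x: "x \<in> VS"
  shows "CC R (CC R x) = 0"
proof -
  have l: "linrep R" using R by (simp add: is_rep_def)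
  show ?thesis
  proof (rule operator_zeroI[where T="\<lambda>x. CC R (CC R x)" and c=1, OF _ _ _ x])
    fix x assume x: "x \<in> VS"
    show "CC R (CC R x) \<in> VS" by (intro VS_CC l x)
    show "CC R (CC R x) [] = 0" by (simp add: CC_Nil)
    fix i assume i: "i < n"
    have Z: "us i \<in> Ub" using i by (rule us_in)
    show "f (us i) (CC R (CC R x)) = sf 1 (CC R (CC R (f (us i) x)))"
      using x Z l by (simp add: CC_f' VS_CC CC_simps CC_LL[OF R Z x])
  qed
qed

end

text \<open>The indices in \<^term>\<open>P\<close> are those of a basis of an abelian ideal; the remaining ones normalize it.\<close>
locale spin_adapted = spin_lie s B n ub us br
  for s :: "complex \<Rightarrow> 'v::ab_group_add \<Rightarrow> 'v"
    and B :: "complex^'n \<Rightarrow> complex^'n \<Rightarrow> complex" and n :: nat and ub us :: "nat \<Rightarrow> complex^'n"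
    and br :: "complex^'n \<Rightarrow> complex^'n \<Rightarrow> complex^'n" +
  fixes P :: "nat set" and \<theta> :: "complex^'n \<Rightarrow> complex^'n" and \<rho> :: "complex^'n \<Rightarrow> 'v \<Rightarrow> 'v"
  assumes P_sub: "P \<subseteq> {..<n}"
    and theta_lin: "lin_op \<theta>"
    and theta_br: "\<theta> (br X Y) = br (\<theta> X) (\<theta> Y)"
    and theta_us: "i < n \<Longrightarrow> \<theta> (us i) = (if i \<in> P then - us i else us i)"
    and theta_ub: "i < n \<Longrightarrow> \<theta> (ub i) = (if i \<in> P then - ub i else ub i)"
    and P_abelian: "\<lbrakk>i \<in> P; j \<in> P\<rbrakk> \<Longrightarrow> br (us i) (us j) = 0"
    and KP_ub: "\<lbrakk>i < n; i \<notin> P; j \<in> P\<rbrakk> \<Longrightarrow> br (us i) (ub j) = (\<Sum>k\<in>P. B (us k) (br (us i) (ub j)) *s ub k)"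
    and KP_us: "\<lbrakk>i < n; i \<notin> P; j \<in> P\<rbrakk> \<Longrightarrow> br (us i) (us j) = (\<Sum>k\<in>P. B (br (us i) (us j)) (ub k) *s us k)"
    and rho_rep: "is_rep \<rho>"
begin

section \<open>Splitting the action along k and p\<close>

lemma rho_linrep: "linrep \<rho>" using rho_rep by (simp add: is_rep_def)
lemma rho_lin: "linV (\<rho> Z)" using linrepD[OF rho_linrep] .

definition "\<rho>\<theta> Z = \<rho> (\<theta> Z)"
text \<open>Composition with (1 + \<theta>)/2, the projection onto the fixed space of \<theta> along
  its -1 eigenspace. While \<open>\<rho>\<theta>\<close> is a representation because \<theta> is an
  automorphism, this composite is in general only linear.\<close>

definition "\<rho>K Z = \<rho> ((1/2) *s (Z + \<theta> Z))"

lemma theta_simps: "\<theta> (X + Y) = \<theta> X + \<theta> Y" "\<theta> (c *s X) = c *s \<theta> X"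
proof -
  interpret Vector_Spaces.linear "(*s)" "(*s)" \<theta> by (rule theta_lin)
  show "\<theta> (X + Y) = \<theta> X + \<theta> Y" "\<theta> (c *s X) = c *s \<theta> X" by (simp_all add: add scale)
qed

lemma linrep_comp:
  assumes "lin_op T" shows "linrep (\<lambda>Z. \<rho> (T Z))"
  unfolding linrep_def
proof (intro conjI allI rho_lin)
  fix v
  have "Vector_Spaces.linear (*s) s (\<lambda>Z. \<rho> Z v)" using rho_linrep by (simp add: linrep_def)
  from Vector_Spaces.linear_compose[OF assms this]
  show "Vector_Spaces.linear (*s) s (\<lambda>Z. \<rho> (T Z) v)" by (simp add: o_def)
qed

lemma rho_theta_rep: "is_rep \<rho>\<theta>"
  using rho_rep linrep_comp[OF theta_lin] unfolding is_rep_def \<rho>\<theta>_def[abs_def] by (simp add: theta_br)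

lemma rhoK_linrep: "linrep \<rho>K"
  unfolding \<rho>K_def[abs_def]
  by (rule linrep_comp) (rule lin_opI, simp_all add: theta_simps vec.scale_right_distrib)

lemma rho_theta_us:
  fixes x :: "(complex^'n) list \<Rightarrow> 'v"
  shows "i < n \<Longrightarrow> (\<rho>\<theta> (us i) \<circ> x) = (if i \<in> P then - (\<rho> (us i) \<circ> x) else \<rho> (us i) \<circ> x)"
  by (simp add: \<rho>\<theta>_def theta_us linrep_lin[OF rho_linrep])

lemma rhoK_us: "i < n \<Longrightarrow> \<rho>K (us i) = (if i \<in> P then (\<lambda>v. 0) else \<rho> (us i))"
proof -
  assume i: "i < n"
  have "\<rho> 0 v = 0" for v
    using fun_cong[OF linrep_lin(6)[OF rho_linrep, of "\<lambda>_. v"], of "[]"] by (simp add: fun_app)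
  then have "\<rho> 0 = (\<lambda>v. 0)" by blast
  moreover have "(1/2) *s (us i + \<theta> (us i)) = (if i \<in> P then 0 else us i)"
    using i by (simp add: theta_us vec_eq_iff)
  ultimately show "\<rho>K (us i) = (if i \<in> P then (\<lambda>v. 0) else \<rho> (us i))"
    by (simp add: \<rho>K_def)
qed

text \<open>The cubic term is kept entirely in this part, so that it has the form
  \<open>CC R\<close> and Cartan's formula applies. \<open>BB\<close> is the D of the overview;
  \<open>BM\<close> is the corresponding part of C^- and turns out to be minus the adjoint of
  \<open>BB\<close>.\<close>

definition AA where "AA x = CC \<rho>K x"
definition BB where "BB x = (\<Sum>j\<in>P. e (ub j) (\<rho> (us j) \<circ> x))"
definition BM where "BM x = (\<Sum>j\<in>P. f (us j) (\<rho> (ub j) \<circ> x))"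

lemma finite_P: "finite P" using P_sub finite_subset by blast

lemma P_less: "j \<in> P \<Longrightarrow> j < n" using P_sub by auto

lemma sum_split_P: "(\<Sum>i<n. g i) = (\<Sum>i\<in>{..<n} - P. g i) + (\<Sum>i\<in>P. g i)" for g :: "nat \<Rightarrow> 'b::comm_monoid_add"
  using sum.subset_diff[OF P_sub, of g] by simp

lemma lin_split:
  "lin \<rho> x = lin \<rho>K x + BB x" "lin \<rho>\<theta> x = lin \<rho>K x - BB x"
proof -
  have z: "(\<lambda>_ :: (complex^'n) list. 0 :: 'v) = 0" by (simp add: fun_eq_iff fun_app)
  have K: "lin \<rho>K x = (\<Sum>i\<in>{..<n} - P. e (ub i) (\<rho> (us i) \<circ> x))"
    unfolding lin_def sum_split_P using P_less by (simp add: rhoK_us z e_simps)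
  show "lin \<rho> x = lin \<rho>K x + BB x" unfolding K BB_def by (simp add: lin_def sum_split_P)
  have "lin \<rho>\<theta> x = (\<Sum>i\<in>{..<n} - P. e (ub i) (\<rho> (us i) \<circ> x)) + (\<Sum>i\<in>P. - e (ub i) (\<rho> (us i) \<circ> x))"
    unfolding lin_def sum_split_P using P_less by (simp add: rho_theta_us e_simps)
  then show "lin \<rho>\<theta> x = lin \<rho>K x - BB x" unfolding K BB_def by (simp add: sum_negf)
qed

lemma CC_split: "CC \<rho> x = AA x + BB x" "CC \<rho>\<theta> x = AA x - BB x"
  by (simp_all add: CC_def AA_def lin_split)

lemma BM_linear: "Vector_Spaces.linear sf sf BM"
  by unfold_locales (simp_all add: BM_def comp_simps rho_lin f_simps sum.distrib F.scale_sum_right)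
lemma BB_linear: "Vector_Spaces.linear sf sf BB"
  by unfold_locales (simp_all add: BB_def comp_simps rho_lin e_simps sum.distrib F.scale_sum_right)
lemma AA_linear: "Vector_Spaces.linear sf sf AA"
  unfolding AA_def[abs_def] using CC_linear[OF rhoK_linrep] by simp

lemmas BM_simps = linear_sf[OF BM_linear]
lemmas BB_simps = linear_sf[OF BB_linear]
lemmas AA_simps = linear_sf[OF AA_linear]

lemma VS_BM: "x \<in> VS \<Longrightarrow> BM x \<in> VS"
  unfolding BM_def by (intro VS_closed VS_f VS_comp rho_lin)
lemma VS_BB: "x \<in> VS \<Longrightarrow> BB x \<in> VS"
  unfolding BB_def by (intro VS_closed VS_e VS_comp rho_lin ub_in P_less)
lemma VS_AA: "x \<in> VS \<Longrightarrow> AA x \<in> VS"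
  unfolding AA_def by (intro VS_CC rhoK_linrep)

lemma BM_f: "x \<in> VS \<Longrightarrow> f X (BM x) = - BM (f X x)"
proof -
  assume x: "x \<in> VS"
  have "f X (f (us j) (\<rho> (ub j) \<circ> x)) = - f (us j) (\<rho> (ub j) \<circ> f X x)" for j
    using f_anticomm[OF VS_comp[OF x rho_lin], of X "us j" "ub j"]
    by (simp add: eq_neg_iff_add_eq_0 comp_f rho_lin)
  then show ?thesis by (simp add: BM_def f_simps sum_negf)
qed

text \<open>\<^term>\<open>BM\<close> comes from the invariant tensor in \<open>P \<otimes> P\<^sup>*\<close>.\<close>
lemma LL_BM:
  assumes i: "i < n" and x: "x \<in> VS"
  shows "LL \<rho>K (us i) (BM x) = BM (LL \<rho>K (us i) x)"
proof -
  let ?X = "us i"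
  note l = linrep_lin[OF rho_linrep]
  have X: "?X \<in> Ub" using i by (rule us_in)
  have EB: "EE ?X (BM x) = BM (EE ?X x) + (\<Sum>j\<in>P. f (br ?X (us j)) (\<rho> (ub j) \<circ> x))"
  proof -
    have "EE ?X (f (us j) (\<rho> (ub j) \<circ> x)) = f (us j) (\<rho> (ub j) \<circ> EE ?X x) + f (br ?X (us j)) (\<rho> (ub j) \<circ> x)"
      if "j \<in> P" for j
      using EE_f[OF VS_comp[OF x rho_lin] us_in[OF P_less[OF that]], of ?X "ub j"]
      by (simp add: comp_EE rho_lin)
    then show ?thesis by (simp add: BM_def EE_simps sum.distrib)
  qed
  show ?thesis
  proof (cases "i \<in> P")
    \<comment> \<open>The \<open>us j\<close> with j in P commute with each other and act by zero
      through \<open>\<rho>K\<close>, so neither S nor V contributes a defect.\<close>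
    case True
    have "(\<Sum>j\<in>P. f (br ?X (us j)) (\<rho> (ub j) \<circ> x)) = 0"
      using True by (simp add: P_abelian f_lin_simps VS_comp[OF x rho_lin])
    moreover have "(\<rho>K ?X \<circ> y) = 0" for y :: "(complex^'n) list \<Rightarrow> 'v" using True i by (simp add: rhoK_us fun_eq_iff fun_app)
    ultimately show ?thesis using EB by (simp add: LL_def)
  next
    case False
    have KX: "\<rho>K ?X = \<rho> ?X" using False i by (simp add: rhoK_us)
    have RB: "(\<rho> ?X \<circ> BM x) = BM (\<rho> ?X \<circ> x) + (\<Sum>j\<in>P. f (us j) (\<rho> (br ?X (ub j)) \<circ> x))"
    proof -
      have "(\<rho> ?X \<circ> (\<rho> (ub j) \<circ> x)) = (\<rho> (ub j) \<circ> (\<rho> ?X \<circ> x)) + (\<rho> (br ?X (ub j)) \<circ> x)" for j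
        using rho_rep by (simp add: is_rep_def fun_eq_iff fun_app)
      then show ?thesis by (simp add: BM_def comp_simps comp_f rho_lin f_simps sum.distrib)
    qed
    \<comment> \<open>The defect from S cancels the one in \<open>RB\<close>: by invariance of B the
      matrix of ad X on the \<open>us j\<close> is minus the transpose of its matrix on the
      \<open>ub j\<close>.\<close>
    have "(\<Sum>j\<in>P. f (br ?X (us j)) (\<rho> (ub j) \<circ> x)) =
        (\<Sum>j\<in>P. \<Sum>k\<in>P. sf (B (br ?X (us j)) (ub k)) (f (us k) (\<rho> (ub j) \<circ> x)))"
      by (intro sum.cong refl, subst KP_us[OF i False])
        (simp_all add: f_lin_simps f_lin VS_comp[OF x rho_lin])
    also have "\<dots> = (\<Sum>k\<in>P. \<Sum>j\<in>P. sf (B (br ?X (us j)) (ub k)) (f (us k) (\<rho> (ub j) \<circ> x)))"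
      by (rule sum.swap)
    also have "\<dots> = (\<Sum>k\<in>P. - f (us k) (\<rho> (br ?X (ub k)) \<circ> x))"
    proof (intro sum.cong refl)
      fix k assume k: "k \<in> P"
      have inv: "B (br ?X (us j)) (ub k) = - B (us j) (br ?X (ub k))" for j
      proof -
        have "br ?X (us j) = (-1) *s br (us j) ?X" using br_antisym[of ?X "us j"] by simp
        then show ?thesis using B_inv[of "us j" ?X "ub k"] B_scale(1)[of "-1" "br (us j) ?X" "ub k"] by simp
      qed
      have "f (us k) (\<rho> (br ?X (ub k)) \<circ> x) = (\<Sum>j\<in>P. sf (B (us j) (br ?X (ub k))) (f (us k) (\<rho> (ub j) \<circ> x)))"
        by (subst KP_ub[OF i False k]) (simp add: l f_simps)
      then show "(\<Sum>j\<in>P. sf (B (br ?X (us j)) (ub k)) (f (us k) (\<rho> (ub j) \<circ> x))) = - f (us k) (\<rho> (br ?X (ub k)) \<circ> x)"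
        by (simp add: inv sum_negf)
    qed
    finally show ?thesis using EB RB by (simp add: LL_def KX BM_simps sum_negf)
  qed
qed

text \<open>Contraction anticommutes with \<open>BM\<close> and turns \<open>AA\<close> into twice
  \<open>LL \<rho>K\<close>. In the contracted anticommutator these Lie derivatives enter through
  their commutator with \<open>BM\<close>, which is zero by \<open>LL_BM\<close>; so the
  anticommutator commutes with contractions.\<close>

lemma AA_BM:
  assumes x: "x \<in> VS"
  shows "AA (BM x) + BM (AA x) = 0"
proof (rule operator_zeroI[where T="\<lambda>x. AA (BM x) + BM (AA x)" and c=1, OF _ _ _ x])
  fix x assume x: "x \<in> VS"
  have Af: "f X (AA x) = sf 2 (LL \<rho>K X x) - AA (f X x)" if "x \<in> VS" "X \<in> Ub" for x X
    unfolding AA_def by (rule CC_f'[OF rhoK_linrep that])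
  show "AA (BM x) + BM (AA x) \<in> VS" by (intro VS_closed VS_AA VS_BM x)
  \<comment> \<open>In exterior degree 0 only the values of \<open>AA x\<close> at
    \<open>[us j]\<close> with j in P matter; there Cartan's formula leaves
    \<open>\<rho>K (us j)\<close>, which is zero.\<close>
  have "\<rho> (ub j) (AA x [us j]) = 0" if j: "j \<in> P" for j
  proof -
    interpret r: Vector_Spaces.linear s s "\<rho> (ub j)" by (rule rho_lin)
    have "s 2 (AA x [us j]) = f (us j) (AA x) []" by (simp add: f_Nil)
    also have "\<dots> = 0"
      using Af[OF x us_in[OF P_less[OF j]]] j P_less[OF j]
      by (simp add: fun_app sf_Nil LL_def EE_Nil us_in rhoK_us) (simp add: AA_def CC_Nil)
    finally show ?thesis by (simp add: r.zero)
  qed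
  then show "(AA (BM x) + BM (AA x)) [] = 0"
    by (simp add: fun_app BM_def sum_fun_apply f_Nil) (simp add: AA_def CC_Nil)
  fix i assume i: "i < n"
  show "f (us i) (AA (BM x) + BM (AA x)) = sf 1 (AA (BM (f (us i) x)) + BM (AA (f (us i) x)))"
    using Af[OF x us_in[OF i]] Af[OF VS_BM[OF x] us_in[OF i]] BM_f[OF x, of "us i"] BM_f[OF VS_AA[OF x], of "us i"]
    by (simp add: f_simps LL_BM[OF i x] BM_simps AA_simps)
qed

end

section \<open>Hodge decomposition\<close>

lemma listset_2: "listset [A, B] = (\<lambda>(a, b). [a, b]) ` (A \<times> B)"
  by (auto simp: set_Cons_def)

lemma listset_3: "listset [A, B, C] = (\<lambda>(a, b, c). [a, b, c]) ` (A \<times> B \<times> C)"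
  by (auto simp: set_Cons_def image_iff)

lemma direct_sum_2I:
  assumes sub: "\<And>a b. a \<in> A \<Longrightarrow> b \<in> B \<Longrightarrow> a + b \<in> W"
    and ex: "\<And>w. w \<in> W \<Longrightarrow> \<exists>a\<in>A. \<exists>b\<in>B. w = a + b"
    and inj: "\<And>a b a' b'. \<lbrakk>a \<in> A; b \<in> B; a' \<in> A; b' \<in> B; a + b = a' + b'\<rbrakk> \<Longrightarrow> a = a' \<and> b = b'"
  shows "direct_sum W [A, B]"
  unfolding direct_sum_def bij_betw_def listset_2
proof (intro conjI)
  show "inj_on sum_list ((\<lambda>(a, b). [a, b]) ` (A \<times> B))"
  proof (rule inj_onI)
    fix x y assume "x \<in> (\<lambda>(a, b). [a, b]) ` (A \<times> B)" "y \<in> (\<lambda>(a, b). [a, b]) ` (A \<times> B)"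
      and eq: "sum_list x = sum_list y"
    then obtain a b a' b' where x: "a \<in> A" "b \<in> B" "x = [a, b]" and y: "a' \<in> A" "b' \<in> B" "y = [a', b']" by auto
    have "a + b = a' + b'" using eq x(3) y(3) by simp
    then show "x = y" using inj[OF x(1,2) y(1,2)] x y by simp
  qed
  show "sum_list ` (\<lambda>(a, b). [a, b]) ` (A \<times> B) = W"
  proof (intro equalityI subsetI)
    fix w assume "w \<in> sum_list ` (\<lambda>(a, b). [a, b]) ` (A \<times> B)"
    then obtain a b where "a \<in> A" "b \<in> B" "w = a + b" by auto
    then show "w \<in> W" using sub by simp
  next
    fix w assume "w \<in> W"
    then obtain a b where "a \<in> A" "b \<in> B" "w = a + b" using ex by blast
    then have "w = sum_list [a, b]" "[a, b] \<in> (\<lambda>(a, b). [a, b]) ` (A \<times> B)" by (simp_all add: image_iff)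
    then show "w \<in> sum_list ` (\<lambda>(a, b). [a, b]) ` (A \<times> B)" by (rule image_eqI)
  qed
qed

lemma direct_sum_3I:
  assumes sub: "\<And>a b c. a \<in> A \<Longrightarrow> b \<in> B \<Longrightarrow> c \<in> C \<Longrightarrow> a + b + c \<in> W"
    and ex: "\<And>w. w \<in> W \<Longrightarrow> \<exists>a\<in>A. \<exists>b\<in>B. \<exists>c\<in>C. w = a + b + c"
    and inj: "\<And>a b c a' b' c'. \<lbrakk>a \<in> A; b \<in> B; c \<in> C; a' \<in> A; b' \<in> B; c' \<in> C; a + b + c = a' + b' + c'\<rbrakk> \<Longrightarrow>
      a = a' \<and> b = b' \<and> c = c'"
  shows "direct_sum W [A, B, C]"
  unfolding direct_sum_def bij_betw_def listset_3
proof (intro conjI)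
  show "inj_on sum_list ((\<lambda>(a, b, c). [a, b, c]) ` (A \<times> B \<times> C))"
  proof (rule inj_onI)
    fix x y assume "x \<in> (\<lambda>(a, b, c). [a, b, c]) ` (A \<times> B \<times> C)" "y \<in> (\<lambda>(a, b, c). [a, b, c]) ` (A \<times> B \<times> C)"
      and eq: "sum_list x = sum_list y"
    then obtain a b c a' b' c' where x: "a \<in> A" "b \<in> B" "c \<in> C" "x = [a, b, c]"
      and y: "a' \<in> A" "b' \<in> B" "c' \<in> C" "y = [a', b', c']" by auto
    have "a + b + c = a' + b' + c'" using eq x(4) y(4) by (simp add: add.assoc)
    then show "x = y" using inj[OF x(1-3) y(1-3)] x y by simp
  qed
  show "sum_list ` (\<lambda>(a, b, c). [a, b, c]) ` (A \<times> B \<times> C) = W"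
  proof (intro equalityI subsetI)
    fix w assume "w \<in> sum_list ` (\<lambda>(a, b, c). [a, b, c]) ` (A \<times> B \<times> C)"
    then obtain a b c where "a \<in> A" "b \<in> B" "c \<in> C" "w = a + b + c" by (auto simp: add.assoc)
    then show "w \<in> W" using sub by simp
  next
    fix w assume "w \<in> W"
    then obtain a b c where "a \<in> A" "b \<in> B" "c \<in> C" "w = a + b + c" using ex by blast
    then have "w = sum_list [a, b, c]" "[a, b, c] \<in> (\<lambda>(a, b, c). [a, b, c]) ` (A \<times> B \<times> C)"
      by (simp_all add: image_iff add.assoc)
    then show "w \<in> sum_list ` (\<lambda>(a, b, c). [a, b, c]) ` (A \<times> B \<times> C)" by (rule image_eqI)
  qed
qed

lemma direct_sum_2D:
  assumes "direct_sum W [A, B]"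
  shows "w \<in> W \<Longrightarrow> \<exists>a\<in>A. \<exists>b\<in>B. w = a + b" "a \<in> A \<Longrightarrow> b \<in> B \<Longrightarrow> a + b \<in> W"
proof -
  have W: "W = sum_list ` (\<lambda>(a, b). [a, b]) ` (A \<times> B)"
    using assms unfolding direct_sum_def bij_betw_def listset_2 by simp
  show "w \<in> W \<Longrightarrow> \<exists>a\<in>A. \<exists>b\<in>B. w = a + b" unfolding W by (clarsimp, blast)
  show "a + b \<in> W" if "a \<in> A" "b \<in> B"
  proof -
    have "a + b = sum_list [a, b]" "[a, b] \<in> (\<lambda>(a, b). [a, b]) ` (A \<times> B)" using that by (simp_all add: image_iff)
    then show ?thesis unfolding W by (rule image_eqI)
  qed
qed

lemma direct_sum_3_unique:
  assumes "direct_sum W [A, B, C]"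
    and "a \<in> A" "b \<in> B" "c \<in> C" "a' \<in> A" "b' \<in> B" "c' \<in> C" "a + b + c = a' + b' + c'"
  shows "a = a' \<and> b = b' \<and> c = c'"
proof -
  have inj: "inj_on sum_list (listset [A, B, C])" using assms(1) by (simp add: direct_sum_def bij_betw_def)
  have "[a, b, c] \<in> listset [A, B, C]" "[a', b', c'] \<in> listset [A, B, C]"
    using assms by (auto simp: set_Cons_def)
  note in_list = this
  have "sum_list [a, b, c] = sum_list [a', b', c']" using assms(8) by (simp add: add.assoc)
  from inj_onD[OF inj this in_list] show ?thesis by simp
qed

section \<open>Hodge theory for a locally finite self-adjoint operator\<close>

context hermitian_space
begin

lemma h_ext:
  assumes "x \<in> W" "\<And>y. y \<in> W \<Longrightarrow> h x y = 0" shows "x = 0"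
  using assms h_self_zero by blast

lemma adjoint_sym:
  assumes "\<And>x y. x \<in> W \<Longrightarrow> y \<in> W \<Longrightarrow> h (D x) y = h x (D' y)" "\<And>x. x \<in> W \<Longrightarrow> D x \<in> W" "\<And>x. x \<in> W \<Longrightarrow> D' x \<in> W"
    "x \<in> W" "y \<in> W"
  shows "h (D' x) y = h x (D y)"
  using assms h_sym by metis

text \<open>\<open>adjoint_on\<close> is a choice, and positivity makes any two adjoints agree on W;
  an explicit adjoint therefore identifies the chosen one.\<close>

lemma adjoint_on_eq:
  assumes D: "\<And>x. x \<in> W \<Longrightarrow> D x \<in> W" "\<And>x. x \<in> W \<Longrightarrow> D' x \<in> W"
    and adj: "\<And>x y. x \<in> W \<Longrightarrow> y \<in> W \<Longrightarrow> h (D x) y = h x (D' y)"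
    and y: "y \<in> W"
  shows "adjoint_on W h D y = D' y"
proof -
  let ?Q = "\<lambda>f'. f' \<in> W \<rightarrow> W \<and> (\<forall>x\<in>W. \<forall>y\<in>W. h (D x) y = h x (f' y))"
  have "?Q D'" using D adj by auto
  then have Q: "?Q (adjoint_on W h D)" unfolding adjoint_on_def by (rule someI[where P="?Q"])
  let ?d = "adjoint_on W h D y - D' y"
  have W: "adjoint_on W h D y \<in> W" "D' y \<in> W" using Q D y by auto
  have "h x ?d = 0" if "x \<in> W" for x
    using Q adj[OF that y] that y W by (auto simp: h_right)
  then have "?d = 0" using h_self_zero W W_closed(4) by blast
  then show ?thesis by simp
qed

text \<open>Project x onto the finite-dimensional space L E. The remainder z is orthogonal to L E,
  and L z lies in E, so the squared norm of L z equals h z (L (L z)) = 0.\<close>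

lemma selfadjoint_splitting:
  assumes L: "\<And>x. x \<in> W \<Longrightarrow> L x \<in> W" "\<And>x y. x \<in> W \<Longrightarrow> y \<in> W \<Longrightarrow> L (x + y) = L x + L y"
      "\<And>c x. x \<in> W \<Longrightarrow> L (s c x) = s c (L x)"
    and self: "\<And>x y. x \<in> W \<Longrightarrow> y \<in> W \<Longrightarrow> h (L x) y = h x (L y)"
    and E: "subspace E" "E \<subseteq> W" "finite S" "E \<subseteq> span S" "L ` E \<subseteq> E" and x: "x \<in> E"
  obtains y z where "y \<in> E" "z \<in> E" "x = z + L y" "L z = 0"
proof -
  have LE_sub: "subspace (L ` E)"
    unfolding subspace_def
  proof (intro conjI ballI allI)
    have "L 0 = 0" using L(3)[of 0 0] W_closed(1) by simp
    then show "0 \<in> L ` E" using subspace_0[OF E(1)] by force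
    fix a b assume "a \<in> L ` E" "b \<in> L ` E"
    then obtain a' b' where "a' \<in> E" "b' \<in> E" "a = L a'" "b = L b'" by auto
    then show "a + b \<in> L ` E"
      using L(2)[of a' b'] E(2) subspace_add[OF E(1), of a' b'] by (metis image_eqI subsetD)
  next
    fix c a assume "a \<in> L ` E"
    then obtain a' where "a' \<in> E" "a = L a'" by auto
    then show "s c a \<in> L ` E"
      using L(3)[of a' c] E(2) subspace_scale[OF E(1), of a' c] by (metis image_eqI subsetD)
  qed
  obtain T where T: "T \<subseteq> L ` E" "independent T" "L ` E \<subseteq> span T"
    by (rule maximal_independent_subset)
  have "T \<subseteq> span S" using T(1) E(4,5) by blast
  then have fT: "finite T" using independent_span_bound[OF E(3) T(2)] by simp
  have span_T: "span T = L ` E"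
    using T(1,3) LE_sub span_minimal by blast
  have TW: "T \<subseteq> W" using T(1) E(2,5) by blast
  obtain p where p: "p \<in> span T" "\<And>w. w \<in> span T \<Longrightarrow> h (x - p) w = 0"
    using projection_onto_span[OF fT TW, of x] x E(2) by blast
  obtain y where y: "y \<in> E" "p = L y" using p(1) span_T by auto
  have pE: "p \<in> E" using y E(5) by auto
  have zE: "x - p \<in> E" using x pE E(1) subspace_diff by blast
  have "L (x - p) \<in> E" using zE E(5) by auto
  then have "h (L (x - p)) (L (x - p)) = h (x - p) (L (L (x - p)))"
    using self zE E(2) by blast
  also have "\<dots> = 0" using p(2) span_T \<open>L (x - p) \<in> E\<close> by blast
  finally have "L (x - p) = 0" using h_self_zero \<open>L (x - p) \<in> E\<close> E(2) by blast
  then show ?thesis using that[OF y(1) zE] y(2) by simp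
qed

text \<open>Existence comes from x = z + L y with L z = 0, where L y splits into an image of D and
  one of D'. The condition \<open>sq\<close> makes the three summands orthogonal, which gives
  uniqueness. Local finiteness \<open>fin\<close> takes the place of completeness of W.\<close>

lemma hodge_decomposition:
  fixes D D' L
  assumes D: "\<And>x. x \<in> W \<Longrightarrow> D x \<in> W" "\<And>x y. x \<in> W \<Longrightarrow> y \<in> W \<Longrightarrow> D (x + y) = D x + D y"
      "\<And>c x. x \<in> W \<Longrightarrow> D (s c x) = s c (D x)"
    and D': "\<And>x. x \<in> W \<Longrightarrow> D' x \<in> W" "\<And>x y. x \<in> W \<Longrightarrow> y \<in> W \<Longrightarrow> D' (x + y) = D' x + D' y"
      "\<And>c x. x \<in> W \<Longrightarrow> D' (s c x) = s c (D' x)"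
    and adj: "\<And>x y. x \<in> W \<Longrightarrow> y \<in> W \<Longrightarrow> h (D x) y = h x (D' y)"
    and sq: "\<And>x. x \<in> W \<Longrightarrow> D (D x) = 0"
    and L: "\<And>x. x \<in> W \<Longrightarrow> L x = D (D' x) + D' (D x)"
    and fin: "\<And>x. x \<in> W \<Longrightarrow> \<exists>E S. subspace E \<and> E \<subseteq> W \<and> finite S \<and> E \<subseteq> span S \<and> L ` E \<subseteq> E \<and> x \<in> E"
  shows "kernel_on W L = kernel_on W D \<inter> kernel_on W D'"
    and "direct_sum W [kernel_on W L, D ` W, D' ` W]"
    and "direct_sum (kernel_on W D) [kernel_on W L, D ` W]"
    and "direct_sum (kernel_on W D') [kernel_on W L, D' ` W]"
proof -
  have adj': "h (D' x) y = h x (D y)" if "x \<in> W" "y \<in> W" for x y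
    by (rule adjoint_sym[of D D']) (use that adj D(1) D'(1) in auto)
  have sq': "D' (D' x) = 0" if x: "x \<in> W" for x
  proof (rule h_ext)
    show "D' (D' x) \<in> W" using D' x by simp
    show "h (D' (D' x)) y = 0" if "y \<in> W" for y
      using adj' that x D D' sq by simp
  qed
  have D0: "D 0 = 0" "D' 0 = 0" using D(3)[of 0 0] D'(3)[of 0 0] W_closed(1) by simp_all
  have LW: "L x \<in> W" if "x \<in> W" for x using that by (simp add: L D D' W_closed)
  show ker: "kernel_on W L = kernel_on W D \<inter> kernel_on W D'"
  proof (intro equalityI subsetI)
    fix x assume "x \<in> kernel_on W L"
    then have x: "x \<in> W" "L x = 0" by (auto simp: kernel_on_def)
    have "h (L x) x = h (D' x) (D' x) + h (D x) (D x)"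
      using x(1) by (simp add: L h_add D D' adj adj')
    then have "h (D' x) (D' x) + h (D x) (D x) = 0" using x by simp
    from arg_cong[OF this, of Re] have "Re (h (D' x) (D' x)) + Re (h (D x) (D x)) = 0" by simp
    then have "\<not> Re (h (D' x) (D' x)) > 0" "\<not> Re (h (D x) (D x)) > 0"
      using h_self_nonneg[of "D x"] h_self_nonneg[of "D' x"] D(1) D'(1) x(1) by auto
    then have "D x = 0" "D' x = 0" using h_pos D(1) D'(1) x(1) by blast+
    then show "x \<in> kernel_on W D \<inter> kernel_on W D'" using x by (simp add: kernel_on_def)
  next
    fix x assume "x \<in> kernel_on W D \<inter> kernel_on W D'"
    then show "x \<in> kernel_on W L" by (auto simp: kernel_on_def L D0)
  qed
  have self: "h (L x) y = h x (L y)" if "x \<in> W" "y \<in> W" for x y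
    using that by (simp add: L h_add h_right D D' adj adj')
  have Llin: "L (x + y) = L x + L y" "L (s c x) = s c (L x)" if "x \<in> W" "y \<in> W" for x y c
    using that by (simp_all add: L D D' W_closed scale_right_distrib)
  have Ladd: "L (x + y) = L x + L y" if "x \<in> W" "y \<in> W" for x y using Llin that by blast
  have Lsc: "L (s c x) = s c (L x)" if "x \<in> W" for x c using Llin(2)[OF that that] .
  have decomp: "\<exists>z\<in>kernel_on W L. \<exists>a\<in>W. \<exists>b\<in>W. x = z + D a + D' b" if x: "x \<in> W" for x
  proof -
    obtain E S where E: "subspace E" "E \<subseteq> W" "finite S" "E \<subseteq> span S" "L ` E \<subseteq> E" "x \<in> E"
      using fin[OF x] by blast
    obtain y z where yz: "y \<in> E" "z \<in> E" "x = z + L y" "L z = 0"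
      by (rule selfadjoint_splitting[OF LW Ladd Lsc self E])
    then have yW: "y \<in> W" and zW: "z \<in> W" using E(2) by auto
    have eq: "x = z + D (D' y) + D' (D y)" using yz(3) L[OF yW] by (simp add: add.assoc)
    have "z \<in> kernel_on W L" using zW yz(4) by (simp add: kernel_on_def)
    then show ?thesis using eq D(1)[OF yW] D'(1)[OF yW] by (intro bexI)
  qed
  have kD: "z \<in> kernel_on W L \<longleftrightarrow> z \<in> W \<and> D z = 0 \<and> D' z = 0" for z
    unfolding ker by (auto simp: kernel_on_def)
  have diffD: "D (x - y) = D x - D y" "D' (x - y) = D' x - D' y" if "x \<in> W" "y \<in> W" for x y
    using D(2)[of "x - y" y] D'(2)[of "x - y" y] that by (simp_all add: W_closed)
  have inj3: "z = z' \<and> D a = D a' \<and> D' b = D' b'"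
    if "z \<in> kernel_on W L" "z' \<in> kernel_on W L" and W: "a \<in> W" "a' \<in> W" "b \<in> W" "b' \<in> W"
      and eq: "z + D a + D' b = z' + D a' + D' b'" for z z' a a' b b'
  proof -
    define u v w where "u = z - z'" "v = a - a'" "w = b - b'"
    have zW: "z \<in> W" "z' \<in> W" "D z = 0" "D' z = 0" "D z' = 0" "D' z' = 0" using that(1,2) by (auto simp: kD)
    have uvw: "u \<in> W" "v \<in> W" "w \<in> W" "D u = 0" "D' u = 0"
      using W zW by (simp_all add: u_v_w_def W_closed diffD)
    have sum: "u + D v + D' w = 0" using eq W by (simp add: u_v_w_def diffD algebra_simps)
    have "h (D v) u = 0" "h (D' w) u = 0" "h (D v) (D' w) = 0" "h (D' w) (D v) = 0" "h u (D v) = 0"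
      "h u (D' w) = 0"
      using uvw adj[of v u] adj'[of w u] adj[of v "D' w"] adj'[of w "D v"] adj'[of u v] adj[of u w]
      by (simp_all add: D D' sq sq')
    moreover have "h (u + D v + D' w) u = 0" "h (u + D v + D' w) (D v) = 0" "h (u + D v + D' w) (D' w) = 0"
      using sum uvw D(1) D'(1) by simp_all
    ultimately have "h u u = 0" "h (D v) (D v) = 0" "h (D' w) (D' w) = 0"
      using uvw by (simp_all add: h_add D D' W_closed)
    then have "u = 0" "D v = 0" "D' w = 0" using h_self_zero uvw D(1) D'(1) by blast+
    then show ?thesis using W by (simp add: u_v_w_def diffD)
  qed
  show "direct_sum W [kernel_on W L, D ` W, D' ` W]"
  proof (rule direct_sum_3I)
    show "x + y + z \<in> W" if "x \<in> kernel_on W L" "y \<in> D ` W" "z \<in> D' ` W" for x y z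
      using that D(1) D'(1) by (auto simp: kD intro!: W_closed)
    show "\<exists>a\<in>kernel_on W L. \<exists>b\<in>D ` W. \<exists>c\<in>D' ` W. w = a + b + c" if "w \<in> W" for w
      using decomp[OF that] by blast
    show "x = x' \<and> y = y' \<and> z = z'" if "x \<in> kernel_on W L" "y \<in> D ` W" "z \<in> D' ` W"
      "x' \<in> kernel_on W L" "y' \<in> D ` W" "z' \<in> D' ` W" "x + y + z = x' + y' + z'" for x y z x' y' z'
    proof -
      note prems = that
      obtain a where a: "a \<in> W" "y = D a" using prems(2) by blast
      obtain a' where a': "a' \<in> W" "y' = D a'" using prems(5) by blast
      obtain b where b: "b \<in> W" "z = D' b" using prems(3) by blast
      obtain b' where b': "b' \<in> W" "z' = D' b'" using prems(6) by blast
      note ab = a(1) a'(1) b(1) b'(1) a(2) a'(2) b(2) b'(2)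
      show ?thesis using inj3[OF prems(1,4) ab(1-4)] prems(7) ab by simp
    qed
  qed
  show "direct_sum (kernel_on W D) [kernel_on W L, D ` W]"
    proof (rule direct_sum_2I)
    show "x + y \<in> kernel_on W D" if "x \<in> kernel_on W L" "y \<in> D ` W" for x y
    proof -
      have "x \<in> W" "D x = 0" using that(1) by (simp_all add: kD)
      then show ?thesis using that(2) D by (auto simp: kernel_on_def sq W_closed)
    qed
    show "\<exists>a\<in>kernel_on W L. \<exists>b\<in>D ` W. w = a + b" if "w \<in> kernel_on W D" for w
    proof -
      have w: "w \<in> W" "D w = 0" using that by (auto simp: kernel_on_def)
      obtain z a b where zab: "z \<in> kernel_on W L" "a \<in> W" "b \<in> W" "w = z + D a + D' b" using decomp[OF w(1)] by blast
      have z: "z \<in> W" "D z = 0" using zab by (auto simp: kD)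
      \<comment> \<open>An element of Ker D has no component in the image of D': pairing D (D' b) =
        0 with b gives the squared norm of D' b.\<close>
      have "D w = D (D' b)" using zab z by (simp add: D D' sq W_closed)
      then have "h (D' b) (D' b) = 0" using w zab by (simp add: adj' D D')
      then have "D' b = 0" using h_self_zero D' zab by blast
      then show ?thesis using zab by auto
    qed
    show "x = x' \<and> y = y'" if "x \<in> kernel_on W L" "y \<in> D ` W" "x' \<in> kernel_on W L" "y' \<in> D ` W" "x + y = x' + y'" for x y x' y'
    proof -
      note prems = that
      obtain a where a: "a \<in> W" "y = D a" using prems(2) by blast
      obtain a' where a': "a' \<in> W" "y' = D a'" using prems(4) by blast
      note ab = a(1) a'(1) a(2) a'(2)
      have "x = x' \<and> D a = D a' \<and> D' 0 = D' 0"
        by (rule inj3[OF prems(1,3) ab(1,2)]) (use prems(5) ab W_closed(1) in \<open>simp_all add: D0\<close>)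
      then show ?thesis using ab by auto
    qed
  qed
  show "direct_sum (kernel_on W D') [kernel_on W L, D' ` W]"
    proof (rule direct_sum_2I)
    show "x + y \<in> kernel_on W D'" if "x \<in> kernel_on W L" "y \<in> D' ` W" for x y
    proof -
      have "x \<in> W" "D' x = 0" using that(1) by (simp_all add: kD)
      then show ?thesis using that(2) D' by (auto simp: kernel_on_def sq' W_closed)
    qed
    show "\<exists>a\<in>kernel_on W L. \<exists>b\<in>D' ` W. w = a + b" if "w \<in> kernel_on W D'" for w
    proof -
      have w: "w \<in> W" "D' w = 0" using that by (auto simp: kernel_on_def)
      obtain z a b where zab: "z \<in> kernel_on W L" "a \<in> W" "b \<in> W" "w = z + D a + D' b" using decomp[OF w(1)] by blast
      have z: "z \<in> W" "D' z = 0" using zab by (auto simp: kD)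
      have "D' w = D' (D a)" using zab z by (simp add: D D' sq' W_closed)
      then have "h (D a) (D a) = 0" using w zab by (simp add: adj D D')
      then have "D a = 0" using h_self_zero D zab by blast
      then show ?thesis using zab by auto
    qed
    show "x = x' \<and> y = y'" if "x \<in> kernel_on W L" "y \<in> D' ` W" "x' \<in> kernel_on W L" "y' \<in> D' ` W" "x + y = x' + y'" for x y x' y'
    proof -
      note prems = that
      obtain a where a: "a \<in> W" "y = D' a" using prems(2) by blast
      obtain a' where a': "a' \<in> W" "y' = D' a'" using prems(4) by blast
      note ab = a(1) a'(1) a(2) a'(2)
      have "x = x' \<and> D 0 = D 0 \<and> D' a = D' a'"
        by (rule inj3[OF prems(1,3) _ _ ab(1,2)]) (use prems(5) ab W_closed(1) in \<open>simp_all add: D0\<close>)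
      then show ?thesis using ab by auto
    qed
  qed
qed

end

section \<open>Adjoints and the Laplacian\<close>

text \<open>\<open>H_e\<close> says that exterior multiplication by Y is adjoint to the Clifford
  action of - \<theta> (cj Y), and \<open>dag_us\<close> that this same map relates the dual bases,
  that is, \<open>ub\<close> is orthonormal for half of the Hermitian form. Hence creation by
  \<open>ub i\<close> and the Clifford action of \<open>us i\<close> are mutually adjoint.\<close>

locale spin_hermitian = spin_adapted s B n ub us br P \<theta> \<rho>
  for s :: "complex \<Rightarrow> 'v::ab_group_add \<Rightarrow> 'v"
    and B :: "complex^'n \<Rightarrow> complex^'n \<Rightarrow> complex" and n :: nat and ub us :: "nat \<Rightarrow> complex^'n"
    and br :: "complex^'n \<Rightarrow> complex^'n \<Rightarrow> complex^'n" and P \<theta> \<rho> +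
  fixes cj :: "complex^'n \<Rightarrow> complex^'n" and h :: "'v \<Rightarrow> 'v \<Rightarrow> complex"
    and H :: "((complex^'n) list \<Rightarrow> 'v) \<Rightarrow> ((complex^'n) list \<Rightarrow> 'v) \<Rightarrow> complex"
  assumes theta_theta: "\<theta> (\<theta> X) = X"
    and cj_cj: "cj (cj X) = X" and theta_cj: "\<theta> (cj X) = cj (\<theta> X)"
    and cj_neg: "cj (- X) = - cj X"
    and cj_br: "cj (br X Y) = br (cj X) (cj Y)"
    and dag_us: "i < n \<Longrightarrow> - \<theta> (cj (us i)) = ub i"
    and U_br: "\<lbrakk>X \<in> U; Y \<in> U\<rbrakk> \<Longrightarrow> br X Y \<in> U"
    and trace_U: "X \<in> U \<Longrightarrow> (\<Sum>j<n. B (us j) (br X (ub j))) = 0"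
    and h_positive: "positive_hermitian_form s h"
    and h_rho: "h (\<rho> Z v) w = - h v (\<rho> (cj Z) w)"
    and H_left: "\<lbrakk>x \<in> VS; y \<in> VS; z \<in> VS\<rbrakk> \<Longrightarrow> H (x + y) z = H x z + H y z"
      "\<lbrakk>x \<in> VS; z \<in> VS\<rbrakk> \<Longrightarrow> H (sf c x) z = c * H x z"
    and H_right: "\<lbrakk>x \<in> VS; y \<in> VS; z \<in> VS\<rbrakk> \<Longrightarrow> H z (x + y) = H z x + H z y"
      "\<lbrakk>x \<in> VS; z \<in> VS\<rbrakk> \<Longrightarrow> H z (sf c x) = cnj c * H z x"
    and H_vac: "H (vac v) (vac w) = h v w"
    and H_e: "\<lbrakk>Y \<in> U; x \<in> VS; y \<in> VS\<rbrakk> \<Longrightarrow> H (e Y x) y = H x (f (- \<theta> (cj Y)) y)"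
      "\<lbrakk>Y \<in> U; x \<in> VS; y \<in> VS\<rbrakk> \<Longrightarrow> H y (e Y x) = H (f (- \<theta> (cj Y)) y) x"
begin

section \<open>Hermitian symmetry and positivity of the form on V \<otimes> S\<close>

abbreviation dag :: "complex^'n \<Rightarrow> complex^'n" where "dag X \<equiv> - \<theta> (cj X)"

lemma theta_neg: "\<theta> (- X) = - \<theta> X" using theta_simps(2)[of "-1" X] by simp

lemma dag_dag [simp]: "dag (dag X) = X"
  by (simp add: cj_neg theta_neg theta_cj[symmetric] theta_theta cj_cj)

lemma dag_ub: "i < n \<Longrightarrow> dag (ub i) = us i"
  using dag_dag[of "us i"] dag_us[of i] by simp

lemma h_props:
  "h (x + y) z = h x z + h y z" "h (s c x) y = c * h x y" "x \<noteq> 0 \<Longrightarrow> Re (h x x) > 0"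
  using h_positive unfolding positive_hermitian_form_def by blast+

lemma h_conj: "h y x = cnj (h x y)"
  using h_positive unfolding positive_hermitian_form_def by blast

lemma H_zero: "z \<in> VS \<Longrightarrow> H 0 z = 0" "z \<in> VS \<Longrightarrow> H z 0 = 0"
  using H_left(2)[of 0 z 0] H_right(2)[of 0 z 0] by (simp_all add: VS_closed)

lemma H_sym: "x \<in> VS \<Longrightarrow> y \<in> VS \<Longrightarrow> H y x = cnj (H x y)"
proof (induction arbitrary: y rule: VS_induct)
  case (vac v)
  from vac show ?case
  proof (induction rule: VS_induct)
    case (vac w)
    then show ?case by (simp add: H_vac h_conj[of w v])
  next
    case (e Y x)
    then show ?case by (simp add: H_e VS_vac H_zero)
  next
    case (add x y)
    then show ?case by (simp add: H_left H_right VS_vac)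
  qed
next
  case (e Y x)
  then show ?case by (simp add: H_e VS_f)
next
  case (add x y)
  then show ?case by (simp add: H_left H_right)
qed

text \<open>In y + e (ub m) z with y, z from stage m the summands are orthogonal because
  \<open>us m\<close> annihilates y, and the squared norm of the second is twice that of z by the
  Clifford relation. Positivity thus climbs the Fock stages, starting from that of h.\<close>

lemma H_pos: "x \<in> VS \<Longrightarrow> x \<noteq> 0 \<Longrightarrow> Re (H x x) > 0"
proof -
  have "Re (H x x) \<ge> 0 \<and> (Re (H x x) = 0 \<longrightarrow> x = 0)" if "x \<in> Fock UNIV m" "m \<le> n" for m x
    using that
  proof (induction m arbitrary: x)
    case 0
    then obtain v where v: "x = vac v" by auto
    show ?case
    proof (cases "v = 0")
      case True
      then have "x = 0" using v vac_add(2)[of 0 0] by simp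
      then show ?thesis by (simp add: H_zero VS_closed)
    next
      case False
      then show ?thesis using h_props(3)[of v] v by (simp add: H_vac)
    qed
  next
    case (Suc m)
    then obtain y z where x: "x = y + e (ub m) z" "y \<in> Fock UNIV m" "z \<in> Fock UNIV m" by auto
    have m: "m < n" "m \<le> n" using Suc.prems by auto
    have V: "y \<in> VS" "z \<in> VS" using Fock_sub_VS x m by auto
    note U = ub_in[OF m(1)]
    have kill: "f (us m) y = 0" "f (us m) z = 0" using Fock_f_high[of _ UNIV m m] x m by auto
    have "H y (e (ub m) z) = 0" "H (e (ub m) z) y = 0"
      using H_e[OF U V(2,1)] kill V by (simp_all add: dag_ub m H_zero)
    moreover have "H (e (ub m) z) (e (ub m) z) = 2 * H z z"
      using H_e(1)[OF U V(2) VS_e[OF U V(2)]] kill V m by (simp add: dag_ub f_e dual e_simps H_right)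
    ultimately have "H x x = H y y + 2 * H z z"
      using V U by (simp add: x H_left H_right VS_e VS_closed)
    then have R: "Re (H x x) = Re (H y y) + 2 * Re (H z z)" by simp
    have IH: "Re (H y y) \<ge> 0" "Re (H y y) = 0 \<longrightarrow> y = 0" "Re (H z z) \<ge> 0" "Re (H z z) = 0 \<longrightarrow> z = 0"
      using Suc.IH[OF x(2) m(2)] Suc.IH[OF x(3) m(2)] by auto
    show ?case
    proof (intro conjI impI)
      show "Re (H x x) \<ge> 0" using R IH by simp
      assume "Re (H x x) = 0"
      then have "y = 0" "z = 0" using R IH by auto
      then show "x = 0" by (simp add: x e_simps)
    qed
  qed
  then show "x \<in> VS \<Longrightarrow> x \<noteq> 0 \<Longrightarrow> Re (H x x) > 0" using VS_Fock by force
qed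

sublocale HH: hermitian_space sf VS H
proof (intro hermitian_space.intro hermitian_space_axioms.intro)
  show "vector_space sf" by (rule F.vector_space_axioms)
  show "F.subspace VS" by (rule VS_subspace)
qed (fact H_left H_sym H_pos)+

lemma H_f: "dag W \<in> U \<Longrightarrow> x \<in> VS \<Longrightarrow> y \<in> VS \<Longrightarrow> H (f W x) y = H x (e (dag W) y)"
  using H_e(2)[of "dag W" y x] by simp

definition star_rep where
  "star_rep R \<longleftrightarrow> linrep R \<and> (\<forall>Z v w. h (R Z v) w = - h v (R (cj Z) w))"

lemma H_comp:
  assumes R: "star_rep R"
  shows "x \<in> VS \<Longrightarrow> y \<in> VS \<Longrightarrow> H (R Z \<circ> x) y = - H x (R (cj Z) \<circ> y)"
proof (induction arbitrary: y rule: VS_induct)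
  case (vac v)
  have l: "linV (R Z)" for Z using R linrepD by (simp add: star_rep_def)
  from vac show ?case
  proof (induction rule: VS_induct)
    case (vac w)
    then show ?case using R by (simp add: decomposable_comp[OF l] H_vac star_rep_def)
  next
    case (e Y x)
    then show ?case by (simp add: comp_e l decomposable_comp VS_vac H_e H_zero VS_comp del: comp_apply)
  next
    case (add x y)
    then show ?case by (simp add: comp_simps l H_right VS_vac VS_comp del: comp_apply)
  qed
next
  case (e Y x)
  have l: "linV (R Z)" for Z using R linrepD by (simp add: star_rep_def)
  show ?case using e by (simp add: comp_e l H_e VS_f VS_comp comp_f del: comp_apply)
next
  case (add x y)
  have l: "linV (R Z)" for Z using R linrepD by (simp add: star_rep_def)
  show ?case using add by (simp add: comp_simps l H_left VS_comp H_right del: comp_apply)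
qed

section \<open>The operator C^- and the adjoint of C\<close>

definition linm where "linm R x = (\<Sum>i<n. f (us i) (R (ub i) \<circ> x))"
definition cubm where "cubm x = (\<Sum>i<n. \<Sum>j<n. e (br (ub i) (ub j)) (f (us i) (f (us j) x)))"
definition CM where "CM R x = linm R x - sf (1/4) (cubm x)"

lemma linm_linear: "linrep R \<Longrightarrow> Vector_Spaces.linear sf sf (linm R)"
  by unfold_locales (simp_all add: linm_def comp_simps linrepD f_simps sum.distrib F.scale_sum_right)

lemma cubm_linear: "Vector_Spaces.linear sf sf cubm"
  by unfold_locales (simp_all add: cubm_def e_simps f_simps sum.distrib F.scale_sum_right)

lemma CM_linear: "linrep R \<Longrightarrow> Vector_Spaces.linear sf sf (CM R)"
  by unfold_locales (simp_all add: CM_def linear_sf[OF linm_linear] linear_sf[OF cubm_linear] algebra_simps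
    F.scale_right_distrib F.scale_right_diff_distrib)

lemmas CM_simps = linear_sf[OF CM_linear]

lemma VS_CM: "linrep R \<Longrightarrow> x \<in> VS \<Longrightarrow> CM R x \<in> VS"
  unfolding CM_def linm_def cubm_def
  by (intro VS_closed VS_e VS_f VS_comp linrepD ub_in U_br) auto

text \<open>Here the twist arises: the adjoint of \<open>R (us i)\<close> is
  \<open>- R (cj (us i))\<close>, and \<open>cj (us i)\<close> is
  \<open>- \<theta> (ub i)\<close>.\<close>

lemma lin_adj:
  assumes R: "star_rep R" and x: "x \<in> VS" and y: "y \<in> VS"
  shows "H (lin R x) y = H x (linm (\<lambda>Z. R (\<theta> Z)) y)"
proof -
  have l: "linrep R" using R by (simp add: star_rep_def)
  note lV = linrepD[OF l]
  have "H (e (ub i) (R (us i) \<circ> x)) y = H x (f (us i) (R (\<theta> (ub i)) \<circ> y))" if i: "i < n" for i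
  proof -
    have "cj (us i) = - \<theta> (ub i)"
      using dag_us[OF i, symmetric] by (simp add: theta_neg theta_theta)
    then have "(R (cj (us i)) \<circ> f (us i) y) = - (R (\<theta> (ub i)) \<circ> f (us i) y)"
      by (simp add: linrep_lin[OF l])
    moreover have "H (e (ub i) (R (us i) \<circ> x)) y = - H x (R (cj (us i)) \<circ> f (us i) y)"
      using x y i by (simp add: H_e ub_in VS_comp lV dag_ub H_comp[OF R] VS_f)
    moreover have "H x (- (R (\<theta> (ub i)) \<circ> f (us i) y)) = - H x (R (\<theta> (ub i)) \<circ> f (us i) y)"
      using H_right(2)[of "R (\<theta> (ub i)) \<circ> f (us i) y" x "-1"] x y by (simp add: VS_comp lV VS_f)
    ultimately show ?thesis by (simp add: comp_f lV)
  qed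
  moreover have "H (lin R x) y = (\<Sum>i<n. H (e (ub i) (R (us i) \<circ> x)) y)"
    unfolding lin_def using x y by (intro HH.h_sum VS_e VS_comp lV ub_in) auto
  moreover have "H x (linm (\<lambda>Z. R (\<theta> Z)) y) = cnj (\<Sum>i<n. H (f (us i) (R (\<theta> (ub i)) \<circ> y)) x)"
  proof -
    have "H (linm (\<lambda>Z. R (\<theta> Z)) y) x = (\<Sum>i<n. H (f (us i) (R (\<theta> (ub i)) \<circ> y)) x)"
      unfolding linm_def using x y by (intro HH.h_sum VS_f VS_comp lV) auto
    moreover have "linm (\<lambda>Z. R (\<theta> Z)) y \<in> VS"
      unfolding linm_def using y by (intro VS_closed VS_f VS_comp lV)
    ultimately show ?thesis using H_sym[of "linm (\<lambda>Z. R (\<theta> Z)) y" x] x by simp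
  qed
  moreover have "cnj (H (f (us i) (R (\<theta> (ub i)) \<circ> y)) x) = H x (f (us i) (R (\<theta> (ub i)) \<circ> y))" for i
    using H_sym[of "f (us i) (R (\<theta> (ub i)) \<circ> y)" x] x y by (simp add: VS_f VS_comp lV)
  ultimately show ?thesis by simp
qed

lemma H_sum_right:
  "\<lbrakk>\<And>i. i \<in> I \<Longrightarrow> g i \<in> VS; x \<in> VS\<rbrakk> \<Longrightarrow> H x (\<Sum>i\<in>I. g i) = (\<Sum>i\<in>I. H x (g i))"
  by (induction I rule: infinite_finite_induct) (simp_all add: H_right VS_closed H_zero)

lemma H_double_sum:
  assumes "\<And>i j. i < n \<Longrightarrow> j < n \<Longrightarrow> g i j \<in> VS" "z \<in> VS"
  shows "H (\<Sum>i<n. \<Sum>j<n. g i j) z = (\<Sum>i<n. \<Sum>j<n. H (g i j) z)"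
    "H z (\<Sum>i<n. \<Sum>j<n. g i j) = (\<Sum>i<n. \<Sum>j<n. H z (g i j))"
proof -
  have V: "(\<Sum>j<n. g i j) \<in> VS" if "i < n" for i using assms(1) that by (intro VS_closed) auto
  have "H (\<Sum>i<n. \<Sum>j<n. g i j) z = (\<Sum>i<n. H (\<Sum>j<n. g i j) z)"
    by (rule HH.h_sum) (use V assms(2) in auto)
  also have "\<dots> = (\<Sum>i<n. \<Sum>j<n. H (g i j) z)"
    by (intro sum.cong refl HH.h_sum) (use assms in auto)
  finally show "H (\<Sum>i<n. \<Sum>j<n. g i j) z = (\<Sum>i<n. \<Sum>j<n. H (g i j) z)" .
  have "H z (\<Sum>i<n. \<Sum>j<n. g i j) = (\<Sum>i<n. H z (\<Sum>j<n. g i j))"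
    by (rule H_sum_right) (use V assms(2) in auto)
  also have "\<dots> = (\<Sum>i<n. \<Sum>j<n. H z (g i j))"
    by (intro sum.cong refl H_sum_right) (use assms in auto)
  finally show "H z (\<Sum>i<n. \<Sum>j<n. g i j) = (\<Sum>i<n. \<Sum>j<n. H z (g i j))" .
qed

lemma e_neg: "e (- V) y = - e V y"
  using e_lin(2)[of "-1" V y] by simp

text \<open>Moving the creation operator to the left costs the trace of \<open>ad u\<close>, which vanishes.\<close>
lemma cubm_reorder:
  assumes y: "y \<in> VS"
  shows "(\<Sum>i<n. \<Sum>j<n. f (us j) (f (us i) (e (- br (ub i) (ub j)) y))) = cubm y"
proof -
  let ?V = "\<lambda>i j. br (ub i) (ub j)"
  have t: "f (us j) (f (us i) (e (- ?V i j) y)) =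
    e (?V i j) (f (us i) (f (us j) y)) + (sf 2 (sf (B (us j) (?V i j)) (f (us i) y)) - sf 2 (sf (B (us i) (?V i j)) (f (us j) y)))"
    for i j
  proof -
    have a: "f (us j) (f (us i) y) = - f (us i) (f (us j) y)"
      using f_anticomm[OF y, of "us j" "us i"] by (simp add: eq_neg_iff_add_eq_0)
    have "f (us j) (f (us i) (e (?V i j) y)) = sf (2 * B (us i) (?V i j)) (f (us j) y)
       - (sf (2 * B (us j) (?V i j)) (f (us i) y) - e (?V i j) (f (us j) (f (us i) y)))"
      by (simp add: f_e f_simps)
    then show ?thesis by (simp add: e_neg f_simps a e_simps)
  qed
  have z1: "(\<Sum>j<n. sf (B (us j) (?V i j)) (f (us i) y)) = 0" if "i < n" for i
    using trace_U[OF ub_in[OF that]] by (simp flip: F.scale_sum_left)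
  have z2: "(\<Sum>i<n. sf (B (us i) (?V i j)) (f (us j) y)) = 0" if "j < n" for j
  proof -
    have "B (us i) (?V i j) = - B (us i) (br (ub j) (ub i))" for i
      using B_scale(2)[of "us i" "-1" "br (ub j) (ub i)"] br_antisym[of "ub i" "ub j"] by simp
    then have "(\<Sum>i<n. B (us i) (?V i j)) = 0" using trace_U[OF ub_in[OF that]] by (simp add: sum_negf)
    then show ?thesis by (simp flip: F.scale_sum_left)
  qed
  have "(\<Sum>i<n. \<Sum>j<n. sf 2 (sf (B (us j) (?V i j)) (f (us i) y))) = sf 2 (\<Sum>i<n. \<Sum>j<n. sf (B (us j) (?V i j)) (f (us i) y))"
    by (simp add: F.scale_sum_right)
  also have "\<dots> = 0" by (simp add: z1)
  finally have S1: "(\<Sum>i<n. \<Sum>j<n. sf 2 (sf (B (us j) (?V i j)) (f (us i) y))) = 0" .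
  have "(\<Sum>i<n. \<Sum>j<n. sf 2 (sf (B (us i) (?V i j)) (f (us j) y))) = sf 2 (\<Sum>j<n. \<Sum>i<n. sf (B (us i) (?V i j)) (f (us j) y))"
    by (subst sum.swap) (simp add: F.scale_sum_right)
  also have "\<dots> = 0" by (simp add: z2)
  finally have S2: "(\<Sum>i<n. \<Sum>j<n. sf 2 (sf (B (us i) (?V i j)) (f (us j) y))) = 0" .
  show ?thesis unfolding t cubm_def using S1 S2 by (simp only: sum.distrib sum_subtractf) simp
qed

text \<open>No twist remains in the cubic term: \<theta> and conjugation are compatible with
  brackets, so \<open>dag\<close> sends [us i, us j] to - [ub i, ub j]. Taking adjoints reverses the
  product, which leaves the creation operator innermost; \<open>cubm_reorder\<close> restores the
  order.\<close>

lemma cub_adj: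
  assumes x: "x \<in> VS" and y: "y \<in> VS"
  shows "H (cub x) y = H x (cubm y)"
proof -
  have t: "H (f (br (us i) (us j)) (e (ub i) (e (ub j) x))) y =
     H x (f (us j) (f (us i) (e (- br (ub i) (ub j)) y)))" if ij: "i < n" "j < n" for i j
  proof -
    have c: "cj (us i) = - \<theta> (ub i)" if "i < n" for i
      using dag_us[OF that, symmetric] by (simp add: theta_neg theta_theta)
    have "br (- X) (- Y) = br X Y" for X Y
      using br_scale(1)[of "-1" X "- Y"] br_scale(2)[of X "-1" Y] by simp
    then have d: "dag (br (us i) (us j)) = - br (ub i) (ub j)"
      using ij by (simp add: cj_br c theta_br theta_neg theta_theta)
    have dU: "- br (ub i) (ub j) \<in> U" using U_br ub_in ij by (simp add: vec.span_neg)
    have "H (f (br (us i) (us j)) (e (ub i) (e (ub j) x))) y =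
       H (e (ub i) (e (ub j) x)) (e (- br (ub i) (ub j)) y)"
      using H_f[of "br (us i) (us j)" "e (ub i) (e (ub j) x)" y] x y ij dU by (simp add: d VS_e ub_in)
    also have "\<dots> = H x (f (us j) (f (us i) (e (- br (ub i) (ub j)) y)))"
      using x y ij dU by (simp add: H_e(1) ub_in VS_e VS_f dag_ub)
    finally show ?thesis .
  qed
  have dU: "- br (ub i) (ub j) \<in> U" if "i < n" "j < n" for i j using U_br ub_in that by (simp add: vec.span_neg)
  have "H (cub x) y = (\<Sum>i<n. \<Sum>j<n. H (f (br (us i) (us j)) (e (ub i) (e (ub j) x))) y)"
    unfolding cub_def using x y by (intro H_double_sum VS_f VS_e ub_in)
  also have "\<dots> = (\<Sum>i<n. \<Sum>j<n. H x (f (us j) (f (us i) (e (- br (ub i) (ub j)) y))))"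
    by (simp add: t)
  also have "\<dots> = H x (\<Sum>i<n. \<Sum>j<n. f (us j) (f (us i) (e (- br (ub i) (ub j)) y)))"
    using x y dU by (intro H_double_sum(2)[symmetric] VS_f VS_e)
  finally show ?thesis by (simp add: cubm_reorder y)
qed

lemma CC_adj:
  assumes R: "star_rep R" and x: "x \<in> VS" and y: "y \<in> VS"
  shows "H (CC R x) y = H x (CM (\<lambda>Z. R (\<theta> Z)) y)"
proof -
  have l: "linrep R" using R by (simp add: star_rep_def)
  note lV = linrepD[OF l]
  have V: "lin R x \<in> VS" "cub x \<in> VS" "linm (\<lambda>Z. R (\<theta> Z)) y \<in> VS" "cubm y \<in> VS"
    unfolding lin_def cub_def linm_def cubm_def using x y
    by (intro VS_closed VS_e VS_f VS_comp lV ub_in U_br; simp)+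
  show ?thesis
    using x y V by (simp add: CC_def CM_def HH.h_diff HH.h_right HH.h_scale VS_closed lin_adj[OF R] cub_adj)
qed

lemma rho_star: "star_rep \<rho>" using rho_linrep h_rho by (simp add: star_rep_def)

lemma rho_theta_linrep: "linrep \<rho>\<theta>" using rho_theta_rep by (simp add: is_rep_def)

lemma rho_theta_star: "star_rep \<rho>\<theta>"
  using rho_theta_linrep by (simp add: star_rep_def \<rho>\<theta>_def h_rho theta_cj)

lemma adjoints:
  assumes "x \<in> VS" "y \<in> VS"
  shows "H (CC \<rho> x) y = H x (CM \<rho>\<theta> y)" "H (CC \<rho>\<theta> x) y = H x (CM \<rho> y)" "H (CM \<rho> x) y = H x (CC \<rho>\<theta> y)"
proof -
  have t: "(\<lambda>Z. \<rho> (\<theta> Z)) = \<rho>\<theta>" "(\<lambda>Z. \<rho>\<theta> (\<theta> Z)) = \<rho>" by (simp_all add: \<rho>\<theta>_def fun_eq_iff theta_theta)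
  show "H (CC \<rho> x) y = H x (CM \<rho>\<theta> y)" using CC_adj[OF rho_star assms] by (simp add: t)
  show 2: "H (CC \<rho>\<theta> x) y = H x (CM \<rho> y)" using CC_adj[OF rho_theta_star assms] by (simp add: t)
  have "H (CC \<rho>\<theta> y) x = H y (CM \<rho> x)" using CC_adj[OF rho_theta_star assms(2,1)] by (simp add: t)
  then show "H (CM \<rho> x) y = H x (CC \<rho>\<theta> y)"
    using H_sym[of "CC \<rho>\<theta> y" x] H_sym[of y "CM \<rho> x"] assms
    by (simp add: VS_CC VS_CM rho_linrep rho_theta_linrep)
qed

section \<open>Adjoints of the two parts and the two Laplacians\<close>

definition AM where "AM x = CM \<rho>K x"

lemma rho_zero: "\<rho> 0 = (\<lambda>v. 0)"
proof
  show "\<rho> 0 v = 0" for v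
    using fun_cong[OF linrep_lin(6)[OF rho_linrep, of "\<lambda>_. v"], of "[]"] by (simp add: fun_app)
qed

lemma rho_theta_ub:
  fixes x :: "(complex^'n) list \<Rightarrow> 'v"
  shows "i < n \<Longrightarrow> (\<rho>\<theta> (ub i) \<circ> x) = (if i \<in> P then - (\<rho> (ub i) \<circ> x) else \<rho> (ub i) \<circ> x)"
  by (simp add: \<rho>\<theta>_def theta_ub linrep_lin[OF rho_linrep])

lemma rhoK_ub: "i < n \<Longrightarrow> \<rho>K (ub i) = (if i \<in> P then (\<lambda>v. 0) else \<rho> (ub i))"
proof -
  assume i: "i < n"
  have "(1/2) *s (ub i + \<theta> (ub i)) = (if i \<in> P then 0 else ub i)"
    using i by (simp add: theta_ub vec_eq_iff)
  then show "\<rho>K (ub i) = (if i \<in> P then (\<lambda>v. 0) else \<rho> (ub i))"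
    by (simp add: \<rho>K_def rho_zero)
qed

lemma CM_split: "CM \<rho> x = AM x + BM x" "CM \<rho>\<theta> x = AM x - BM x"
proof -
  have z: "(\<lambda>_ :: (complex^'n) list. 0 :: 'v) = 0" by (simp add: fun_eq_iff fun_app)
  have K: "linm \<rho>K x = (\<Sum>i\<in>{..<n} - P. f (us i) (\<rho> (ub i) \<circ> x))"
    unfolding linm_def sum_split_P using P_less by (simp add: rhoK_ub z f_simps)
  have "linm \<rho> x = linm \<rho>K x + BM x" unfolding K BM_def by (simp add: linm_def sum_split_P)
  then show "CM \<rho> x = AM x + BM x" by (simp add: CM_def AM_def)
  have "linm \<rho>\<theta> x = (\<Sum>i\<in>{..<n} - P. f (us i) (\<rho> (ub i) \<circ> x)) + (\<Sum>i\<in>P. - f (us i) (\<rho> (ub i) \<circ> x))"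
    unfolding linm_def sum_split_P using P_less by (simp add: rho_theta_ub f_simps)
  then have "linm \<rho>\<theta> x = linm \<rho>K x - BM x" unfolding K BM_def by (simp add: sum_negf)
  then show "CM \<rho>\<theta> x = AM x - BM x" by (simp add: CM_def AM_def)
qed

lemma AM_linear: "Vector_Spaces.linear sf sf AM"
  unfolding AM_def[abs_def] using CM_linear[OF rhoK_linrep] by simp
lemmas AM_simps = linear_sf[OF AM_linear]

lemma VS_AM: "x \<in> VS \<Longrightarrow> AM x \<in> VS"
  unfolding AM_def by (intro VS_CM rhoK_linrep)

text \<open>The adjunctions for \<open>\<rho>\<close> and for \<open>\<rho>\<theta>\<close> concern
  the sum and the difference of the two parts; adding and subtracting them separates the
  parts.\<close>

lemma AB_adjoints:
  assumes x: "x \<in> VS" and y: "y \<in> VS"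
  shows "H (AA x) y = H x (AM y)" "H (BB x) y = - H x (BM y)"
proof -
  have "H (AA x) y + H (BB x) y = H x (AM y) - H x (BM y)"
    "H (AA x) y - H (BB x) y = H x (AM y) + H x (BM y)"
    using adjoints(1,2)[OF x y] x y
    by (simp_all add: CC_split CM_split H_left H_right HH.h_diff HH.h_right VS_AA VS_BB VS_AM VS_BM)
  moreover have "a = c \<and> b = - d" if "a + b = c - d" "a - b = c + d" for a b c d :: complex
  proof -
    have "2 * a = (a + b) + (a - b)" by simp
    also have "\<dots> = 2 * c" using that by simp
    finally show ?thesis using that by simp
  qed
  ultimately show "H (AA x) y = H x (AM y)" "H (BB x) y = - H x (BM y)" by blast+
qed

text \<open>Transposition of \<open>AA_BM\<close>: the adjoint of \<open>AA\<close> is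
  \<open>AM\<close> and that of \<open>BB\<close> is minus \<open>BM\<close>.\<close>

lemma AM_BB:
  assumes x: "x \<in> VS" shows "AM (BB x) + BB (AM x) = 0"
proof (rule HH.h_ext)
  show "AM (BB x) + BB (AM x) \<in> VS" using x by (intro VS_closed VS_AM VS_BB)
  fix y assume y: "y \<in> VS"
  have AM': "H (AM u) w = H u (AA w)" if "u \<in> VS" "w \<in> VS" for u w
    by (rule HH.adjoint_sym[of AA AM]) (use that AB_adjoints(1) VS_AA VS_AM in auto)
  have "H (AM (BB x) + BB (AM x)) y = - H x (BM (AA y)) - H x (AA (BM y))"
    using x y by (simp add: H_left VS_AM VS_BB VS_AA VS_BM AM' AB_adjoints(2))
  also have "\<dots> = - H x (AA (BM y) + BM (AA y))" using x y by (simp add: H_right VS_AA VS_BM)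
  finally show "H (AM (BB x) + BB (AM x)) y = 0" using AA_BM[OF y] x by (simp add: H_zero)
qed

text \<open>Obtained as the adjoint of \<open>CC_square\<close> for the twisted representation
  \<open>\<rho>\<theta>\<close>, which takes the place of a second Cartan calculus for u.\<close>

lemma CM_square:
  assumes x: "x \<in> VS" shows "CM \<rho> (CM \<rho> x) = 0"
proof (rule HH.h_ext)
  show "CM \<rho> (CM \<rho> x) \<in> VS" using x by (intro VS_CM rho_linrep)
  fix y assume y: "y \<in> VS"
  show "H (CM \<rho> (CM \<rho> x)) y = 0"
    using x y by (simp add: adjoints(3) VS_CM VS_CC rho_linrep rho_theta_linrep CC_square[OF rho_theta_rep] H_zero)
qed

definition Lap where "Lap x = CC \<rho> (CM \<rho>\<theta> x) + CM \<rho>\<theta> (CC \<rho> x)"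

text \<open>The mixed terms vanish, so the Laplacians of \<^term>\<open>CC \<rho>\<close> and of \<^term>\<open>CM \<rho>\<close> agree.\<close>
lemma Lap_eq:
  assumes x: "x \<in> VS"
  shows "Lap x = AA (AM x) + AM (AA x) - (BB (BM x) + BM (BB x))"
    "Lap x = CM \<rho> (CC \<rho>\<theta> x) + CC \<rho>\<theta> (CM \<rho> x)"
proof -
  have a: "AA (BM x) = - BM (AA x)" using AA_BM[OF x] by (simp add: eq_neg_iff_add_eq_0)
  have b: "AM (BB x) = - BB (AM x)" using AM_BB[OF x] by (simp add: eq_neg_iff_add_eq_0)
  show "Lap x = AA (AM x) + AM (AA x) - (BB (BM x) + BM (BB x))"
    unfolding Lap_def CC_split CM_split AA_simps AM_simps BB_simps BM_simps a b by simp
  moreover have "CM \<rho> (CC \<rho>\<theta> x) + CC \<rho>\<theta> (CM \<rho> x) = AA (AM x) + AM (AA x) - (BB (BM x) + BM (BB x))"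
    unfolding CC_split CM_split AA_simps AM_simps BB_simps BM_simps a b by simp
  ultimately show "Lap x = CM \<rho> (CC \<rho>\<theta> x) + CC \<rho>\<theta> (CM \<rho> x)" by simp
qed

section \<open>Local finiteness of the Laplacian\<close>

definition "Q v = (\<Sum>j\<in>P. \<rho> (ub j) (\<rho> (us j) v))"

text \<open>These are the ways in which \<open>Lap\<close> acts on the factor V: through basis
  vectors outside P, through the brackets [us i, ub j] with i, j in P, and through \<open>Q\<close>.
  A single \<open>\<rho> (ub j)\<close> with j in P is not asked to preserve A.\<close>

definition stable where
  "stable A \<longleftrightarrow> (\<forall>i<n. i \<notin> P \<longrightarrow> \<rho> (us i) ` A \<subseteq> A \<and> \<rho> (ub i) ` A \<subseteq> A) \<and>
    (\<forall>i\<in>P. \<forall>j\<in>P. \<rho> (br (us i) (ub j)) ` A \<subseteq> A) \<and> Q ` A \<subseteq> A"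

text \<open>Interchanging the factors produces a commutator on V for every pair i, j, and the
  Clifford relation adds twice \<open>\<rho> (ub i)\<close> after \<open>\<rho> (us i)\<close> when
  i = j. So products of two operators from P survive only in the combination
  \<open>Q\<close>.\<close>

lemma BB_BM:
  assumes x: "x \<in> VS"
  shows "BB (BM x) + BM (BB x) =
    (\<Sum>i\<in>P. \<Sum>j\<in>P. e (ub i) (f (us j) (\<rho> (br (us i) (ub j)) \<circ> x))) + sf 2 (Q \<circ> x)"
proof -
  have t: "e (ub i) (\<rho> (us i) \<circ> f (us j) (\<rho> (ub j) \<circ> x)) + f (us j) (\<rho> (ub j) \<circ> e (ub i) (\<rho> (us i) \<circ> x)) =
     e (ub i) (f (us j) (\<rho> (br (us i) (ub j)) \<circ> x)) + (if i = j then sf 2 (\<rho> (ub i) \<circ> (\<rho> (us i) \<circ> x)) else 0)"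
    if ij: "i \<in> P" "j \<in> P" for i j
  proof -
    have r: "(\<rho> (br (us i) (ub j)) \<circ> x) = (\<rho> (us i) \<circ> (\<rho> (ub j) \<circ> x)) - (\<rho> (ub j) \<circ> (\<rho> (us i) \<circ> x))"
      using rho_rep by (simp add: is_rep_def fun_eq_iff fun_app)
    show ?thesis using ij P_less
      by (auto simp: r comp_f comp_e rho_lin f_e f_simps e_simps dual)
  qed
  have "BB (BM x) + BM (BB x) =
    (\<Sum>i\<in>P. \<Sum>j\<in>P. e (ub i) (\<rho> (us i) \<circ> f (us j) (\<rho> (ub j) \<circ> x)) + f (us j) (\<rho> (ub j) \<circ> e (ub i) (\<rho> (us i) \<circ> x)))"
  proof -
    have 1: "BB (BM x) = (\<Sum>i\<in>P. \<Sum>j\<in>P. e (ub i) (\<rho> (us i) \<circ> f (us j) (\<rho> (ub j) \<circ> x)))"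
      by (simp add: BB_def BM_def comp_simps rho_lin e_simps)
    have "BM (BB x) = (\<Sum>j\<in>P. \<Sum>i\<in>P. f (us j) (\<rho> (ub j) \<circ> e (ub i) (\<rho> (us i) \<circ> x)))"
      by (simp add: BB_def BM_def comp_simps rho_lin f_simps)
    also have "\<dots> = (\<Sum>i\<in>P. \<Sum>j\<in>P. f (us j) (\<rho> (ub j) \<circ> e (ub i) (\<rho> (us i) \<circ> x)))" by (rule sum.swap)
    finally show ?thesis using 1 by (simp add: sum.distrib)
  qed
  also have "\<dots> = (\<Sum>i\<in>P. \<Sum>j\<in>P. e (ub i) (f (us j) (\<rho> (br (us i) (ub j)) \<circ> x)))
      + (\<Sum>i\<in>P. sf 2 (\<rho> (ub i) \<circ> (\<rho> (us i) \<circ> x)))"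
    by (simp add: t sum.distrib finite_P cong: sum.cong)
  also have "(\<Sum>i\<in>P. sf 2 (\<rho> (ub i) \<circ> (\<rho> (us i) \<circ> x))) = sf 2 (Q \<circ> x)"
    unfolding F.scale_sum_right[symmetric]
    by (rule arg_cong[of _ _ "sf 2"]) (simp add: Q_def fun_eq_iff fun_app sum_fun_apply)
  finally show ?thesis .
qed

lemma Q_lin: "linV Q"
proof -
  have "linV (\<lambda>v. \<rho> (ub j) (\<rho> (us j) v))" for j
    using Vector_Spaces.linear_compose[OF rho_lin rho_lin] by (simp add: o_def)
  then interpret l: Vector_Spaces.linear s s "\<lambda>v. \<rho> (ub j) (\<rho> (us j) v)" for j .
  show ?thesis by unfold_locales (simp_all add: Q_def l.add l.scale sum.distrib scale_sum_right)
qed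

text \<open>In the first form of \<open>Lap_eq\<close> the operators \<open>AA\<close> and
  \<open>AM\<close> act on V only by \<open>\<rho>K\<close>, and the anticommutator of
  \<open>BB\<close> and \<open>BM\<close> is given by \<open>BB_BM\<close>; all operators on V that
  occur there preserve A. Single terms such as \<open>BB (BM x)\<close> need not stay in the
  space.\<close>

lemma Lap_Fock:
  assumes A: "subspace A" "stable A" and x: "x \<in> Fock A n"
  shows "Lap x \<in> Fock A n"
proof -
  note sub = Fock_subspace[OF A(1), of n]
  have st: "\<And>i. i < n \<Longrightarrow> i \<notin> P \<Longrightarrow> \<rho> (us i) ` A \<subseteq> A" "\<And>i. i < n \<Longrightarrow> i \<notin> P \<Longrightarrow> \<rho> (ub i) ` A \<subseteq> A"
    "\<And>i j. i \<in> P \<Longrightarrow> j \<in> P \<Longrightarrow> \<rho> (br (us i) (ub j)) ` A \<subseteq> A" "Q ` A \<subseteq> A"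
    using A(2) unfolding stable_def by blast+
  note fk = Fock_eU[OF A(1)] Fock_f[OF A(1) _ order_refl]
  have z0: "((\<lambda>_. 0) \<circ> y) = (0 :: (complex^'n) list \<Rightarrow> 'v)" for y :: "(complex^'n) list \<Rightarrow> 'v"
    by (simp add: fun_eq_iff fun_app)
  have K: "(\<rho>K (us i) \<circ> y) \<in> Fock A n" "(\<rho>K (ub i) \<circ> y) \<in> Fock A n" if "i < n" "y \<in> Fock A n" for i y
  proof -
    show "(\<rho>K (us i) \<circ> y) \<in> Fock A n"
    proof (cases "i \<in> P")
      case True
      then show ?thesis using F.subspace_0[OF sub] z0 by (simp only: rhoK_us[OF that(1)] if_True)
    next
      case False
      then show ?thesis using Fock_comp[OF rho_lin st(1)[OF that(1) False] that(2)]
        by (simp only: rhoK_us[OF that(1)] if_False)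
    qed
    show "(\<rho>K (ub i) \<circ> y) \<in> Fock A n"
    proof (cases "i \<in> P")
      case True
      then show ?thesis using F.subspace_0[OF sub] z0 by (simp only: rhoK_ub[OF that(1)] if_True)
    next
      case False
      then show ?thesis using Fock_comp[OF rho_lin st(2)[OF that(1) False] that(2)]
        by (simp only: rhoK_ub[OF that(1)] if_False)
    qed
  qed
  have AAF: "AA y \<in> Fock A n" if y: "y \<in> Fock A n" for y
    unfolding AA_def CC_def lin_def cub_def
    using y by (intro F.subspace_diff[OF sub] F.subspace_sum[OF sub] F.subspace_scale[OF sub] fk K ub_in) auto
  have AMF: "AM y \<in> Fock A n" if y: "y \<in> Fock A n" for y
    unfolding AM_def CM_def linm_def cubm_def
    using y by (intro F.subspace_diff[OF sub] F.subspace_sum[OF sub] F.subspace_scale[OF sub] fk K ub_in U_br) auto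
  have BF: "BB (BM x) + BM (BB x) \<in> Fock A n"
    unfolding BB_BM[OF Fock_sub_VS[OF x order_refl]]
  proof (intro F.subspace_add[OF sub] F.subspace_sum[OF sub] F.subspace_scale[OF sub] fk)
    show "(Q \<circ> x) \<in> Fock A n" by (rule Fock_comp[OF Q_lin st(4) x])
    show "(\<rho> (br (us i) (ub j)) \<circ> x) \<in> Fock A n" if "i \<in> P" "j \<in> P" for i j
      by (rule Fock_comp[OF rho_lin st(3)[OF that] x])
  qed (use P_less ub_in in auto)
  show ?thesis
    unfolding Lap_eq(1)[OF Fock_sub_VS[OF x order_refl]]
    by (intro F.subspace_diff[OF sub] F.subspace_add[OF sub] AAF AMF x BF)
qed

text \<open>\<open>hodge_decomposition\<close> is applied to C^- and its adjoint. Their Laplacian is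
  \<open>Lap\<close>, which was defined from C, by the second form in \<open>Lap_eq\<close>; this is
  how the kernel of \<Delta> enters statements about C^-.\<close>

theorem hodge:
  assumes fin: "\<And>v. \<exists>A. subspace A \<and> finite_dimensional s A \<and> stable A \<and> v \<in> A"
  shows "kernel_on VS Lap = kernel_on VS (CM \<rho>) \<inter> kernel_on VS (CC \<rho>\<theta>)"
    "direct_sum VS [kernel_on VS Lap, CM \<rho> ` VS, CC \<rho>\<theta> ` VS]"
    "direct_sum (kernel_on VS (CM \<rho>)) [kernel_on VS Lap, CM \<rho> ` VS]"
    "direct_sum (kernel_on VS (CC \<rho>\<theta>)) [kernel_on VS Lap, CC \<rho>\<theta> ` VS]"
proof -
  have join: "\<exists>A''. subspace A'' \<and> finite_dimensional s A'' \<and> stable A'' \<and> A \<subseteq> A'' \<and> A' \<subseteq> A''"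
    if A: "subspace A" "finite_dimensional s A" "stable A" and A': "subspace A'" "finite_dimensional s A'" "stable A'" for A A'
  proof -
    let ?S = "{a + b |a b. a \<in> A \<and> b \<in> A'}"
    have img: "R ` ?S \<subseteq> ?S" if "linV R" "R ` A \<subseteq> A" "R ` A' \<subseteq> A'" for R
    proof -
      interpret R: Vector_Spaces.linear s s R by fact
      show ?thesis using that(2,3) by (auto simp: R.add) blast
    qed
    have "subspace ?S" using subspace_sums[OF A(1) A'(1)] .
    moreover have "stable ?S"
      using A(3) A'(3) img[OF rho_lin] img[OF Q_lin] unfolding stable_def by (intro conjI allI impI ballI) auto
    moreover have "finite_dimensional s ?S"
    proof -
      obtain T T' where T: "finite T" "A \<subseteq> span T" "finite T'" "A' \<subseteq> span T'"
        using A(2) A'(2) unfolding finite_dimensional_def by blast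
      have "?S \<subseteq> span (T \<union> T')"
        using T(2,4) span_mono[of T "T \<union> T'"] span_mono[of T' "T \<union> T'"] by (auto intro!: span_add)
      then show ?thesis using T unfolding finite_dimensional_def by (intro exI[of _ "T \<union> T'"]) auto
    qed
    moreover have "A \<subseteq> ?S" "A' \<subseteq> ?S"
      using subspace_0[OF A(1)] subspace_0[OF A'(1)] by force+
    ultimately show ?thesis by blast
  qed
  have loc: "\<exists>E S. F.subspace E \<and> E \<subseteq> VS \<and> finite S \<and> E \<subseteq> F.span S \<and> Lap ` E \<subseteq> E \<and> x \<in> E" if x: "x \<in> VS" for x
  proof -
    obtain A where A: "subspace A" "finite_dimensional s A" "stable A" "x \<in> Fock A n"
      using Fock_Un[where Q=stable, OF x fin join] by blast
    obtain S where S: "finite S" "Fock A n \<subseteq> F.span S" using Fock_finite_dimensional[OF A(2)] by blast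
    have "Fock A n \<subseteq> VS" using Fock_sub_VS by auto
    moreover have "Lap ` Fock A n \<subseteq> Fock A n" using Lap_Fock[OF A(1,3)] by auto
    ultimately show ?thesis using Fock_subspace[OF A(1)] S A(4) by blast
  qed
  note hd = HH.hodge_decomposition[where D="CM \<rho>" and D'="CC \<rho>\<theta>" and L=Lap,
      OF VS_CM[OF rho_linrep] CM_simps(1)[OF rho_linrep] CM_simps(5)[OF rho_linrep]
        VS_CC[OF rho_theta_linrep] CC_simps(1)[OF rho_theta_linrep] CC_simps(5)[OF rho_theta_linrep]
        adjoints(3) CM_square Lap_eq(2) loc]
  show "kernel_on VS Lap = kernel_on VS (CM \<rho>) \<inter> kernel_on VS (CC \<rho>\<theta>)" by (rule hd(1))
  show "direct_sum VS [kernel_on VS Lap, CM \<rho> ` VS, CC \<rho>\<theta> ` VS]" by (rule hd(2))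
  show "direct_sum (kernel_on VS (CM \<rho>)) [kernel_on VS Lap, CM \<rho> ` VS]" by (rule hd(3))
  show "direct_sum (kernel_on VS (CC \<rho>\<theta>)) [kernel_on VS Lap, CC \<rho>\<theta> ` VS]" by (rule hd(4))
qed

lemma adjoint_on_CC: "x \<in> VS \<Longrightarrow> adjoint_on VS H (CC \<rho>) x = CM \<rho>\<theta> x"
  by (rule HH.adjoint_on_eq) (use adjoints(1) VS_CC VS_CM rho_linrep rho_theta_linrep in auto)

lemma adjoint_on_CM: "x \<in> VS \<Longrightarrow> adjoint_on VS H (CM \<rho>) x = CC \<rho>\<theta> x"
  by (rule HH.adjoint_on_eq) (use adjoints(3) VS_CC VS_CM rho_linrep rho_theta_linrep in auto)

end

section \<open>Finite-dimensional invariant subspaces\<close>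

locale complex_vector_space = vector_space s for s :: "complex \<Rightarrow> 'v::ab_group_add \<Rightarrow> 'v"
begin

lemma finite_dimensional_basis:
  assumes "finite_dimensional s W" "subspace W"
  obtains B where "finite B" "independent B" "span B = W" "card B = dim W"
proof -
  obtain F where F: "finite F" "W \<subseteq> span F" using assms(1) by (auto simp: finite_dimensional_def)
  obtain B where B: "B \<subseteq> W" "independent B" "W \<subseteq> span B" "card B = dim W" by (rule basis_exists)
  have "finite B" using independent_span_bound[OF F(1) B(2)] B(1) F(2) by auto
  moreover have "span B = W" using B(1,3) span_minimal[OF B(1) assms(2)] by auto
  ultimately show ?thesis using that B by blast
qed

lemma dim_less:
  assumes "finite_dimensional s W" "subspace W" "subspace W'" "W' \<subset> W"
  shows "dim W' < dim W"
proof -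
  obtain B where B: "finite B" "independent B" "span B = W" "card B = dim W"
    using finite_dimensional_basis[OF assms(1,2)] by blast
  obtain B' where B': "B' \<subseteq> W'" "independent B'" "W' \<subseteq> span B'" "card B' = dim W'" by (rule basis_exists)
  have sp: "span B' = W'" using B'(1,3) span_minimal[OF B'(1) assms(3)] by auto
  obtain x where x: "x \<in> W" "x \<notin> W'" using assms(4) by auto
  have ind: "independent (insert x B')" using x(2) B'(2) sp by (simp add: independent_insert)
  have "insert x B' \<subseteq> span B" using B(3) B'(1) assms(4) x(1) by auto
  from independent_span_bound[OF B(1) ind this]
  have "finite (insert x B')" "card (insert x B') \<le> card B" by simp_all
  moreover have "x \<notin> B'" using x(2) B'(1) by auto
  ultimately show ?thesis using B(4) B'(4) by simp
qed

lemma finite_dimensional_subset: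
  "finite_dimensional s W \<Longrightarrow> W' \<subseteq> W \<Longrightarrow> finite_dimensional s W'"
  unfolding finite_dimensional_def by blast

lemma finite_dimensional_sums:
  assumes "finite_dimensional s A" "finite_dimensional s A'"
  shows "finite_dimensional s {a + b |a b. a \<in> A \<and> b \<in> A'}"
proof -
  obtain T T' where T: "finite T" "A \<subseteq> span T" "finite T'" "A' \<subseteq> span T'"
    using assms unfolding finite_dimensional_def by blast
  have "{a + b |a b. a \<in> A \<and> b \<in> A'} \<subseteq> span (T \<union> T')"
    using T(2,4) span_mono[of T "T \<union> T'"] span_mono[of T' "T \<union> T'"] by (auto intro!: span_add)
  then show ?thesis using T unfolding finite_dimensional_def by (intro exI[of _ "T \<union> T'"]) auto
qed

end

text \<open>Makes membership in A testable by linear functionals, the form in which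
  differentiability of the group action is given.\<close>

lemma separating_functional:
  fixes s :: "complex \<Rightarrow> 'v::ab_group_add \<Rightarrow> 'v"
  assumes "vector_space s" "module.subspace s A" "x \<notin> A"
  obtains \<phi> where "Vector_Spaces.linear s (*) \<phi>" "\<And>a. a \<in> A \<Longrightarrow> \<phi> a = 0" "\<phi> x = (1 :: complex)"
proof -
  interpret vector_space s by fact
  interpret p: vector_space_pair s "(*) :: complex \<Rightarrow> complex \<Rightarrow> complex"
    by unfold_locales (simp_all add: algebra_simps)
  obtain B where B: "B \<subseteq> A" "independent B" "A \<subseteq> span B" by (rule maximal_independent_subset)
  have sp: "span B = A" using B span_minimal[OF B(1) assms(2)] by auto
  have ind: "independent (insert x B)" using assms(3) B(2) sp by (simp add: independent_insert)
  define \<phi> where "\<phi> = p.construct (insert x B) (\<lambda>y. if y = x then 1 else 0)"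
  have lin: "Vector_Spaces.linear s (*) \<phi>" unfolding \<phi>_def by (rule p.linear_construct[OF ind])
  then interpret L: Vector_Spaces.linear s "(*)" \<phi> .
  have bas: "\<phi> b = (if b = x then 1 else 0)" if "b \<in> insert x B" for b
    unfolding \<phi>_def by (rule p.construct_basis[OF ind that])
  have "\<phi> a = 0" if "a \<in> span B" for a
    using that
  proof (induction rule: span_induct_alt)
    case (step c b y)
    then have "b \<noteq> x" using assms(3) B(1) by auto
    then show ?case using step bas[of b] by (simp add: L.add L.scale)
  qed (simp add: L.zero)
  then show ?thesis using that lin bas[of x] sp by auto
qed

section \<open>Unitary admissible actions of a group\<close>

locale unitary_rep = complex_vector_space s for s :: "complex \<Rightarrow> 'v::ab_group_add \<Rightarrow> 'v" +
  fixes K :: "'a set" and \<pi> :: "'a \<Rightarrow> 'v \<Rightarrow> 'v" and h :: "'v \<Rightarrow> 'v \<Rightarrow> complex"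
  assumes linear_pi: "g \<in> K \<Longrightarrow> Vector_Spaces.linear s s (\<pi> g)"
    and pi_unit: "\<exists>g\<in>K. \<forall>v. \<pi> g v = v"
    and pi_inv: "g \<in> K \<Longrightarrow> \<exists>g'\<in>K. \<forall>v. \<pi> g (\<pi> g' v) = v"
    and pi_prod: "\<lbrakk>g \<in> K; g' \<in> K\<rbrakk> \<Longrightarrow> \<exists>k\<in>K. \<forall>v. \<pi> g (\<pi> g' v) = \<pi> k v"
    and finite_orbit: "finite_dimensional s {\<pi> g v |g. g \<in> K}"
    and h_positive: "positive_hermitian_form s h"
    and h_inv: "g \<in> K \<Longrightarrow> h (\<pi> g v) (\<pi> g w) = h v w"
    and admissible: "admissible K s \<pi>"
begin

abbreviation "stbl \<equiv> stable_subspace K s \<pi>"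

sublocale hV: hermitian_space s UNIV h
  by (rule hermitian_spaceI[OF vector_space_axioms h_positive]) (rule subspace_UNIV)

lemma pi_simps:
  assumes "g \<in> K"
  shows "\<pi> g (x + y) = \<pi> g x + \<pi> g y" "\<pi> g (s c x) = s c (\<pi> g x)" "\<pi> g 0 = 0"
proof -
  interpret Vector_Spaces.linear s s "\<pi> g" by (rule linear_pi[OF assms])
  show "\<pi> g (x + y) = \<pi> g x + \<pi> g y" "\<pi> g (s c x) = s c (\<pi> g x)" "\<pi> g 0 = 0"
    by (simp_all add: add scale zero)
qed

lemma stblD: "stbl W \<Longrightarrow> subspace W" "stbl W \<Longrightarrow> g \<in> K \<Longrightarrow> x \<in> W \<Longrightarrow> \<pi> g x \<in> W"
  by (auto simp: stable_subspace_def)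

lemma stblI: "subspace W \<Longrightarrow> (\<And>g x. g \<in> K \<Longrightarrow> x \<in> W \<Longrightarrow> \<pi> g x \<in> W) \<Longrightarrow> stbl W"
  by (auto simp: stable_subspace_def)

lemma stable_span:
  assumes "\<And>x g. x \<in> S \<Longrightarrow> g \<in> K \<Longrightarrow> \<pi> g x \<in> span S"
  shows "stbl (span S)"
  unfolding stable_subspace_def
proof (intro conjI ballI subsetI)
  fix g y assume g: "g \<in> K" and "y \<in> \<pi> g ` span S"
  then obtain x where x: "x \<in> span S" "y = \<pi> g x" by auto
  from x(1) have "\<pi> g x \<in> span S"
    by (induction rule: span_induct_alt)
      (use g assms in \<open>auto simp: pi_simps span_zero intro!: span_add span_scale\<close>)
  then show "y \<in> span S" using x by simp
qed simp

lemma orbit_span: "stbl (span {\<pi> g v |g. g \<in> K})" "finite_dimensional s (span {\<pi> g v |g. g \<in> K})"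
  "v \<in> span {\<pi> g v |g. g \<in> K}"
proof -
  show "stbl (span {\<pi> g v |g. g \<in> K})"
    by (rule stable_span) (use pi_prod in \<open>fastforce intro: span_base\<close>)
  show "finite_dimensional s (span {\<pi> g v |g. g \<in> K})"
    using finite_orbit[of v] span_minimal[OF _ subspace_span] unfolding finite_dimensional_def by blast
  show "v \<in> span {\<pi> g v |g. g \<in> K}"
    using pi_unit by (auto intro!: span_base) metis
qed

lemma irreducible_exists:
  assumes "stbl F" "finite_dimensional s F" "F \<noteq> {0}"
  obtains W where "irreducible_subspace K s \<pi> W" "W \<subseteq> F"
proof -
  let ?P = "\<lambda>W. stbl W \<and> W \<subseteq> F \<and> W \<noteq> {0}"
  obtain W where W: "?P W" "\<And>W'. ?P W' \<Longrightarrow> dim W \<le> dim W'"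
    using ex_has_least_nat[of ?P F dim] assms by blast
  have "irreducible_subspace K s \<pi> W"
    unfolding irreducible_subspace_def
  proof (intro conjI allI impI)
    fix W' assume W': "stbl W' \<and> W' \<subseteq> W"
    show "W' = {0} \<or> W' = W"
    proof (rule ccontr)
      assume n: "\<not> (W' = {0} \<or> W' = W)"
      have "dim W' < dim W"
        using W(1) W' n finite_dimensional_subset[OF assms(2)]
        by (intro dim_less) (auto simp: stable_subspace_def)
      moreover have "?P W'" using W(1) W' n by blast
      ultimately show False using W(2)[of W'] by simp
    qed
  qed (use W in auto)
  then show ?thesis using that W by blast
qed

context
  fixes T :: "'v \<Rightarrow> 'v"
  assumes T_lin: "Vector_Spaces.linear s s T" and T_pi: "\<And>g v. g \<in> K \<Longrightarrow> T (\<pi> g v) = \<pi> g (T v)"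
begin

interpretation T: Vector_Spaces.linear s s T by (rule T_lin)

text \<open>Schur: an intertwining operator maps a copy of \<open>W\<close> to zero or to another copy.\<close>
lemma isotypic_component_props:
  assumes W: "irreducible_subspace K s \<pi> W"
  defines "M \<equiv> isotypic_component K s \<pi> W"
  shows "stbl M" "T ` M \<subseteq> M" "W \<subseteq> M"
proof -
  let ?S = "\<Union>{W'. stbl W' \<and> equivalent_subspaces K s \<pi> W W'}"
  have M: "M = span ?S" by (simp add: M_def isotypic_component_def)
  have sW: "stbl W" using W by (simp add: irreducible_subspace_def)
  have subW: "subspace W" using sW by (simp add: stable_subspace_def)
  show "stbl M" unfolding M
  proof (rule stable_span)
    fix x g assume "x \<in> ?S" "g \<in> K"
    then have "\<pi> g x \<in> ?S" by (auto simp: stable_subspace_def)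
    then show "\<pi> g x \<in> span ?S" by (rule span_base)
  qed
  have "equivalent_subspaces K s \<pi> W W" unfolding equivalent_subspaces_def
    by (rule exI[of _ "\<lambda>x. x"]) (simp add: bij_betw_def)
  then show "W \<subseteq> M" unfolding M using sW span_superset[of ?S] by blast
  have gen: "T x \<in> span ?S" if "x \<in> ?S" for x
  proof -
    obtain W' f where W': "stbl W'" "x \<in> W'" and f: "bij_betw f W W'"
      "\<And>x y. x \<in> W \<Longrightarrow> y \<in> W \<Longrightarrow> f (x + y) = f x + f y" "\<And>c x. x \<in> W \<Longrightarrow> f (s c x) = s c (f x)"
      "\<And>g x. g \<in> K \<Longrightarrow> x \<in> W \<Longrightarrow> f (\<pi> g x) = \<pi> g (f x)"
      using \<open>x \<in> ?S\<close> unfolding equivalent_subspaces_def by blast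
    let ?N = "{w \<in> W. T (f w) = 0}"
    have f0: "f 0 = 0" using f(3)[of 0 0] subspace_0[OF subW] by simp
    have subN: "subspace ?N"
      unfolding subspace_def using subspace_0[OF subW] subspace_add[OF subW] subspace_scale[OF subW]
      by (auto simp: f0 T.zero f T.add T.scale)
    have "stbl ?N"
      by (rule stblI[OF subN]) (auto simp: f(4) stblD[OF sW] T_pi pi_simps)
    then have "?N = {0} \<or> ?N = W"
      using W unfolding irreducible_subspace_def by blast
    then show ?thesis
    proof
      assume "?N = W"
      moreover obtain w where "w \<in> W" "x = f w" using f(1) W'(2) by (auto simp: bij_betw_def)
      ultimately have "T x = 0" by auto
      then show ?thesis by (simp add: span_zero)
    next
      assume N: "?N = {0}"
      have "inj_on (\<lambda>w. T (f w)) W"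
      proof (rule inj_onI)
        fix a b assume ab: "a \<in> W" "b \<in> W" "T (f a) = T (f b)"
        have mb: "s (-1) b \<in> W" using subspace_scale[OF subW ab(2)] .
        have "f (a + s (-1) b) = f a - f b" using f(2)[OF ab(1) mb] f(3)[OF ab(2), of "-1"] by simp
        then have "T (f (a + s (-1) b)) = 0" using ab(3) by (simp add: T.diff)
        then have "a + s (-1) b \<in> ?N" using subspace_add[OF subW ab(1) mb] by simp
        then have "a + s (-1) b = 0" using N by blast
        then show "a = b" by simp
      qed
      moreover have "(\<lambda>w. T (f w)) ` W = T ` W'" using f(1) by (auto simp: bij_betw_def)
      ultimately have bij: "bij_betw (\<lambda>w. T (f w)) W (T ` W')" by (simp add: bij_betw_def)
      have "equivalent_subspaces K s \<pi> W (T ` W')"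
        unfolding equivalent_subspaces_def
        by (rule exI[of _ "\<lambda>w. T (f w)"]) (use bij f in \<open>simp add: T.add T.scale T_pi\<close>)
      moreover have "stbl (T ` W')"
        unfolding stable_subspace_def
      proof (intro conjI ballI)
        have "subspace W'" using W'(1) by (simp add: stable_subspace_def)
        then show "subspace (T ` W')" by (rule T.subspace_image)
        show "\<pi> g ` T ` W' \<subseteq> T ` W'" if "g \<in> K" for g
          using stblD(2)[OF W'(1) that] that by (auto simp: T_pi[symmetric])
      qed
      ultimately have "T x \<in> ?S" using W'(2) by blast
      then show ?thesis by (rule span_base)
    qed
  qed
  show "T ` M \<subseteq> M" unfolding M
  proof
    fix y assume "y \<in> T ` span ?S"
    then obtain x where x: "x \<in> span ?S" "y = T x" by auto
    from x(1) have "T x \<in> span ?S"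
      by (induction rule: span_induct_alt)
        (use gen in \<open>auto simp: T.add T.scale T.zero span_zero simp del: Union_iff intro!: span_add span_scale\<close>)
    then show "y \<in> span ?S" using x by simp
  qed
qed

lemma stable_sums:
  assumes "stbl A" "stbl A'" shows "stbl {a + b |a b. a \<in> A \<and> b \<in> A'}"
  unfolding stable_subspace_def
proof (intro conjI ballI)
  show "subspace {a + b |a b. a \<in> A \<and> b \<in> A'}"
    using assms by (intro subspace_sums) (auto simp: stable_subspace_def)
  show "\<pi> g ` {a + b |a b. a \<in> A \<and> b \<in> A'} \<subseteq> {a + b |a b. a \<in> A \<and> b \<in> A'}" if g: "g \<in> K" for g
  proof
    fix y assume "y \<in> \<pi> g ` {a + b |a b. a \<in> A \<and> b \<in> A'}"
    then obtain a b where ab: "a \<in> A" "b \<in> A'" "y = \<pi> g a + \<pi> g b" using g by (auto simp: pi_simps)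
    moreover have "\<pi> g a \<in> A" "\<pi> g b \<in> A'" using assms ab g unfolding stable_subspace_def by blast+
    ultimately show "y \<in> {a + b |a b. a \<in> A \<and> b \<in> A'}" by blast
  qed
qed

text \<open>Adding T F, T (T F), ... to F need not end in a finite-dimensional space, so isotypic
  components are used: an irreducible W \<subseteq> F is enlarged to its component, which T
  preserves and admissibility makes finite-dimensional, and the orthogonal complement of W in F has
  smaller dimension than F.\<close>

lemma invariant_finite_dimensional:
  assumes "stbl F" "finite_dimensional s F"
  shows "\<exists>A. stbl A \<and> finite_dimensional s A \<and> T ` A \<subseteq> A \<and> F \<subseteq> A"
  using assms
proof (induction "dim F" arbitrary: F rule: less_induct)
  case less
  have subF: "subspace F" using less.prems by (simp add: stable_subspace_def)
  show ?case
  proof (cases "F = {0}")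
    case True
    then show ?thesis using less.prems by (intro exI[of _ F]) (simp add: T.zero)
  next
    case False
    obtain W where W: "irreducible_subspace K s \<pi> W" "W \<subseteq> F"
      using irreducible_exists[OF less.prems False] by blast
    have sW: "stbl W" "W \<noteq> {0}" using W by (auto simp: irreducible_subspace_def)
    have subW: "subspace W" using sW by (simp add: stable_subspace_def)
    \<comment> \<open>Invariance of h makes this orthogonal complement stable, so the induction
      hypothesis applies to it.\<close>
    define F' where "F' = {x \<in> F. \<forall>w\<in>W. h x w = 0}"
    have subF': "subspace F'"
      unfolding F'_def subspace_def using subspace_0[OF subF] subspace_add[OF subF] subspace_scale[OF subF]
      by (auto simp: hV.h_add hV.h_scale)
    have sF': "stbl F'"
      unfolding stable_subspace_def
    proof (intro conjI ballI subF' subsetI)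
      fix g y assume g: "g \<in> K" and "y \<in> \<pi> g ` F'"
      then obtain x where x: "x \<in> F'" "y = \<pi> g x" by auto
      have "y \<in> F" using less.prems(1) x g unfolding F'_def stable_subspace_def by blast
      moreover have "h y w = 0" if w: "w \<in> W" for w
      proof -
        obtain g' where g': "g' \<in> K" "\<And>v. \<pi> g (\<pi> g' v) = v" using pi_inv[OF g] by blast
        have "h y w = h (\<pi> g x) (\<pi> g (\<pi> g' w))" using x g' by simp
        also have "\<dots> = h x (\<pi> g' w)" by (rule h_inv[OF g])
        also have "\<pi> g' w \<in> W" using sW(1) g'(1) w unfolding stable_subspace_def by blast
        then have "h x (\<pi> g' w) = 0" using x by (simp add: F'_def)
        finally show ?thesis .
      qed
      ultimately show "y \<in> F'" by (simp add: F'_def)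
    qed
    obtain w where w: "w \<in> W" "w \<noteq> 0" using sW(2) subspace_0[OF subW] by blast
    have "w \<notin> F'" using w hV.h_self_zero[of w] by (auto simp: F'_def)
    then have "F' \<subset> F" using w W by (auto simp: F'_def)
    then have "dim F' < dim F" using dim_less[OF less.prems(2) subF subF'] by blast
    moreover have fF': "finite_dimensional s F'"
      using finite_dimensional_subset[OF less.prems(2)] by (auto simp: F'_def)
    ultimately obtain A where A: "stbl A" "finite_dimensional s A" "T ` A \<subseteq> A" "F' \<subseteq> A"
      using less.hyps[OF _ sF'] by blast
    define M where "M = isotypic_component K s \<pi> W"
    have fW: "finite_dimensional s W" using finite_dimensional_subset[OF less.prems(2) W(2)] .
    \<comment> \<open>Admissibility enters here: W is irreducible and, as a subspace of F,
      finite-dimensional.\<close>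
    have M: "stbl M" "T ` M \<subseteq> M" "W \<subseteq> M" "finite_dimensional s M"
      using isotypic_component_props[OF W(1)] admissible fW W(1) unfolding M_def admissible_def by auto
    have FW: "F \<subseteq> {a + b |a b. a \<in> M \<and> b \<in> A}"
    proof
      fix x assume x: "x \<in> F"
      obtain B where B: "finite B" "independent B" "span B = W"
        using finite_dimensional_basis[OF fW subW] by blast
      obtain p where p: "p \<in> span B" "\<And>z. z \<in> span B \<Longrightarrow> h (x - p) z = 0"
        using hV.projection_onto_span[OF B(1), of x] by auto
      have "x - p \<in> F'" using p B(3) x W(2) subspace_diff[OF subF] by (auto simp: F'_def)
      then have "p \<in> M" "x - p \<in> A" using p(1) B(3) M(3) A(4) by auto
      moreover have "x = p + (x - p)" by simp
      ultimately show "x \<in> {a + b |a b. a \<in> M \<and> b \<in> A}" by blast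
    qed
    have "T ` {a + b |a b. a \<in> M \<and> b \<in> A} \<subseteq> {a + b |a b. a \<in> M \<and> b \<in> A}"
    proof
      fix y assume "y \<in> T ` {a + b |a b. a \<in> M \<and> b \<in> A}"
      then obtain a b where "a \<in> M" "b \<in> A" "y = T a + T b" by (auto simp: T.add)
      then show "y \<in> {a + b |a b. a \<in> M \<and> b \<in> A}" using M(2) A(3) by blast
    qed
    then show ?thesis
      using stable_sums[OF M(1) A(1)] finite_dimensional_sums[OF M(4) A(2)] FW by blast
  qed
qed

lemma vector_in_invariant_finite_dimensional:
  "\<exists>A. stbl A \<and> finite_dimensional s A \<and> T ` A \<subseteq> A \<and> v \<in> A"
  using invariant_finite_dimensional[OF orbit_span(1,2)[of v]] orbit_span(3)[of v] by blast

end

end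

section \<open>The action of k as the derivative of the action of K\<close>

context gK_module
begin

abbreviation "KG \<equiv> fixed_group G \<Theta>"

lemma KG_carrier: "g \<in> KG \<Longrightarrow> g \<in> carrier G" by (simp add: fixed_group_def)

lemma KG_group: "\<one> \<in> KG" "g \<in> KG \<Longrightarrow> inv g \<in> KG" "g \<in> KG \<Longrightarrow> g' \<in> KG \<Longrightarrow> g \<otimes> g' \<in> KG"
proof -
  interpret hom: group_hom G G \<Theta> using Theta_hom by unfold_locales
  show "\<one> \<in> KG" "g \<in> KG \<Longrightarrow> inv g \<in> KG" "g \<in> KG \<Longrightarrow> g' \<in> KG \<Longrightarrow> g \<otimes> g' \<in> KG"
    by (auto simp: fixed_group_def)
qed

lemma unitary_repI:
  assumes h: "unitary_form KG s \<rho> \<pi> h" and a: "admissible KG s \<pi>"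
  shows "unitary_rep s KG \<pi> h"
proof (intro unitary_rep.intro complex_vector_space.intro unitary_rep_axioms.intro)
  show "vector_space s" by (rule vector_space)
  show "\<exists>g\<in>KG. \<forall>v. \<pi> g v = v" using KG_group(1) pi_one by blast
  show "\<exists>g'\<in>KG. \<forall>v. \<pi> g (\<pi> g' v) = v" if "g \<in> KG" for g
    using KG_group(2)[OF that] pi_mult[OF that KG_group(2)[OF that], symmetric] KG_carrier[OF that] pi_one
    by (intro bexI[of _ "inv g"]) auto
  show "\<exists>k\<in>KG. \<forall>v. \<pi> g (\<pi> g' v) = \<pi> k v" if "g \<in> KG" "g' \<in> KG" for g g'
    using pi_mult[OF that] KG_group(3)[OF that] by (intro bexI[of _ "g \<otimes> g'"]) simp_all
qed (use h a in \<open>auto simp: unitary_form_def pi_linear K_finite\<close>)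

lemma expo_in_KG: "\<theta> X = X \<Longrightarrow> expo G (t *\<^sub>R X) \<in> KG"
  using exp_closed[of "t *\<^sub>R X"] Theta_differential[of "t *\<^sub>R X"] theta_linear
  by (simp add: fixed_group_def linear_scale)

text \<open>If \<rho>(X) v were outside A for a real X fixed by \<theta>, some functional would
  vanish on A but not at \<rho>(X) v; yet it is zero along \<pi>(exp tX) v, so its derivative at t =
  0 is zero. General elements of k are complex combinations of such X.\<close>

lemma stable_rho:
  assumes A: "stable_subspace KG s \<pi> A" and Z: "Z \<in> k_part \<theta>" and v: "v \<in> A"
  shows "\<rho> Z v \<in> A"
proof -
  interpret vector_space s by (rule vector_space)
  have sub: "subspace A" using A by (simp add: stable_subspace_def)
  have real: "\<rho> (cvec X) v \<in> A" if X: "\<theta> X = X" for X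
  proof (rule ccontr)
    assume "\<rho> (cvec X) v \<notin> A"
    then obtain \<phi> where \<phi>: "Vector_Spaces.linear s (*) \<phi>" "\<And>a. a \<in> A \<Longrightarrow> \<phi> a = 0" "\<phi> (\<rho> (cvec X) v) = 1"
      using separating_functional[OF vector_space sub] by blast
    have "\<phi> (\<pi> (expo G (t *\<^sub>R X)) v) = 0" for t
      using A expo_in_KG[OF X, of t] v unfolding stable_subspace_def by (intro \<phi>(2)) blast
    then have "((\<lambda>t. 0) has_vector_derivative (1 :: complex)) (at (0 :: real))"
      using pi_differential[OF \<phi>(1) X, of v] \<phi>(3) by simp
    moreover have "((\<lambda>t. 0) has_vector_derivative (0 :: complex)) (at (0 :: real))" by simp
    ultimately have "(1 :: complex) = 0" by (rule vector_derivative_unique_at)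
    then show False by simp
  qed
  have "complexify \<theta> Z = Z" using Z by (simp add: k_part_def)
  then have "\<theta> (re_vec Z) = re_vec Z" "\<theta> (im_vec Z) = im_vec Z"
    using re_im_complexify[of \<theta> Z] by simp_all
  then have "\<rho> (cvec (re_vec Z)) v \<in> A" "\<rho> (cvec (im_vec Z)) v \<in> A" using real by blast+
  moreover have "\<rho> Z v = \<rho> (cvec (re_vec Z)) v + s \<i> (\<rho> (cvec (im_vec Z)) v)"
  proof -
    interpret l: Vector_Spaces.linear "(*s)" s "\<lambda>Z. \<rho> Z v" by (rule rho_linear_left)
    have "\<rho> Z v = \<rho> (cvec (re_vec Z) + \<i> *s cvec (im_vec Z)) v" using cvec_decomp[of Z] by simp
    then show ?thesis by (simp only: l.add l.scale)
  qed
  ultimately show ?thesis using subspace_add[OF sub] subspace_scale[OF sub] by simp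
qed

end

section \<open>Change of basis and invariant tensors\<close>

context spin_space
begin

lemma bilinear_sum_left:
  assumes "\<And>X X' Y. X \<in> U \<Longrightarrow> X' \<in> U \<Longrightarrow> Y \<in> Ub \<Longrightarrow> \<Phi> (X + X') Y = \<Phi> X Y + \<Phi> X' Y"
    "\<And>c X Y. X \<in> U \<Longrightarrow> Y \<in> Ub \<Longrightarrow> \<Phi> (c *s X) Y = sf c (\<Phi> X Y)"
    and "\<And>i. i \<in> I \<Longrightarrow> X i \<in> U" "Y \<in> Ub"
  shows "\<Phi> (\<Sum>i\<in>I. c i *s X i) Y = (\<Sum>i\<in>I. sf (c i) (\<Phi> (X i) Y))"
proof -
  have z: "\<Phi> 0 Y = 0" using assms(2)[of 0 Y 0] assms(4) by (simp add: vec.span_zero)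
  show ?thesis using assms(3)
  proof (induction I rule: infinite_finite_induct)
    case (insert i I)
    then have "c i *s X i \<in> U" "(\<Sum>i\<in>I. c i *s X i) \<in> U"
      by (auto intro!: vec.span_scale vec.span_sum)
    then show ?case using insert assms(1,2,4) by simp
  qed (simp_all add: z)
qed

lemma bilinear_sum_right:
  assumes "\<And>X Y Y'. X \<in> U \<Longrightarrow> Y \<in> Ub \<Longrightarrow> Y' \<in> Ub \<Longrightarrow> \<Phi> X (Y + Y') = \<Phi> X Y + \<Phi> X Y'"
    "\<And>c X Y. X \<in> U \<Longrightarrow> Y \<in> Ub \<Longrightarrow> \<Phi> X (c *s Y) = sf c (\<Phi> X Y)"
    and "\<And>i. i \<in> I \<Longrightarrow> Y i \<in> Ub" "X \<in> U"
  shows "\<Phi> X (\<Sum>i\<in>I. c i *s Y i) = (\<Sum>i\<in>I. sf (c i) (\<Phi> X (Y i)))"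
proof -
  have z: "\<Phi> X 0 = 0" using assms(2)[of X 0 0] assms(4) by (simp add: vec.span_zero)
  show ?thesis using assms(3)
  proof (induction I rule: infinite_finite_induct)
    case (insert i I)
    then have "c i *s Y i \<in> Ub" "(\<Sum>i\<in>I. c i *s Y i) \<in> Ub"
      by (auto intro!: vec.span_scale vec.span_sum)
    then show ?case using insert assms(1,2,4) by simp
  qed (simp_all add: z)
qed

text \<open>The sum of \<open>ub i\<close> \<otimes> \<open>us i\<close> is the canonical tensor of
  the pairing B and does not depend on the dual bases. Bilinearity is asked on \<open>U\<close>
  \<times> \<open>Ub\<close> only, since \<open>e X x\<close> is known to stay in \<open>VS\<close>
  just for X in \<open>U\<close>.\<close>

lemma dual_basis_change:
  assumes \<Phi>: "\<And>X X' Y. X \<in> U \<Longrightarrow> X' \<in> U \<Longrightarrow> Y \<in> Ub \<Longrightarrow> \<Phi> (X + X') Y = \<Phi> X Y + \<Phi> X' Y"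
    "\<And>c X Y. X \<in> U \<Longrightarrow> Y \<in> Ub \<Longrightarrow> \<Phi> (c *s X) Y = sf c (\<Phi> X Y)"
    "\<And>X Y Y'. X \<in> U \<Longrightarrow> Y \<in> Ub \<Longrightarrow> Y' \<in> Ub \<Longrightarrow> \<Phi> X (Y + Y') = \<Phi> X Y + \<Phi> X Y'"
    "\<And>c X Y. X \<in> U \<Longrightarrow> Y \<in> Ub \<Longrightarrow> \<Phi> X (c *s Y) = sf c (\<Phi> X Y)"
    and other: "spin_space s B n' ub' us'"
    and U': "vec.span (ub' ` {..<n'}) = U" and Ub': "vec.span (us' ` {..<n'}) = Ub"
  shows "(\<Sum>i<n'. \<Phi> (ub' i) (us' i)) = (\<Sum>i<n. \<Phi> (ub i) (us i))"
proof -
  interpret o: spin_space s B n' ub' us' by (rule other)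
  have "(\<Sum>i<n'. \<Phi> (ub' i) (us' i)) = (\<Sum>i<n'. \<Sum>k<n. sf (B (us k) (ub' i)) (\<Phi> (ub k) (us' i)))"
  proof (rule sum.cong[OF refl])
    fix i assume i: "i \<in> {..<n'}"
    have u: "ub' i \<in> U" using o.ub_in i U' by auto
    have "\<Phi> (\<Sum>k<n. B (us k) (ub' i) *s ub k) (us' i) = (\<Sum>k<n. sf (B (us k) (ub' i)) (\<Phi> (ub k) (us' i)))"
      using \<Phi>(1,2) ub_in o.us_in i Ub' by (intro bilinear_sum_left) auto
    then show "\<Phi> (ub' i) (us' i) = (\<Sum>k<n. sf (B (us k) (ub' i)) (\<Phi> (ub k) (us' i)))"
      by (simp add: expand_U[OF u])
  qed
  also have "\<dots> = (\<Sum>k<n. \<Sum>i<n'. sf (B (us k) (ub' i)) (\<Phi> (ub k) (us' i)))" by (rule sum.swap)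
  also have "\<dots> = (\<Sum>k<n. \<Phi> (ub k) (us k))"
  proof (rule sum.cong[OF refl])
    fix k assume k: "k \<in> {..<n}"
    have u: "us k \<in> vec.span (us' ` {..<n'})" using us_in k Ub' by auto
    have "\<Phi> (ub k) (\<Sum>i<n'. B (us k) (ub' i) *s us' i) = (\<Sum>i<n'. sf (B (us k) (ub' i)) (\<Phi> (ub k) (us' i)))"
      using \<Phi>(3,4) ub_in o.us_in k Ub' by (intro bilinear_sum_right) auto
    then show "(\<Sum>i<n'. sf (B (us k) (ub' i)) (\<Phi> (ub k) (us' i))) = \<Phi> (ub k) (us k)"
      by (simp add: o.expand_Ub[OF u])
  qed
  finally show ?thesis .
qed

text \<open>Suited to the form \<open>H\<close>, whose values are prescribed on decomposable
  tensors.\<close>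

lemma VS_decomposable_induct [consumes 1, case_names decomposable add]:
  assumes "x \<in> VS"
    and d: "\<And>v Ys. set Ys \<subseteq> U \<Longrightarrow> P (decomposable s B v Ys)"
    and a: "\<And>x y. x \<in> VS \<Longrightarrow> y \<in> VS \<Longrightarrow> P x \<Longrightarrow> P y \<Longrightarrow> P (x + y)"
  shows "P x"
proof -
  have "x \<in> VS \<and> P x"
    using assms(1) unfolding V_tensor_S_def
  proof (induction rule: F.span_induct_alt)
    case base
    have "vac 0 = 0" by (simp add: decomposable_def fun_eq_iff fun_app)
    then show ?case using d[of "[]" 0] VS_vac[of 0] by (simp add: V_tensor_S_def)
  next
    case (step c x y)
    have "sf c x \<in> VS \<and> P (sf c x)"
    proof -
      obtain v Ys where x: "x = decomposable s B v Ys" "set Ys \<subseteq> U" using step by auto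
      have "decomposable s B (s c v) Ys \<in> VS"
        unfolding V_tensor_S_def by (rule F.span_base) (use x(2) in blast)
      then show ?thesis using d[OF x(2)] x by (simp add: decomposable_scale)
    qed
    then show ?case using step a[of "sf c x" y] VS_closed(2)[of "sf c x" y] by (simp add: V_tensor_S_def)
  qed
  then show ?thesis ..
qed

lemma decomposable_VS: "set Ys \<subseteq> U \<Longrightarrow> decomposable s B v Ys \<in> VS"
  unfolding V_tensor_S_def by (rule F.span_base) blast

end

section \<open>Independence of C and C^- from the dual bases\<close>

context lie_group
begin

lemma spin_spaceI:
  assumes "vector_space s" "\<And>i j. i < n \<Longrightarrow> j < n \<Longrightarrow> BK (us i) (ub j) = (if i = j then 1 else 0)"
  shows "spin_space s BK n ub us"
  by (intro spin_space.intro spin_space_axioms.intro assms kill_simps)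

text \<open>The theorem allows arbitrary dual bases, while the argument works in an adapted one.
  Every sum inserts the canonical tensor into a bilinear expression; the double sums are changed one
  index at a time, through sums mixing both bases.\<close>

lemma C_op_basis_change:
  assumes a: "spin_space s BK n ub us" and b: "spin_space s BK n' ub' us'"
    and U: "vec.span (ub' ` {..<n'}) = vec.span (ub ` {..<n})"
    and Ub: "vec.span (us' ` {..<n'}) = vec.span (us ` {..<n})"
    and R: "\<And>v. Vector_Spaces.linear (*s) s (\<lambda>Z. R Z v)" "\<And>Z. Vector_Spaces.linear s s (R Z)"
    and x: "x \<in> V_tensor_S s BK (vec.span (ub ` {..<n}))"
    and Ubr: "\<And>X Y. X \<in> vec.span (ub ` {..<n}) \<Longrightarrow> Y \<in> vec.span (ub ` {..<n}) \<Longrightarrow> br X Y \<in> vec.span (ub ` {..<n})"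
  shows "C_op G s R n' ub' us' x = C_op G s R n ub us x"
    "C_minus G s R n' ub' us' x = C_minus G s R n ub us x"
proof -
  interpret a: spin_space s BK n ub us by (rule a)
  interpret b: spin_space s BK n' ub' us' by (rule b)
  interpret L: Vector_Spaces.linear "(*s)" s "\<lambda>Z. R Z v" for v by (rule R(1))
  note change = a.dual_basis_change[OF _ _ _ _ b U Ub]
  have Rl: "(R (X + Y) \<circ> x) = (R X \<circ> x) + (R Y \<circ> x)" "(R (c *s X) \<circ> x) = a.sf c (R X \<circ> x)"
    for X Y c and x :: "(complex^'n) list \<Rightarrow> 'b"
    by (simp_all add: fun_eq_iff fun_app L.add L.scale scale_fun_def)
  have Vc: "(R X \<circ> x) \<in> a.VS" for X using a.VS_comp[OF x R(2)] .
  have 1: "(\<Sum>i<n'. cl_u s BK (ub' i) (R (us' i) \<circ> x)) = (\<Sum>i<n. cl_u s BK (ub i) (R (us i) \<circ> x))"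
    by (rule change[where \<Phi>="\<lambda>X Y. cl_u s BK X (R Y \<circ> x)"]) (simp_all add: a.e_lin Rl a.e_simps)
  have 2: "(\<Sum>i<n'. cl_ubar s (us' i) (R (ub' i) \<circ> x)) = (\<Sum>i<n. cl_ubar s (us i) (R (ub i) \<circ> x))"
    by (rule change[where \<Phi>="\<lambda>X Y. cl_ubar s Y (R X \<circ> x)"]) (simp_all add: a.f_lin Vc Rl a.f_simps)
  have 3: "(\<Sum>j<n'. cl_ubar s (br W (us' j)) (cl_u s BK Z (cl_u s BK (ub' j) x))) =
      (\<Sum>j<n. cl_ubar s (br W (us j)) (cl_u s BK Z (cl_u s BK (ub j) x)))" if "Z \<in> a.U" for W Z
    by (rule change[where \<Phi>="\<lambda>X Y. cl_ubar s (br W Y) (cl_u s BK Z (cl_u s BK X x))"])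
      (use that in \<open>simp_all add: a.f_lin a.VS_e x a.e_lin a.e_simps a.f_simps br_simps\<close>)
  have 4: "(\<Sum>i<n'. \<Sum>j<n. cl_ubar s (br (us' i) (us j)) (cl_u s BK (ub' i) (cl_u s BK (ub j) x))) =
      (\<Sum>i<n. \<Sum>j<n. cl_ubar s (br (us i) (us j)) (cl_u s BK (ub i) (cl_u s BK (ub j) x)))"
    by (rule change[where \<Phi>="\<lambda>X Y. \<Sum>j<n. cl_ubar s (br Y (us j)) (cl_u s BK X (cl_u s BK (ub j) x))"])
      (simp_all add: a.f_lin a.VS_e x a.e_lin a.e_simps a.f_simps br_simps sum.distrib a.F.scale_sum_right a.ub_in)
  have 5: "(\<Sum>j<n'. cl_u s BK (br W (ub' j)) (cl_ubar s Z (cl_ubar s (us' j) x))) =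
      (\<Sum>j<n. cl_u s BK (br W (ub j)) (cl_ubar s Z (cl_ubar s (us j) x)))" for W Z
    by (rule change[where \<Phi>="\<lambda>X Y. cl_u s BK (br W X) (cl_ubar s Z (cl_ubar s Y x))"])
      (simp_all add: a.f_lin a.VS_f x a.e_lin a.e_simps a.f_simps br_simps)
  have 6: "(\<Sum>i<n'. \<Sum>j<n. cl_u s BK (br (ub' i) (ub j)) (cl_ubar s (us' i) (cl_ubar s (us j) x))) =
      (\<Sum>i<n. \<Sum>j<n. cl_u s BK (br (ub i) (ub j)) (cl_ubar s (us i) (cl_ubar s (us j) x)))"
    by (rule change[where \<Phi>="\<lambda>X Y. \<Sum>j<n. cl_u s BK (br X (ub j)) (cl_ubar s Y (cl_ubar s (us j) x))"])
      (simp_all add: a.f_lin a.VS_f x a.e_lin a.e_simps a.f_simps br_simps sum.distrib a.F.scale_sum_right)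
  have ub': "ub' i \<in> a.U" if "i < n'" for i using b.ub_in[OF that] U by simp
  have 7: "(\<Sum>i<n'. \<Sum>j<n'. cl_ubar s (br (us' i) (us' j)) (cl_u s BK (ub' i) (cl_u s BK (ub' j) x))) =
      (\<Sum>i<n'. \<Sum>j<n. cl_ubar s (br (us' i) (us j)) (cl_u s BK (ub' i) (cl_u s BK (ub j) x)))"
    by (intro sum.cong refl 3 ub') simp
  show "C_op G s R n' ub' us' x = C_op G s R n ub us x"
    unfolding C_op_def 1 7 4 ..
  show "C_minus G s R n' ub' us' x = C_minus G s R n ub us x"
    unfolding C_minus_def 2 5 6 ..
qed

end

text \<open>ad X maps each step of the lower central series of u into the next, so its composite
  with a projection onto u has trace zero. The dual bases provide the projection \<open>P\<close>,
  and \<open>tr_rank_one\<close> evaluates the trace of the composite as the stated sum.\<close>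

lemma (in lie_group) nilpotent_trace:
  assumes sp: "spin_space s BK n ub us" and u: "u = vec.span (ub ` {..<n})"
    and closed: "\<And>X Y. X \<in> u \<Longrightarrow> Y \<in> u \<Longrightarrow> br X Y \<in> u" and nil: "lie_nilpotent br u" and X: "X \<in> u"
  shows "(\<Sum>j<n. BK (us j) (br X (ub j))) = 0"
proof -
  interpret spin_space s BK n ub us by (rule sp)
  obtain m where m: "((\<lambda>d. bracket_span br u d) ^^ m) u = {0}"
    using nil unfolding lie_nilpotent_def by blast
  define W where "W k = ((\<lambda>d. bracket_span br u d) ^^ k) u" for k
  have su: "vec.subspace u" by (simp add: u)
  have it: "vec.subspace (W k)" "W (Suc k) \<subseteq> W k" for k
    unfolding W_def by (rule bracket_span_iterate; use closed su in blast)+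
  have it3: "br X Y \<in> W (Suc k)" if "Y \<in> W k" for Y k
    unfolding W_def by (rule bracket_span_iterate(3)[OF _ su X]) (use closed that in \<open>auto simp: W_def\<close>)
  define P where "P x = (\<Sum>j<n. BK (us j) x *s ub j)" for x
  have P: "lin_op P" by (rule lin_opI) (simp_all add: P_def kill_simps vec.scale_left_distrib sum.distrib vec.scale_sum_right)
  have Pu: "P x \<in> W 0" for x using ub_in unfolding W_def P_def u by (auto intro!: vec.span_sum vec.span_scale)
  have Pid: "P x = x" if "x \<in> W 0" for x using that expand_U[of x] by (simp add: W_def u P_def)
  have Wm: "W m = {0}" using m by (simp add: W_def)
  have "tr (\<lambda>x. br X (P x)) = 0"
    by (rule tr_zero_of_flag[OF it(1,2) Wm lin_op_br(1) it3 P Pu Pid])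
  moreover have "br X (P x) = (\<Sum>j<n. BK (us j) x *s br X (ub j))" for x
  proof -
    interpret r: Vector_Spaces.linear "(*s)" "(*s)" "br X" by (rule lin_op_br)
    show ?thesis by (simp add: P_def r.sum r.scale)
  qed
  moreover have "tr (\<lambda>x. \<Sum>j<n. BK (us j) x *s br X (ub j)) = (\<Sum>j<n. BK (us j) (br X (ub j)))"
    unfolding tr_sum by (intro sum.cong refl tr_rank_one) (simp_all add: kill_simps)
  ultimately show ?thesis by simp
qed


context gK_module
begin

text \<open>The operator comes from an invariant tensor in \<open>pp \<otimes> pm\<close>.\<close>
lemma invariant_operator_commutes:
  fixes P :: "nat set" and ub us :: "nat \<Rightarrow> complex^'n"
  assumes g: "g \<in> KG" and fin: "finite P"
    and us: "\<And>j. j \<in> P \<Longrightarrow> us j \<in> pm" and ub: "\<And>j. j \<in> P \<Longrightarrow> ub j \<in> pp"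
    and exp_p: "\<And>X. X \<in> pp \<Longrightarrow> X = (\<Sum>k\<in>P. BK (us k) X *s ub k)"
    and exp_m: "\<And>X. X \<in> pm \<Longrightarrow> X = (\<Sum>k\<in>P. BK X (ub k) *s us k)"
    and Ad_p: "\<And>g. g \<in> KG \<Longrightarrow> Ad G g ` pp \<subseteq> pp" and Ad_m: "\<And>g. g \<in> KG \<Longrightarrow> Ad G g ` pm \<subseteq> pm"
  shows "(\<Sum>j\<in>P. \<rho> (ub j) (\<rho> (us j) (\<pi> g v))) = \<pi> g (\<Sum>j\<in>P. \<rho> (ub j) (\<rho> (us j) v))"
proof -
  interpret vector_space s by (rule vector_space)
  interpret pg: Vector_Spaces.linear s s "\<pi> g" by (rule pi_linear[OF g])
  interpret L: Vector_Spaces.linear "(*s)" s "\<lambda>Z. \<rho> Z x" for x by (rule rho_linear_left)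
  interpret R: Vector_Spaces.linear s s "\<rho> Z" for Z by (rule rho_linear_right)
  have gc: "g \<in> carrier G" using g KG_carrier by blast
  note A = Ad_simps[OF gc]
  interpret A: Vector_Spaces.linear "(*s)" "(*s)" "Ad G g" by (rule A(1))
  define w where "w = \<pi> g v"
  have "\<pi> g (\<Sum>j\<in>P. \<rho> (ub j) (\<rho> (us j) v)) = (\<Sum>j\<in>P. \<rho> (Ad G g (ub j)) (\<rho> (Ad G g (us j)) w))"
    by (simp add: pg.sum compatible[OF g] w_def)
  also have "\<dots> = (\<Sum>j\<in>P. \<Sum>k\<in>P. s (BK (us k) (Ad G g (ub j))) (\<rho> (ub k) (\<rho> (Ad G g (us j)) w)))"
  proof (rule sum.cong[OF refl])
    fix j assume "j \<in> P"
    then have "Ad G g (ub j) \<in> pp" using ub Ad_p[OF g] by blast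
    from arg_cong[OF exp_p[OF this], of "\<lambda>Z. \<rho> Z (\<rho> (Ad G g (us j)) w)"]
    show "\<rho> (Ad G g (ub j)) (\<rho> (Ad G g (us j)) w) =
      (\<Sum>k\<in>P. s (BK (us k) (Ad G g (ub j))) (\<rho> (ub k) (\<rho> (Ad G g (us j)) w)))"
      by (simp only: L.sum L.scale)
  qed
  also have "\<dots> = (\<Sum>k\<in>P. \<Sum>j\<in>P. s (BK (us k) (Ad G g (ub j))) (\<rho> (ub k) (\<rho> (Ad G g (us j)) w)))"
    by (rule sum.swap)
  also have "\<dots> = (\<Sum>k\<in>P. \<rho> (ub k) (\<rho> (us k) w))"
  proof (rule sum.cong[OF refl])
    fix k assume k: "k \<in> P"
    let ?Y = "Ad G (inv g) (us k)"
    \<comment> \<open>Invariance of B moves Ad g from \<open>ub j\<close> to its inverse on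
      \<open>us k\<close>; stability of \<open>pm\<close> under the inverse then allows the
      expansion \<open>exp_m\<close>.\<close>
    have Y: "?Y \<in> pm" using Ad_m[OF KG_group(2)[OF g]] us[OF k] by blast
    have c: "BK (us k) (Ad G g (ub j)) = BK ?Y (ub j)" for j
      using A(5)[of ?Y "ub j"] by (simp add: A(4))
    have "us k = Ad G g ?Y" by (simp add: A(4))
    also have "\<dots> = Ad G g (\<Sum>j\<in>P. BK ?Y (ub j) *s us j)" using exp_m[OF Y] by simp
    also have "\<dots> = (\<Sum>j\<in>P. BK ?Y (ub j) *s Ad G g (us j))" by (simp add: A.sum A.scale)
    finally have "us k = (\<Sum>j\<in>P. BK ?Y (ub j) *s Ad G g (us j))" .
    from arg_cong[OF this, of "\<lambda>Z. \<rho> Z w"]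
    have "\<rho> (us k) w = (\<Sum>j\<in>P. s (BK ?Y (ub j)) (\<rho> (Ad G g (us j)) w))"
      by (simp only: L.sum L.scale)
    then show "(\<Sum>j\<in>P. s (BK (us k) (Ad G g (ub j))) (\<rho> (ub k) (\<rho> (Ad G g (us j)) w))) = \<rho> (ub k) (\<rho> (us k) w)"
      by (simp add: c R.sum R.scale)
  qed
  finally have "\<pi> g (\<Sum>j\<in>P. \<rho> (ub j) (\<rho> (us j) v)) = (\<Sum>k\<in>P. \<rho> (ub k) (\<rho> (us k) w))" .
  then show ?thesis by (simp add: w_def)
qed

text \<open>Skewness is given on the real form. In the complex-linear extension a factor i changes
  to its conjugate when it passes to the second argument, whence \<open>conj_vec\<close>.\<close>

lemma rho_conj_adjoint:
  assumes h: "unitary_form KG s \<rho> \<pi> h"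
  shows "h (\<rho> Z v) w = - h v (\<rho> (conj_vec Z) w)"
proof -
  interpret vs: vector_space s by (rule vector_space)
  interpret L: Vector_Spaces.linear "(*s)" s "\<lambda>Z. \<rho> Z x" for x by (rule rho_linear_left)
  have hp: "positive_hermitian_form s h" and sk: "\<And>X v w. h (\<rho> (cvec X) v) w = - h v (\<rho> (cvec X) w)"
    using h by (auto simp: unitary_form_def)
  interpret hermitian_space s UNIV h
    by (rule hermitian_spaceI[OF vector_space hp]) (simp add: vs.subspace_UNIV)
  define a b where "a = cvec (re_vec Z)" "b = cvec (im_vec Z)"
  have Z: "Z = a + \<i> *s b" unfolding a_b_def by (rule cvec_decomp)
  have "conj_vec Z = a + (- \<i>) *s b" by (subst Z) (simp add: a_b_def cvec_eq_iff)
  then have "h v (\<rho> (conj_vec Z) w) = h v (\<rho> a w) + \<i> * h v (\<rho> b w)"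
    by (simp add: L.add L.scale h_right del: vec.scale_minus_left)
  moreover have "h (\<rho> Z v) w = h (\<rho> a v) w + \<i> * h (\<rho> b v) w"
    by (subst Z) (simp add: L.add L.scale h_add h_scale)
  ultimately show ?thesis using sk[of "re_vec Z" v w] sk[of "im_vec Z" v w] by (simp add: a_b_def)
qed

end

section \<open>Adjunction for the determinant form\<close>

context cartan_pair
begin

abbreviation dagger :: "complex^'n \<Rightarrow> complex^'n" where "dagger X \<equiv> - \<theta>c (conj_vec X)"

lemma herm_u_dagger: "hu X Y = 2 * BK X (dagger Y)"
  by (simp add: herm_u_def kill_simps)

lemma herm_u_dagger_left: "hu X Y = cnj (2 * BK (dagger X) Y)"
proof -
  have "cnj (BK (dagger X) Y) = BK (conj_vec (dagger X)) (conj_vec Y)" by (rule kill_conj[symmetric])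
  also have "conj_vec (dagger X) = - \<theta>c X" by (simp add: thetac_conj[symmetric])
  also have "BK (- \<theta>c X) (conj_vec Y) = - BK X (\<theta>c (conj_vec Y))"
    using kill_theta[of X "\<theta>c (conj_vec Y)"] by (simp add: kill_simps thetac_simps)
  finally show ?thesis by (simp add: herm_u_def)
qed

text \<open>Wedging with Y adds a row or a column to the Gram matrix, and Laplace expansion along it
  reproduces the contraction formula; the 2 in \<open>hu\<close> is the 2 of the Clifford action.
  With the contraction in the second argument the coefficients are conjugated, which
  \<open>herm_u_dagger_left\<close> supplies.\<close>

lemma tensor_form_adjoint:
  assumes sp: "spin_space s BK n ub us" and u: "u = vec.span (ub ` {..<n})"
    and H: "tensor_form G \<theta> s h u H" and Y: "Y \<in> u"
    and x: "x \<in> V_tensor_S s BK u" and y: "y \<in> V_tensor_S s BK u"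
  shows "H (cl_u s BK Y x) y = H x (cl_ubar s (dagger Y) y)"
    "H y (cl_u s BK Y x) = H (cl_ubar s (dagger Y) y) x"
proof -
  interpret spin_space s BK n ub us by (rule sp)
  have Hl: "H (x + y) z = H x z + H y z" "H (sf c x) z = c * H x z" "H z (x + y) = H z x + H z y"
     "H z (sf c x) = cnj c * H z x" if "x \<in> VS" "y \<in> VS" "z \<in> VS" for x y z c
    using H that unfolding tensor_form_def u by blast+
  have Hd: "H (decomposable s BK v Ys) (decomposable s BK v' Ys') = h v v' * gram_det hu Ys Ys'"
    if "set Ys \<subseteq> U" "set Ys' \<subseteq> U" for v v' Ys Ys'
    using H that unfolding tensor_form_def u by blast
  have H0: "H 0 z = 0" "H z 0 = 0" if "z \<in> VS" for z
    using Hl(2)[OF that that that, of 0] Hl(4)[OF that that that, of 0] by simp_all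
  have Hsc: "H (sf c x) z = c * H x z" "H z (sf c x) = cnj c * H z x" if "x \<in> VS" "z \<in> VS" for x z c
    using Hl(2,4)[OF that(1) that(1) that(2)] by blast+
  have Hs1: "(\<And>i. i \<in> I \<Longrightarrow> g i \<in> VS) \<Longrightarrow> z \<in> VS \<Longrightarrow> H (\<Sum>i\<in>I. sf (c i) (g i)) z = (\<Sum>i\<in>I. c i * H (g i) z)"
    for I :: "nat set" and c g z
    by (induction I rule: infinite_finite_induct) (simp_all add: H0 Hl(1) Hsc VS_closed)
  have Hs2: "(\<And>i. i \<in> I \<Longrightarrow> g i \<in> VS) \<Longrightarrow> z \<in> VS \<Longrightarrow> H z (\<Sum>i\<in>I. sf (c i) (g i)) = (\<Sum>i\<in>I. cnj (c i) * H z (g i))"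
    for I :: "nat set" and c g z
    by (induction I rule: infinite_finite_induct) (simp_all add: H0 Hl(3) Hsc VS_closed)
  have rm: "set (remove_at j Ys) \<subseteq> U" if "set Ys \<subseteq> U" for j Ys
    using that set_take_subset[of j Ys] set_drop_subset[of "Suc j" Ys] by (auto simp: remove_at_def)
  have xy: "x \<in> VS" "y \<in> VS" and YU: "Y \<in> U" using x y Y u by auto
  have "H (e Y x) y = H x (f (dagger Y) y) \<and> H y (e Y x) = H (f (dagger Y) y) x"
    using xy(1)
  proof (induction rule: VS_decomposable_induct)
    case (decomposable v Ys)
    note Ys = decomposable
    have xV: "decomposable s BK v Ys \<in> VS" by (rule decomposable_VS[OF Ys])
    from xy(2) show ?case
    proof (induction rule: VS_decomposable_induct)
      case (decomposable v' Ys')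
      note Ys' = decomposable
      have dV: "decomposable s BK v' (remove_at j Ys') \<in> VS" for j by (rule decomposable_VS[OF rm[OF Ys']])
      have YYs: "set (Y # Ys) \<subseteq> U" using YU Ys by simp
      have fe: "f (dagger Y) (decomposable s BK v' Ys') =
        (\<Sum>j<length Ys'. sf (2 * (-1) ^ j * BK (dagger Y) (Ys' ! j)) (decomposable s BK v' (remove_at j Ys')))"
        by (rule cl_ubar_decomposable[OF vector_space_axioms])
      have "H (e Y (decomposable s BK v Ys)) (decomposable s BK v' Ys') =
        (\<Sum>j<length Ys'. cnj (2 * (-1) ^ j * BK (dagger Y) (Ys' ! j)) * (h v v' * gram_det hu Ys (remove_at j Ys')))"
        unfolding decomposable_Cons[symmetric] Hd[OF YYs Ys'] gram_det_Cons_left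
        by (simp add: herm_u_dagger_left[of Y] sum_distrib_left ac_simps)
      also have "\<dots> = H (decomposable s BK v Ys) (f (dagger Y) (decomposable s BK v' Ys'))"
        unfolding fe by (subst Hs2) (use dV xV in \<open>simp_all add: Hd[OF Ys rm[OF Ys']]\<close>)
      finally have 1: "H (e Y (decomposable s BK v Ys)) (decomposable s BK v' Ys') =
        H (decomposable s BK v Ys) (f (dagger Y) (decomposable s BK v' Ys'))" .
      have "H (decomposable s BK v' Ys') (e Y (decomposable s BK v Ys)) =
        (\<Sum>j<length Ys'. (2 * (-1) ^ j * BK (dagger Y) (Ys' ! j)) * (h v' v * gram_det hu (remove_at j Ys') Ys))"
        unfolding decomposable_Cons[symmetric] Hd[OF Ys' YYs] gram_det_Cons_right
        by (simp add: herm_u_dagger[of _ Y] kill_sym[of _ "dagger Y"] sum_distrib_left ac_simps)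
      also have "\<dots> = H (f (dagger Y) (decomposable s BK v' Ys')) (decomposable s BK v Ys)"
        unfolding fe by (subst Hs1) (use dV xV in \<open>simp_all add: Hd[OF rm[OF Ys'] Ys]\<close>)
      finally show ?case using 1 by blast
    next
      case (add a b)
      have V: "e Y (decomposable s BK v Ys) \<in> VS" "f (dagger Y) a \<in> VS" "f (dagger Y) b \<in> VS"
        using add xV YU by (simp_all add: VS_e VS_f)
      show ?case using add V xV by (simp add: f_simps Hl(1)[of a b] Hl(3)[of a b]
        Hl(1)[of "f (dagger Y) a" "f (dagger Y) b"] Hl(3)[of "f (dagger Y) a" "f (dagger Y) b"])
    qed
  next
    case (add a b)
    have V: "e Y a \<in> VS" "e Y b \<in> VS" "f (dagger Y) y \<in> VS" using add YU xy by (simp_all add: VS_e VS_f)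
    show ?case using add V xy by (simp add: e_simps Hl(1)[of a b] Hl(3)[of a b]
        Hl(1)[of "e Y a" "e Y b"] Hl(3)[of "e Y a" "e Y b"])
  qed
  then show "H (e Y x) y = H x (f (dagger Y) y)" "H y (e Y x) = H (f (dagger Y) y) x" by blast+
qed

end

section \<open>Adapted bases and the theorem\<close>

lemma sum_of_2: "sum_of [A, B] = {a + b |a b. a \<in> A \<and> b \<in> B}"
proof -
  have "sum_of [A, B] = sum_list ` (\<lambda>(a, b). [a, b]) ` (A \<times> B)" unfolding sum_of_def listset_2 ..
  also have "\<dots> = (\<lambda>(a, b). a + b) ` (A \<times> B)" unfolding image_image by (rule image_cong) auto
  finally show ?thesis by auto
qed

section \<open>The Cartan decomposition and orthonormal bases of u\<close>

context cartan_pair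
begin

lemma k_part_iff: "Z \<in> k_part \<theta> \<longleftrightarrow> \<theta>c Z = Z" and p_part_iff: "Z \<in> p_part \<theta> \<longleftrightarrow> \<theta>c Z = - Z"
  by (simp_all add: k_part_def p_part_def)

lemma k_part_subspace: "vec.subspace (k_part \<theta>)"
  by (auto simp: vec.subspace_def k_part_iff thetac_simps)

lemma kill_k_p: "X \<in> k_part \<theta> \<Longrightarrow> Y \<in> p_part \<theta> \<Longrightarrow> BK X Y = 0"
proof -
  assume "X \<in> k_part \<theta>" "Y \<in> p_part \<theta>"
  then have "- BK X Y = BK X Y" using kill_theta[of X Y] by (simp add: k_part_iff p_part_iff kill_simps)
  then show "BK X Y = 0" by simp
qed

lemma conj_k_p: "X \<in> k_part \<theta> \<Longrightarrow> conj_vec X \<in> k_part \<theta>" "X \<in> p_part \<theta> \<Longrightarrow> conj_vec X \<in> p_part \<theta>"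
  by (simp_all add: k_part_iff p_part_iff thetac_conj)

lemma br_p_p: "X \<in> p_part \<theta> \<Longrightarrow> Y \<in> p_part \<theta> \<Longrightarrow> br X Y \<in> k_part \<theta>"
  by (simp add: k_part_iff p_part_iff thetac_br br_simps)

definition half_form :: "complex^'n \<Rightarrow> complex^'n \<Rightarrow> complex" where
  "half_form X Y = BK X (dagger Y)"

lemma half_form_hermitian: "hermitian_space (*s) UNIV half_form"
proof -
  have e: "half_form X Y = hu X Y / 2" for X Y by (simp add: half_form_def herm_u_dagger)
  have h: "hu (x + y) z = hu x z + hu y z" "hu (c *s x) y = c * hu x y" "hu y x = cnj (hu x y)"
    "x \<noteq> 0 \<Longrightarrow> Re (hu x x) > 0" for x y z c
    using herm_u_positive unfolding positive_hermitian_form_def by blast+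
  have "positive_hermitian_form (*s) half_form"
    unfolding positive_hermitian_form_def
  proof (intro conjI allI impI)
    fix x y z :: "complex^'n" and c
    show "half_form (x + y) z = half_form x z + half_form y z" by (simp add: e h(1) add_divide_distrib)
    show "half_form (c *s x) y = c * half_form x y" by (simp add: e h(2))
    show "half_form y x = cnj (half_form x y)" unfolding e using h(3)[of y x] by simp
    show "x \<noteq> 0 \<Longrightarrow> Re (half_form x x) > 0" using h(4)[of x] by (simp add: e)
  qed
  then show ?thesis by (rule hermitian_spaceI[OF vec.vector_space_axioms]) (rule vec.subspace_UNIV)
qed

lemma dagger_simps: "dagger (X + Y) = dagger X + dagger Y" "dagger (c *s X) = cnj c *s dagger X"
  "dagger (br X Y) = - br (dagger X) (dagger Y)" "dagger (dagger X) = X"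
  by (simp_all add: thetac_simps br_conj thetac_br br_simps thetac_conj[symmetric])

text \<open>The basis is orthonormal for half of the Hermitian form; the factor makes \<open>- \<theta> (conj u\<^sub>i)\<close> the dual basis.\<close>
lemma adapted_basis:
  assumes u: "vec.subspace u" and pp: "vec.subspace pp" "pp \<subseteq> p_part \<theta>" "pp \<subseteq> u"
    and split: "\<forall>x\<in>u. \<exists>a\<in>u \<inter> k_part \<theta>. \<exists>b\<in>pp. x = a + b"
  shows "\<exists>(N :: nat) (ub :: nat \<Rightarrow> complex^'n) P. P \<subseteq> {..<N} \<and> vec.span (ub ` {..<N}) = u \<and>
    vec.span ((\<lambda>i. dagger (ub i)) ` {..<N}) = conj_vec ` u \<and>
    (\<forall>i\<in>P. ub i \<in> pp) \<and> (\<forall>i<N. i \<notin> P \<longrightarrow> ub i \<in> k_part \<theta>) \<and>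
    (\<forall>i<N. \<forall>j<N. BK (dagger (ub i)) (ub j) = (if i = j then 1 else 0))"
proof -
  interpret hf: hermitian_space "(*s)" UNIV half_form by (rule half_form_hermitian)
  have basis: "\<exists>m b. hf.orthonormal m b \<and> vec.span (b ` {..<m}) = W" if W: "vec.subspace W" for W :: "(complex^'n) set"
  proof -
    obtain S where S: "S \<subseteq> W" "vec.independent S" "W \<subseteq> vec.span S" by (rule vec.maximal_independent_subset)
    have "vec.span S = W" using S vec.span_minimal[OF S(1) W] by auto
    then show ?thesis using hf.orthonormal_basis[OF vec.finiteI_independent[OF S(2)]] by auto
  qed
  have "vec.subspace (u \<inter> k_part \<theta>)" using u k_part_subspace by (rule vec.subspace_inter)
  then obtain m1 b1 where b1: "hf.orthonormal m1 b1" "vec.span (b1 ` {..<m1}) = u \<inter> k_part \<theta>" using basis by blast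
  obtain m2 b2 where b2: "hf.orthonormal m2 b2" "vec.span (b2 ` {..<m2}) = pp" using basis[OF pp(1)] by blast
  define ub where "ub i = (if i < m1 then b1 i else b2 (i - m1))" for i
  define N where "N = m1 + m2"
  define P where "P = {m1..<N}"
  have k1: "b1 i \<in> u \<inter> k_part \<theta>" if "i < m1" for i unfolding b1(2)[symmetric] using that by (auto intro: vec.span_base)
  have p2: "b2 i \<in> pp" if "i < m2" for i unfolding b2(2)[symmetric] using that by (auto intro: vec.span_base)
  have img: "ub ` {..<N} = b1 ` {..<m1} \<union> b2 ` {..<m2}"
  proof -
    have "{..<N} = {..<m1} \<union> (\<lambda>i. i + m1) ` {..<m2}"
    proof (intro equalityI subsetI)
      fix i assume "i \<in> {..<N}"
      then show "i \<in> {..<m1} \<union> (\<lambda>i. i + m1) ` {..<m2}"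
        by (cases "i < m1") (auto simp: N_def image_iff intro!: bexI[of _ "i - m1"])
    qed (auto simp: N_def)
    then have "ub ` {..<N} = ub ` {..<m1} \<union> (\<lambda>i. ub (i + m1)) ` {..<m2}" by (simp only: image_Un image_image)
    moreover have "ub ` {..<m1} = b1 ` {..<m1}" by (rule image_cong) (simp_all add: ub_def)
    moreover have "(\<lambda>i. ub (i + m1)) ` {..<m2} = b2 ` {..<m2}" by (rule image_cong) (simp_all add: ub_def)
    ultimately show ?thesis by simp
  qed
  have ubP: "ub i \<in> pp" if "i \<in> P" for i using that p2[of "i - m1"] by (auto simp: P_def ub_def N_def)
  have ubK: "ub i \<in> k_part \<theta>" if "i < N" "i \<notin> P" for i using that k1[of i] by (auto simp: P_def ub_def)
  have span: "vec.span (ub ` {..<N}) = u"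
  proof
    have "ub ` {..<N} \<subseteq> u" unfolding img using k1 p2 pp(3) by auto
    then show "vec.span (ub ` {..<N}) \<subseteq> u" using u by (rule vec.span_minimal)
    show "u \<subseteq> vec.span (ub ` {..<N})"
    proof
      fix x assume "x \<in> u"
      then obtain a b where ab: "a \<in> u \<inter> k_part \<theta>" "b \<in> pp" "x = a + b" using split by blast
      have "a \<in> vec.span (ub ` {..<N})" "b \<in> vec.span (ub ` {..<N})"
        using ab(1,2) vec.span_mono[of "b1 ` {..<m1}" "ub ` {..<N}"] vec.span_mono[of "b2 ` {..<m2}" "ub ` {..<N}"]
        unfolding img b1(2)[symmetric] b2(2)[symmetric] by blast+
      then show "x \<in> vec.span (ub ` {..<N})" using ab(3) by (simp add: vec.span_add)
    qed
  qed
  have th: "\<theta>c (ub i) = (if i \<in> P then - ub i else ub i)" if "i < N" for i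
    using ubP[of i] ubK[of i] that pp(2) by (auto simp: k_part_iff p_part_iff)
  have dg: "dagger (ub i) = (if i \<in> P then conj_vec (ub i) else - conj_vec (ub i))" if "i < N" for i
    using th[OF that] by (simp add: thetac_conj)
  have cu: "vec.subspace (conj_vec ` u)"
    unfolding vec.subspace_def
  proof (intro conjI ballI allI)
    show "0 \<in> conj_vec ` u" using vec.subspace_0[OF u] conj_vec_simps(4) by (metis image_eqI)
    fix x y c assume "x \<in> conj_vec ` u"
    then obtain x' where x: "x' \<in> u" "x = conj_vec x'" by auto
    then show "c *s x \<in> conj_vec ` u"
      using vec.subspace_scale[OF u x(1), of "cnj c"] by (intro image_eqI[of _ _ "cnj c *s x'"]) simp_all
    assume "y \<in> conj_vec ` u"
    then obtain y' where y: "y' \<in> u" "y = conj_vec y'" by auto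
    then show "x + y \<in> conj_vec ` u"
      using vec.subspace_add[OF u x(1) y(1)] x(2) by (intro image_eqI[of _ _ "x' + y'"]) simp_all
  qed
  have span': "vec.span ((\<lambda>i. dagger (ub i)) ` {..<N}) = conj_vec ` u"
  proof
    have ub_u: "ub i \<in> u" if "i < N" for i using that span vec.span_base[of "ub i" "ub ` {..<N}"] by auto
    have "dagger (ub i) \<in> conj_vec ` u" if "i < N" for i
      using dg[OF that] ub_u[OF that] vec.subspace_neg[OF cu, of "conj_vec (ub i)"] by (simp split: if_splits)
    then show "vec.span ((\<lambda>i. dagger (ub i)) ` {..<N}) \<subseteq> conj_vec ` u"
      by (intro vec.span_minimal[OF _ cu]) auto
    have "conj_vec x \<in> vec.span ((\<lambda>i. dagger (ub i)) ` {..<N})" if "x \<in> vec.span (ub ` {..<N})" for x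
      using that
    proof (induction rule: vec.span_induct_alt)
      case base
      then show ?case by (simp add: vec.span_zero)
    next
      case (step c x y)
      then obtain i where i: "i < N" "x = ub i" by auto
      have "dagger (ub i) \<in> vec.span ((\<lambda>i. dagger (ub i)) ` {..<N})" using i by (auto intro: vec.span_base)
      then have "conj_vec x \<in> vec.span ((\<lambda>i. dagger (ub i)) ` {..<N})"
        using dg[OF i(1)] i(2) vec.span_neg[of "dagger (ub i)"] by (auto split: if_splits)
      then show ?case using step by (simp add: vec.span_add vec.span_scale)
    qed
    then show "conj_vec ` u \<subseteq> vec.span ((\<lambda>i. dagger (ub i)) ` {..<N})" using span by auto
  qed
  \<comment> \<open>k and p are orthogonal for B and \<open>dagger\<close> preserves p, so the
    orthonormal bases of the two pieces combine.\<close>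
  have orth: "half_form (b2 j) (b1 i) = 0" "half_form (b1 i) (b2 j) = 0" if "i < m1" "j < m2" for i j
  proof -
    have k: "b1 i \<in> k_part \<theta>" and p: "b2 j \<in> p_part \<theta>" using k1 p2 that pp(2) by auto
    have "dagger (b2 j) \<in> p_part \<theta>" using p by (simp add: p_part_iff thetac_simps thetac_conj)
    then show "half_form (b1 i) (b2 j) = 0" using kill_k_p[OF k] by (simp add: half_form_def)
    then show "half_form (b2 j) (b1 i) = 0" using hf.h_sym[of "b1 i" "b2 j"] by simp
  qed
  have dual: "BK (dagger (ub i)) (ub j) = (if i = j then 1 else 0)" if "i < N" "j < N" for i j
  proof -
    have "BK (dagger (ub i)) (ub j) = half_form (ub j) (ub i)" by (simp only: half_form_def kill_sym[of "dagger (ub i)"])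
    also have "\<dots> = (if i = j then 1 else 0)"
      using b1(1) b2(1) that orth unfolding hf.orthonormal_def ub_def N_def by auto
    finally show ?thesis .
  qed
  have "P \<subseteq> {..<N}" by (auto simp: P_def)
  then show ?thesis using span span' ubP ubK dual by (intro exI conjI ballI allI impI)
qed

end

section \<open>Assembly for a Hermitian symmetric pair\<close>

context gK_module
begin

lemma hodge_u_homology:
  assumes hs: "hermitian_symmetric G \<theta> \<Theta> pp pm"
    and tp: "theta_stable_parabolic G \<theta> q l u"
    and "l \<subseteq> k_part \<theta>" and ppu: "pp \<subseteq> u"
    and adm: "admissible KG s \<pi>" and uni: "unitary_form KG s \<rho> \<pi> h"
    and db: "dual_bases BK u n ub0 us0"
    and tf: "tensor_form G \<theta> s h u H"
  defines "VS \<equiv> V_tensor_S s BK u"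
    and "C \<equiv> C_op G s \<rho> n ub0 us0"
    and "Cm \<equiv> C_minus G s \<rho> n ub0 us0"
  shows "kernel_on VS (laplacian VS H C) = kernel_on VS Cm \<inter> kernel_on VS (adjoint_on VS H Cm) \<and>
    direct_sum VS [kernel_on VS (laplacian VS H C), Cm ` VS, adjoint_on VS H Cm ` VS] \<and>
    direct_sum (kernel_on VS Cm) [kernel_on VS (laplacian VS H C), Cm ` VS] \<and>
    direct_sum (kernel_on VS (adjoint_on VS H Cm)) [kernel_on VS (laplacian VS H C), adjoint_on VS H Cm ` VS]"
proof -
  note hs' = hs[unfolded hermitian_symmetric_def parabolic_decomposition_def nilradical_def]
  have pp0: "direct_sum (p_part \<theta>) [pp, pm]" "lie_subalgebra br pp" "lie_subalgebra br pm"
    "\<forall>x\<in>pp. \<forall>y\<in>pp. br x y = 0" "\<forall>x\<in>pm. \<forall>y\<in>pm. br x y = 0"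
    "\<forall>g\<in>KG. Ad G g ` pp \<subseteq> pp \<and> Ad G g ` pm \<subseteq> pm"
    "conj_vec ` pp = pm" "lie_ideal br pp (sum_of [k_part \<theta>, pp])"
    using hs' by - (elim conjE, assumption)+
  have Ad_p: "Ad G g ` pp \<subseteq> pp" "Ad G g ` pm \<subseteq> pm" if "g \<in> KG" for g using pp0(6) that by simp_all
  have sub_pp: "vec.subspace pp" and sub_pm: "vec.subspace pm" using pp0(2,3) by (simp_all add: lie_subalgebra_def)
  have pp_p: "pp \<subseteq> p_part \<theta>"
  proof
    fix a assume "a \<in> pp"
    then have "a + 0 \<in> p_part \<theta>" using direct_sum_2D(2)[OF pp0(1)] vec.subspace_0[OF sub_pm] by blast
    then show "a \<in> p_part \<theta>" by simp
  qed
  have pm_p: "pm \<subseteq> p_part \<theta>" using pp0(7) pp_p conj_k_p(2) by auto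
  have k_pp: "br X Y \<in> pp" if "X \<in> k_part \<theta>" "Y \<in> pp" for X Y
  proof -
    have "X + 0 \<in> sum_of [k_part \<theta>, pp]" unfolding sum_of_2 using that(1) vec.subspace_0[OF sub_pp] by blast
    then show ?thesis using pp0(8) that(2) unfolding lie_ideal_def by auto
  qed
  have pm_conj: "Z \<in> pm \<longleftrightarrow> conj_vec Z \<in> pp" for Z
    unfolding pp0(7)[symmetric] by (auto simp: image_iff) (metis conj_vec_simps(6))
  \<comment> \<open>The ideal property of p^+ in k + p^+ is carried to p^- by conjugation, which
    preserves k.\<close>
  have k_pm: "br X Y \<in> pm" if "X \<in> k_part \<theta>" "Y \<in> pm" for X Y
    unfolding pm_conj br_conj using k_pp conj_k_p(1) that by (simp add: pm_conj)

  note tp' = tp[unfolded theta_stable_parabolic_def parabolic_decomposition_def nilradical_def parabolic_def]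
  have tp0: "direct_sum q [l, u]" "lie_ideal br u q" "lie_nilpotent br u" "lie_subalgebra br q"
      "\<theta>c ` q = q" "direct_sum UNIV [conj_vec ` u, l, u]" "lie_subalgebra br l"
    using tp' by - (elim conjE, assumption)+
  have sub_u: "vec.subspace u" "u \<subseteq> q" and u_br: "\<And>x y. x \<in> u \<Longrightarrow> y \<in> u \<Longrightarrow> br x y \<in> u"
    using tp0(2) unfolding lie_ideal_def by auto
  have sub_q: "vec.subspace q" and sub_l: "vec.subspace l" using tp0(4,7) by (simp_all add: lie_subalgebra_def)
  \<comment> \<open>The p-part z of x lies in q because q is \<theta>-stable. Its p^- component lies
    in conj u and, since p^+ \<subseteq> u, also in q = l + u; these meet only in 0 by the
    triangular decomposition of g, so z lies in p^+.\<close>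
  have split: "\<exists>a\<in>u \<inter> k_part \<theta>. \<exists>b\<in>pp. x = a + b" if x: "x \<in> u" for x
  proof -
    have tq: "\<theta>c x \<in> q" using x sub_u tp0(5) by blast
    define z where "z = (1/2) *s (x - \<theta>c x)"
    have zq: "z \<in> q" unfolding z_def using x sub_u(2) tq sub_q by (intro vec.subspace_scale vec.subspace_diff) auto
    have "z \<in> p_part \<theta>" by (simp add: z_def p_part_iff thetac_simps vec_eq_iff)
    then obtain z1 z2 where z: "z1 \<in> pp" "z2 \<in> pm" "z = z1 + z2" using direct_sum_2D(1)[OF pp0(1)] by blast
    have "z1 \<in> q" using z(1) ppu sub_u(2) by auto
    then have "z2 \<in> q" using z(3) zq vec.subspace_diff[OF sub_q zq, of z1] by simp
    then obtain a b where ab: "a \<in> l" "b \<in> u" "z2 = a + b" using direct_sum_2D(1)[OF tp0(1)] by blast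
    have z2u: "z2 \<in> conj_vec ` u" using z(2) pp0(7) ppu by blast
    have zero: "0 \<in> l" "0 \<in> u"
      using vec.subspace_0[OF sub_l] vec.subspace_0[OF sub_u(1)] by simp_all
    then have zero_conj: "0 \<in> conj_vec ` u" using conj_vec_simps(4) image_eqI[of 0 conj_vec 0 u] by simp
    have "z2 = 0 \<and> 0 = a \<and> 0 = b"
      by (rule direct_sum_3_unique[OF tp0(6) z2u zero zero_conj ab(1,2)]) (simp add: ab(3))
    then have zpp: "z \<in> pp" using z by simp
    have "x - z \<in> u" using x zpp ppu vec.subspace_diff[OF sub_u(1)] by auto
    moreover have "x - z \<in> k_part \<theta>" by (simp add: z_def k_part_iff thetac_simps vec_eq_iff field_simps)
    ultimately show ?thesis using zpp by (intro bexI[of _ "x - z"] bexI[of _ z]) auto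
  qed

  then have splits: "\<forall>x\<in>u. \<exists>a\<in>u \<inter> k_part \<theta>. \<exists>b\<in>pp. x = a + b" by (intro ballI)
  obtain N :: nat and ub :: "nat \<Rightarrow> complex^'n" and P where bas: "P \<subseteq> {..<N}" "vec.span (ub ` {..<N}) = u"
    "vec.span ((\<lambda>i. dagger (ub i)) ` {..<N}) = conj_vec ` u"
    "\<forall>i\<in>P. ub i \<in> pp" "\<forall>i<N. i \<notin> P \<longrightarrow> ub i \<in> k_part \<theta>"
    "\<forall>i<N. \<forall>j<N. BK (dagger (ub i)) (ub j) = (if i = j then 1 else 0)"
    using adapted_basis[OF sub_u(1) sub_pp pp_p ppu splits] by (elim exE conjE)
  have ub_P: "ub i \<in> pp" if "i \<in> P" for i using bas(4) that ..
  have ub_K: "ub i \<in> k_part \<theta>" if "i < N" "i \<notin> P" for i using bas(5) that by blast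
  have dual: "BK (dagger (ub i)) (ub j) = (if i = j then 1 else 0)" if "i < N" "j < N" for i j
    using bas(6) that by blast
  define us where "us i = dagger (ub i)" for i
  have sp: "spin_space s BK N ub us"
    by (rule spin_spaceI[OF vector_space]) (simp only: us_def dual)
  interpret sp: spin_space s BK N ub us by (rule sp)
  have Uu: "sp.U = u" using bas(2) .
  have Ubu: "sp.Ub = conj_vec ` u" using bas(3) by (simp only: us_def[abs_def])
  \<comment> \<open>u is \<theta>-stable, because \<theta> only changes the sign of the p^+
    component in the splitting; up to \<theta> and a sign, \<open>dagger\<close> is
    conjugation.\<close>
  have dag_u: "dagger X \<in> u \<longleftrightarrow> X \<in> conj_vec ` u" for X
  proof -
    have tu: "\<theta>c X \<in> u" if X: "X \<in> u" for X
    proof -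
      obtain a b where ab: "a \<in> u" "a \<in> k_part \<theta>" "b \<in> pp" "X = a + b" using splits X by blast
      then have "\<theta>c X = a - b" using pp_p by (auto simp: thetac_simps k_part_iff p_part_iff)
      then show ?thesis using ab ppu vec.subspace_diff[OF sub_u(1)] by auto
    qed
    have neg: "- Z \<in> u \<longleftrightarrow> Z \<in> u" for Z using vec.subspace_neg[OF sub_u(1)] by force
    have "dagger X \<in> u \<longleftrightarrow> conj_vec X \<in> u"
      unfolding neg using tu[of "conj_vec X"] tu[of "\<theta>c (conj_vec X)"] by (auto simp: thetac_simps)
    also have "\<dots> \<longleftrightarrow> X \<in> conj_vec ` u" by (auto simp: image_iff) (metis conj_vec_simps(6))
    finally show ?thesis .
  qed
  have us_P: "us i \<in> pm" if "i \<in> P" for i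
  proof -
    have "\<theta>c (ub i) = - ub i" using ub_P[OF that] pp_p by (auto simp: p_part_iff)
    then have "us i = conj_vec (ub i)" by (simp add: us_def thetac_conj)
    then show ?thesis using ub_P[OF that] pp0(7) by blast
  qed
  have us_K: "us i \<in> k_part \<theta>" if "i < N" "i \<notin> P" for i
    using ub_K[OF that] by (simp add: us_def k_part_iff thetac_simps thetac_conj)
  have P_less: "i < N" if "i \<in> P" for i using bas(1) that by auto
  have finP: "finite P" using bas(1) finite_subset by blast
  have sumP: "(\<Sum>i<N. g i) = (\<Sum>i\<in>P. g i)" if "\<And>i. i < N \<Longrightarrow> i \<notin> P \<Longrightarrow> g i = 0" for g :: "nat \<Rightarrow> complex^'n"
    using bas(1) that by (intro sum.mono_neutral_right) auto
  have exp_p: "X = (\<Sum>k\<in>P. BK (us k) X *s ub k)" if "X \<in> pp" for X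
  proof -
    have "(\<Sum>i<N. BK (us i) X *s ub i) = (\<Sum>k\<in>P. BK (us k) X *s ub k)"
      using kill_k_p[OF us_K] that pp_p by (intro sumP) auto
    then show ?thesis using sp.expand_U[of X] that ppu Uu by auto
  qed
  have exp_m: "X = (\<Sum>k\<in>P. BK X (ub k) *s us k)" if "X \<in> pm" for X
  proof -
    have "BK X (ub i) = 0" if "i < N" "i \<notin> P" for i
      using kill_k_p[OF ub_K[OF that], of X] \<open>X \<in> pm\<close> pm_p kill_sym[of X] by auto
    then have "(\<Sum>i<N. BK X (ub i) *s us i) = (\<Sum>k\<in>P. BK X (ub k) *s us k)" by (intro sumP) simp
    moreover have "X \<in> conj_vec ` u" using that pp0(7) ppu by blast
    ultimately show ?thesis using sp.expand_Ub[of X] Ubu by simp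
  qed
  have trU: "(\<Sum>j<N. BK (us j) (br X (ub j))) = 0" if "X \<in> u" for X
    by (rule nilpotent_trace[OF sp Uu[symmetric] u_br tp0(3) that])
  \<comment> \<open>Transported from u by \<open>dagger\<close>, which is conjugate-linear,
    exchanges \<open>us j\<close> with \<open>ub j\<close> and reverses the sign of brackets; the
    two traces are negative conjugates of each other.\<close>
  have trUb: "(\<Sum>j<N. BK (br X (us j)) (ub j)) = 0" if X: "X \<in> conj_vec ` u" for X
  proof -
    have Y: "dagger X \<in> u" using X dag_u by blast
    have "BK (br X (us j)) (ub j) = - cnj (BK (us j) (br (dagger X) (ub j)))" for j
    proof -
      have "br X (us j) = - dagger (br (dagger X) (ub j))" by (simp only: dagger_simps us_def minus_minus)
      then have "BK (br X (us j)) (ub j) = - BK (dagger (br (dagger X) (ub j))) (ub j)" by (simp only: kill_simps)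
      also have "BK (dagger (br (dagger X) (ub j))) (ub j) = cnj (BK (br (dagger X) (ub j)) (us j))"
        using herm_u_dagger_left[of "br (dagger X) (ub j)" "ub j"] herm_u_dagger[of "br (dagger X) (ub j)" "ub j"]
        by (simp add: us_def complex_eq_iff)
      finally show ?thesis by (simp only: kill_sym[of "us j"])
    qed
    then have "(\<Sum>j<N. BK (br X (us j)) (ub j)) = - cnj (\<Sum>j<N. BK (us j) (br (dagger X) (ub j)))"
      by (simp add: sum_negf)
    then show ?thesis using trU[OF Y] by simp
  qed
  have Ub_br: "br X Y \<in> conj_vec ` u" if "X \<in> conj_vec ` u" "Y \<in> conj_vec ` u" for X Y
    using that u_br by (auto simp flip: br_conj)
  have tfD: "H (x + y) z = H x z + H y z" "H (scale_fun s c x) z = c * H x z" "H z (x + y) = H z x + H z y"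
    "H z (scale_fun s c x) = cnj c * H z x" if "x \<in> VS" "y \<in> VS" "z \<in> VS" for x y z c
    using tf that unfolding tensor_form_def VS_def by blast+
  have tfd: "H (decomposable s BK v []) (decomposable s BK w []) = h v w" for v w
  proof -
    have "H (decomposable s BK v []) (decomposable s BK w []) = h v w * gram_det hu [] []"
      using tf unfolding tensor_form_def by (metis empty_subsetI list.set(1))
    then show ?thesis by (simp add: gram_det_def)
  qed
  have VSe: "V_tensor_S s BK sp.U = VS" by (simp only: Uu VS_def)
  have sl: "spin_lie s BK N ub us br"
  proof (intro spin_lie.intro spin_lie_axioms.intro sp)
    show "br (X + Y) Z = br X Z + br Y Z" "br Z (X + Y) = br Z X + br Z Y" "br (c *s X) Z = c *s br X Z"
      "br Z (c *s X) = c *s br Z X" for X Y Z c by (fact br_simps)+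
    show "br X Y = - br Y X" for X Y by (rule br_antisym)
    show "br X (br Y Z) = br (br X Y) Z + br Y (br X Z)" for X Y Z by (rule br_jacobi)
    show "BK X Y = BK Y X" for X Y by (rule kill_sym)
    show "BK (br X Y) Z = BK X (br Y Z)" for X Y Z by (rule kill_invariant)
    show "br X Y \<in> sp.Ub" if "X \<in> sp.Ub" "Y \<in> sp.Ub" for X Y using Ub_br that unfolding Ubu by blast
    show "(\<Sum>j<N. BK (br X (us j)) (ub j)) = 0" if "X \<in> sp.Ub" for X using trUb that unfolding Ubu by blast
  qed
  have sh: "spin_hermitian s BK N ub us br P \<theta>c \<rho> conj_vec h H"
  proof (intro spin_hermitian.intro spin_adapted.intro sl spin_adapted_axioms.intro spin_hermitian_axioms.intro)
    show "P \<subseteq> {..<N}" by (rule bas(1))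
    show "lin_op \<theta>c" by (rule thetac_lin)
    show "\<theta>c (br X Y) = br (\<theta>c X) (\<theta>c Y)" for X Y by (rule thetac_br)
    show "\<theta>c (us i) = (if i \<in> P then - us i else us i)" if "i < N" for i
      using us_P[of i] us_K[OF that] pm_p by (auto simp: k_part_iff p_part_iff)
    show "\<theta>c (ub i) = (if i \<in> P then - ub i else ub i)" if "i < N" for i
      using ub_P[of i] ub_K[OF that] pp_p by (auto simp: k_part_iff p_part_iff)
    show "br (us i) (us j) = 0" if "i \<in> P" "j \<in> P" for i j using pp0(5) us_P that by blast
    show "br (us i) (ub j) = (\<Sum>k\<in>P. BK (us k) (br (us i) (ub j)) *s ub k)" if "i < N" "i \<notin> P" "j \<in> P" for i j
      by (rule exp_p[OF k_pp[OF us_K[OF that(1,2)] ub_P[OF that(3)]]])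
    show "br (us i) (us j) = (\<Sum>k\<in>P. BK (br (us i) (us j)) (ub k) *s us k)" if "i < N" "i \<notin> P" "j \<in> P" for i j
      by (rule exp_m[OF k_pm[OF us_K[OF that(1,2)] us_P[OF that(3)]]])
    show "spin_lie.is_rep s br \<rho>"
      unfolding spin_lie.is_rep_def[OF sl] spin_lie.linrep_def[OF sl]
      using rho_linear_left rho_linear_right rho_bracket by blast
    show "\<theta>c (\<theta>c X) = X" for X by (simp add: thetac_simps)
    show "conj_vec (conj_vec X) = X" "conj_vec (- X) = - conj_vec X" for X by simp_all
    show "\<theta>c (conj_vec X) = conj_vec (\<theta>c X)" for X by (rule thetac_conj)
    show "conj_vec (br X Y) = br (conj_vec X) (conj_vec Y)" for X Y by (rule br_conj)
    show "dagger (us i) = ub i" for i by (simp only: us_def dagger_simps)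
    show "br X Y \<in> sp.U" if "X \<in> sp.U" "Y \<in> sp.U" for X Y using u_br that unfolding Uu by blast
    show "(\<Sum>j<N. BK (us j) (br X (ub j))) = 0" if "X \<in> sp.U" for X using trU that unfolding Uu by blast
    show "positive_hermitian_form s h" using uni by (simp add: unitary_form_def)
    show "h (\<rho> Z v) w = - h v (\<rho> (conj_vec Z) w)" for Z v w by (rule rho_conj_adjoint[OF uni])
    show "H (x + y) z = H x z + H y z" "H z (x + y) = H z x + H z y"
      if "x \<in> V_tensor_S s BK sp.U" "y \<in> V_tensor_S s BK sp.U" "z \<in> V_tensor_S s BK sp.U" for x y z
      using tfD that unfolding VSe by blast+
    show "H (scale_fun s c x) z = c * H x z" "H z (scale_fun s c x) = cnj c * H z x"
      if "x \<in> V_tensor_S s BK sp.U" "z \<in> V_tensor_S s BK sp.U" for x z c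
      using tfD that unfolding VSe by blast+
    show "H (decomposable s BK v []) (decomposable s BK w []) = h v w" for v w by (rule tfd)
    show "H (cl_u s BK Y x) y = H x (cl_ubar s (dagger Y) y)" "H y (cl_u s BK Y x) = H (cl_ubar s (dagger Y) y) x"
      if "Y \<in> sp.U" "x \<in> V_tensor_S s BK sp.U" "y \<in> V_tensor_S s BK sp.U" for Y x y
      using tensor_form_adjoint[OF sp Uu[symmetric] tf] that unfolding Uu by blast+
  qed
  interpret sh: spin_hermitian s BK N ub us br P \<theta>c \<rho> conj_vec h H by (rule sh)
  interpret ur: unitary_rep s KG \<pi> h by (rule unitary_repI[OF uni adm])
  \<comment> \<open>\<open>Q\<close> commutes with K, so v lies in a finite-dimensional subspace
    stable under K and \<open>Q\<close>. Stability under K passes to k, which contains the basis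
    vectors outside P and all brackets of p^- with p^+.\<close>
  have fin: "\<exists>A. sp.subspace A \<and> finite_dimensional s A \<and> sh.stable A \<and> v \<in> A" for v
  proof -
    have comm: "sh.Q (\<pi> g w) = \<pi> g (sh.Q w)" if "g \<in> KG" for g w
      unfolding sh.Q_def
      by (rule invariant_operator_commutes[OF that finP us_P ub_P exp_p exp_m Ad_p])
    obtain A where A: "stable_subspace KG s \<pi> A" "finite_dimensional s A" "sh.Q ` A \<subseteq> A" "v \<in> A"
      using ur.vector_in_invariant_finite_dimensional[OF sh.Q_lin comm, of v] by blast
    have "br (us i) (ub j) \<in> k_part \<theta>" if "i \<in> P" "j \<in> P" for i j
      using br_p_p us_P[OF that(1)] ub_P[OF that(2)] pp_p pm_p by blast
    then have "sh.stable A"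
      unfolding sh.stable_def using A(3) stable_rho[OF A(1)] us_K ub_K by blast
    then show ?thesis using A by (auto simp: stable_subspace_def)
  qed
  note hd = sh.hodge[OF fin, unfolded VSe]
  have a: "spin_space s BK n ub0 us0"
    by (rule spin_spaceI[OF vector_space]) (use db in \<open>simp add: dual_bases_def\<close>)
  have db': "vec.span (ub0 ` {..<n}) = u" "vec.span (us0 ` {..<n}) = conj_vec ` u"
    using db by (simp_all add: dual_bases_def)
  \<comment> \<open>The given dual bases are arbitrary; on \<open>VS\<close> both operators agree
    with those formed from the adapted basis.\<close>
  have chg: "C x = sh.CC \<rho> x" "Cm x = sh.CM \<rho> x" if "x \<in> VS" for x
  proof -
    note cb = C_op_basis_change[OF a sp, unfolded db' Uu Ubu, OF refl refl rho_linear_left rho_linear_right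
        that[unfolded VS_def] u_br]
    show "C x = sh.CC \<rho> x"
      using cb(1) by (simp add: C_def C_op_def sh.CC_def sh.lin_def sh.cub_def)
    show "Cm x = sh.CM \<rho> x"
      using cb(2) by (simp add: Cm_def C_minus_def sh.CM_def sh.linm_def sh.cubm_def)
  qed
  \<comment> \<open>The choice in \<open>adjoint_on\<close> sees an operator only through its values
    on \<open>VS\<close>, so agreement there gives the same chosen adjoint.\<close>
  have adj_cong: "adjoint_on VS H f = adjoint_on VS H g" if "\<And>x. x \<in> VS \<Longrightarrow> f x = g x" for f g
    unfolding adjoint_on_def using that by (intro arg_cong[of _ _ Eps] ext) simp
  have adjC: "adjoint_on VS H C = adjoint_on VS H (sh.CC \<rho>)" "adjoint_on VS H Cm = adjoint_on VS H (sh.CM \<rho>)"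
    by (rule adj_cong, simp add: chg)+
  have adjC': "adjoint_on VS H C x = sh.CM sh.\<rho>\<theta> x" "adjoint_on VS H Cm x = sh.CC sh.\<rho>\<theta> x" if "x \<in> VS" for x
    using sh.adjoint_on_CC[of x] sh.adjoint_on_CM[of x] that unfolding VSe adjC by simp_all
  have V: "sh.CM sh.\<rho>\<theta> x \<in> VS" "sh.CC \<rho> x \<in> VS" if "x \<in> VS" for x
    using sh.VS_CM[OF sh.rho_theta_linrep, of x] sh.VS_CC[OF sh.rho_linrep, of x] that unfolding VSe by simp_all
  have lap: "laplacian VS H C x = sh.Lap x" if "x \<in> VS" for x
    using that by (simp add: laplacian_def sh.Lap_def adjC' chg V)
  have ker: "kernel_on VS (laplacian VS H C) = kernel_on VS sh.Lap" "kernel_on VS Cm = kernel_on VS (sh.CM \<rho>)"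
    "kernel_on VS (adjoint_on VS H Cm) = kernel_on VS (sh.CC sh.\<rho>\<theta>)"
    by (auto simp: kernel_on_def lap chg adjC')
  have img: "Cm ` VS = sh.CM \<rho> ` VS" "adjoint_on VS H Cm ` VS = sh.CC sh.\<rho>\<theta> ` VS"
    by (intro image_cong refl; simp add: chg adjC')+
  show ?thesis unfolding ker img using hd by blast
qed

end

theorem theorem7p3:
  fixes G :: "('a, 'n::finite) lie_grp"
    and \<theta> :: "real^'n \<Rightarrow> real^'n" and \<Theta> :: "'a \<Rightarrow> 'a"
    and pp pm q l u :: "(complex^'n) set"
    and s :: "complex \<Rightarrow> 'v::ab_group_add \<Rightarrow> 'v"
    and \<rho> :: "complex^'n \<Rightarrow> 'v \<Rightarrow> 'v" and \<pi> :: "'a \<Rightarrow> 'v \<Rightarrow> 'v"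
    and h :: "'v \<Rightarrow> 'v \<Rightarrow> complex"
    and n :: nat and ub us :: "nat \<Rightarrow> complex^'n"
    and H :: "((complex^'n) list \<Rightarrow> 'v) \<Rightarrow> ((complex^'n) list \<Rightarrow> 'v) \<Rightarrow> complex"
  assumes "cartan_pair G \<theta> \<Theta>"
    and "hermitian_symmetric G \<theta> \<Theta> pp pm"
    and "theta_stable_parabolic G \<theta> q l u"
    and "l \<subseteq> k_part \<theta>" and "pp \<subseteq> u"
    and "gK_module G \<theta> \<Theta> s \<rho> \<pi>"
    and "admissible (fixed_group G \<Theta>) s \<pi>"
    and "unitary_form (fixed_group G \<Theta>) s \<rho> \<pi> h"
    and "dual_bases (kill G) u n ub us"
    and "tensor_form G \<theta> s h u H"
  defines "VS \<equiv> V_tensor_S s (kill G) u"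
    and "C \<equiv> C_op G s \<rho> n ub us"
    and "Cm \<equiv> C_minus G s \<rho> n ub us"
  defines "Cm_adj \<equiv> adjoint_on VS H Cm"
    and "\<Delta> \<equiv> laplacian VS H C"
  shows "kernel_on VS \<Delta> = kernel_on VS Cm \<inter> kernel_on VS Cm_adj \<and>
    direct_sum VS [kernel_on VS \<Delta>, Cm ` VS, Cm_adj ` VS] \<and>
    direct_sum (kernel_on VS Cm) [kernel_on VS \<Delta>, Cm ` VS] \<and>
    direct_sum (kernel_on VS Cm_adj) [kernel_on VS \<Delta>, Cm_adj ` VS]"
  using gK_module.hodge_u_homology[OF assms(6,2,3,4,5,7,8,9,10)]
  unfolding assms(11-15) .

end
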